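(* Given a string $x$ of length $n$, one can determine, for every integer $k$ with $1 \leq k \leq n$, whether $x$ is $k$-cyclic periodic, in $\mathcal{O}(n \log n)$ total time and $\mathcal{O}(n)$ space.
   Context: For a string $u=u_1u_2\cdots u_k$ and $1\le \delta\le k$, the rotation $c_\delta(u)$ is $u_\delta\cdots u_k u_1\cdots u_{\delta-1}$; we write $v=c(u)$ if $v=c_\delta(u)$ for some $\delta$ (i.e. $v$ is a cyclic rotation of $u$). A string $x$ of length $n$ is $k$-cyclic periodic (with $k$-cyclic period $\ell$) if $k\ell=n$ and $x=u_1u_2\cdots u_\ell$ where every block $u_i$ has length $k$ and $u_i=c(u_j)$ for all $1\le i,j\le \ell$. *)

theory Defs
  imports Complex_Main "HOL-Library.Landau_Symbols"
begin

section \<open>Cyclic periodicity\<close>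

text \<open>\<open>rotate (\<delta> - 1) u\<close> is the rotation \<open>c\<^sub>\<delta>(u)\<close> that starts at the 1-based position \<open>\<delta>\<close> of \<open>u\<close>.\<close>

definition is_rotation_of :: "'a list \<Rightarrow> 'a list \<Rightarrow> bool" where
  "is_rotation_of v u \<longleftrightarrow> (\<exists>\<delta>\<in>{1..length u}. v = rotate (\<delta> - 1) u)"

definition has_cyclic_period :: "nat \<Rightarrow> nat \<Rightarrow> 'a list \<Rightarrow> bool" where
  "has_cyclic_period k l x \<longleftrightarrow>
     k * l = length x \<and>
     (\<exists>us. length us = l \<and> x = concat us \<and> (\<forall>u\<in>set us. length u = k) \<and>
        (\<forall>i<l. \<forall>j<l. is_rotation_of (us ! i) (us ! j)))"

definition cyclic_periodic :: "nat \<Rightarrow> 'a list \<Rightarrow> bool" where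
  "cyclic_periodic k x \<longleftrightarrow> (\<exists>l. has_cyclic_period k l x)"

section \<open>A word RAM\<close>

text \<open>
  The machine operates on \<open>w\<close>-bit words, represented as natural numbers below \<open>2 ^ w\<close>.
  It has registers, of which a given program mentions only a fixed finite number, and a
  word-addressed memory. Programs do not depend on \<open>w\<close>. Sums and products are reduced
  modulo \<open>2 ^ w\<close>, subtraction is truncated at \<open>0\<close>, division by \<open>0\<close> yields \<open>0\<close>, and
  comparisons yield \<open>1\<close> or \<open>0\<close>; conditions are true iff they are nonzero.
\<close>

datatype binop = Plus | Minus | Times | Div | Mod | Less | Equal

datatype exp = Const nat | Reg nat | Load exp | Op binop exp exp

datatype com =
    Skip
  | Assign nat exp
  | Store exp exp
  | Seq com com
  | Cond exp com com
  | While exp com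

type_synonym state = "(nat \<Rightarrow> nat) \<times> (nat \<Rightarrow> nat)" (* registers, memory *)

fun apply_op :: "binop \<Rightarrow> nat \<Rightarrow> nat \<Rightarrow> nat" where
  "apply_op Plus a b = a + b"
| "apply_op Minus a b = a - b"
| "apply_op Times a b = a * b"
| "apply_op Div a b = a div b"
| "apply_op Mod a b = a mod b"
| "apply_op Less a b = (if a < b then 1 else 0)"
| "apply_op Equal a b = (if a = b then 1 else 0)"

fun val :: "nat \<Rightarrow> state \<Rightarrow> exp \<Rightarrow> nat" where
  "val w s (Const c) = c mod 2 ^ w"
| "val w s (Reg r) = fst s r"
| "val w s (Load e) = snd s (val w s e)"
| "val w s (Op f a b) = apply_op f (val w s a) (val w s b) mod 2 ^ w"

text \<open>\<open>in_space w S s e\<close>: evaluating \<open>e\<close> reads only memory cells with addresses below \<open>S\<close>.\<close>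

fun in_space :: "nat \<Rightarrow> nat \<Rightarrow> state \<Rightarrow> exp \<Rightarrow> bool" where
  "in_space w S s (Const c) \<longleftrightarrow> True"
| "in_space w S s (Reg r) \<longleftrightarrow> True"
| "in_space w S s (Load e) \<longleftrightarrow> in_space w S s e \<and> val w s e < S"
| "in_space w S s (Op f a b) \<longleftrightarrow> in_space w S s a \<and> in_space w S s b"

fun cost :: "exp \<Rightarrow> nat" where
  "cost (Const c) = 1"
| "cost (Reg r) = 1"
| "cost (Load e) = 1 + cost e"
| "cost (Op f a b) = 1 + cost a + cost b"

text \<open>
  \<open>exec w S c s t s'\<close>: started in state \<open>s\<close> on a machine with \<open>w\<close>-bit words and \<open>S\<close> memory
  cells, \<open>c\<close> terminates after \<open>t\<close> unit-cost operations in state \<open>s'\<close>. A program that accesses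
  a cell with address at least \<open>S\<close> is stuck and has no terminating execution.
\<close>

inductive exec :: "nat \<Rightarrow> nat \<Rightarrow> com \<Rightarrow> state \<Rightarrow> nat \<Rightarrow> state \<Rightarrow> bool"
  for w S :: nat where
  Skip: "exec w S Skip s 1 s"
| Assign: "in_space w S (r, m) e \<Longrightarrow>
    exec w S (Assign v e) (r, m) (1 + cost e) (r(v := val w (r, m) e), m)"
| Store: "in_space w S (r, m) a \<Longrightarrow> in_space w S (r, m) e \<Longrightarrow> val w (r, m) a < S \<Longrightarrow>
    exec w S (Store a e) (r, m) (1 + cost a + cost e)
      (r, m(val w (r, m) a := val w (r, m) e))"
| Seq: "exec w S c1 s t1 s' \<Longrightarrow> exec w S c2 s' t2 s'' \<Longrightarrow>
    exec w S (Seq c1 c2) s (t1 + t2) s''"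
| CondTrue: "in_space w S s e \<Longrightarrow> val w s e \<noteq> 0 \<Longrightarrow> exec w S c1 s t s' \<Longrightarrow>
    exec w S (Cond e c1 c2) s (1 + cost e + t) s'"
| CondFalse: "in_space w S s e \<Longrightarrow> val w s e = 0 \<Longrightarrow> exec w S c2 s t s' \<Longrightarrow>
    exec w S (Cond e c1 c2) s (1 + cost e + t) s'"
| WhileTrue: "in_space w S s e \<Longrightarrow> val w s e \<noteq> 0 \<Longrightarrow> exec w S c s t1 s' \<Longrightarrow>
    exec w S (While e c) s' t2 s'' \<Longrightarrow>
    exec w S (While e c) s (1 + cost e + t1 + t2) s''"
| WhileFalse: "in_space w S s e \<Longrightarrow> val w s e = 0 \<Longrightarrow>
    exec w S (While e c) s (1 + cost e) s"

text \<open>The outcome and the running time of a program are unique.\<close>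

lemma exec_deterministic:
  "exec w S c s t s' \<Longrightarrow> exec w S c s u s'' \<Longrightarrow> t = u \<and> s' = s''"
proof (induction arbitrary: u s'' rule: exec.induct)
  case (Skip s)
  from Skip.prems show ?case by cases simp
next
  case (Assign r m e v)
  from Assign.prems show ?case by cases simp
next
  case (Store r m a e)
  from Store.prems show ?case by cases simp
next
  case (Seq c1 s t1 s1 c2 t2 s2)
  from Seq.prems show ?case by cases (metis Seq.IH)
next
  case (CondTrue s e c1 t s1 c2)
  from CondTrue.prems show ?case by cases (metis CondTrue.IH, use CondTrue.hyps in simp)
next
  case (CondFalse s e c2 t s1 c1)
  from CondFalse.prems show ?case by cases (use CondFalse.hyps in simp, metis CondFalse.IH)
next
  case (WhileTrue s e c t1 s1 t2 s2)
  from WhileTrue.prems show ?case by cases (metis WhileTrue.IH, use WhileTrue.hyps in simp)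
next
  case (WhileFalse s e c)
  from WhileFalse.prems show ?case by cases (use WhileFalse.hyps in simp, simp)
qed

text \<open>
  Initially register \<open>0\<close> holds the length of the input string, cells \<open>0, \<dots>, length x - 1\<close> hold
  its letters, and everything else is \<open>0\<close>.
\<close>

definition initial_state :: "nat list \<Rightarrow> state" where
  "initial_state x =
     ((\<lambda>r. if r = 0 then length x else 0), (\<lambda>i. if i < length x then x ! i else 0))"

text \<open>
  A single program has to solve the problem \<open>R\<close> (a relation between inputs and final memory
  contents) on all inputs and for all word sizes for which letters and addresses are words.
  Letters are arbitrary words, so the alphabet is not assumed to be small, and the bounds do not
  depend on the word size. \<open>S\<close> counts all memory cells, including those of
  the input and the output, so it is the total space up to the constant number of registers.
\<close>

definition solves_within ::
  "com \<Rightarrow> (nat list \<Rightarrow> (nat \<Rightarrow> nat) \<Rightarrow> bool) \<Rightarrow> (nat \<Rightarrow> nat) \<Rightarrow> (nat \<Rightarrow> nat) \<Rightarrow> bool" where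
  "solves_within P R T S \<longleftrightarrow>
     (\<forall>w x. length x < 2 ^ w \<and> S (length x) \<le> 2 ^ w \<and> (\<forall>a\<in>set x. a < 2 ^ w) \<longrightarrow>
        (\<exists>t r m. exec w (S (length x)) P (initial_state x) t (r, m) \<and>
           t \<le> T (length x) \<and> R x m))"

definition all_cyclic_periodicities :: "nat list \<Rightarrow> (nat \<Rightarrow> nat) \<Rightarrow> bool" where
  "all_cyclic_periodicities x m \<longleftrightarrow>
     (\<forall>k\<in>{1..length x}. m k = (if cyclic_periodic k x then 1 else 0))"

end

theory Submission
  imports Defs "HOL-Library.Discrete_Functions"
begin

text \<open>
  Prefix doubling names the windows of length \<open>M = 2 ^ j\<close> of \<open>x\<close> so that equal names mean equal
  windows. If \<open>M \<le> k \<le> 2 * M\<close>, a string of length \<open>k\<close> is determined by its first and its last window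
  of length \<open>M\<close>, that is, by a pair of names, and \<open>x\<close> is \<open>k\<close>-cyclic periodic iff the pair of every block
  is the pair of some rotation of the first block. The rotations contain cyclic windows of
  \<open>take k x\<close> that need not occur in \<open>x\<close>, so these are named together with the windows of \<open>x\<close>. Only \<open>M\<close>
  of them wrap around for each \<open>k\<close>, and only the lengths \<open>k = n div l\<close> with \<open>l \<le> n div M\<close> still matter
  at window length \<open>M\<close>, which makes at most \<open>n\<close> names. The checks for all divisors \<open>k\<close> of \<open>n\<close> in
  \<open>{M..<2 * M}\<close> take time proportional to the sum of \<open>k + n div k\<close>, which is at most \<open>3 * n\<close>. So each
  of the logarithmically many levels is linear. Letters are arbitrary words, so the names for
  \<open>M = 1\<close> come from a merge sort.
\<close>

section \<open>Program logic with a clock\<close>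

text \<open>A letter may be any machine word, far beyond every index, and arithmetic wraps around.
  So only constants and results of operations are required to stay below
  \<open>S \<le> 2 ^ w\<close>, while letters are merely copied and compared. After the sort every
  name is an index below \<open>2 * n + 2\<close>, and pairs of names can be classified by direct
  addressing; this is why sorting happens once and not at every level. A length \<open>k\<close> is
  checked at the single level with \<open>M \<le> k < 2 * M\<close>, before the names are
  overwritten, so one generation of names suffices and the space is linear. Stride 16 and indices
  below \<open>2 * n + 2\<close> account for \<open>64 * n + 64\<close> cells, with some slack. The
  input occupies the first \<open>n\<close> cells, on which the arrays lie too, so no array may be
  assumed to start at 0. The time bounds are amortised, over the lists of one classification and
  over the divisors of \<open>n\<close>, and cannot be read off the nesting of the loops; this is
  why the clock is part of the assertions.\<close>

text \<open>\<open>ev\<close> computes without reduction modulo \<open>2 ^ w\<close>; \<open>safe\<close> ensures that no reduction takes place.\<close>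

fun ev :: "state \<Rightarrow> exp \<Rightarrow> nat" where
  "ev s (Const c) = c"
| "ev s (Reg r) = fst s r"
| "ev s (Load e) = snd s (ev s e)"
| "ev s (Op f a b) = apply_op f (ev s a) (ev s b)"

fun safe :: "nat \<Rightarrow> state \<Rightarrow> exp \<Rightarrow> bool" where
  "safe S s (Const c) \<longleftrightarrow> c < S"
| "safe S s (Reg r) \<longleftrightarrow> True"
| "safe S s (Load e) \<longleftrightarrow> safe S s e \<and> ev s e < S"
| "safe S s (Op f a b) \<longleftrightarrow> safe S s a \<and> safe S s b \<and> apply_op f (ev s a) (ev s b) < S"

text \<open>Results below \<open>S\<close> are not changed by reduction modulo \<open>2 ^ w\<close>.
  Contents of registers and loaded words are not bounded by \<open>S\<close>, so letters larger than
  every address may still be copied and compared.\<close>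

lemma safe_val: "safe S s e \<Longrightarrow> S \<le> 2 ^ w \<Longrightarrow> val w s e = ev s e \<and> in_space w S s e"
  by (induction e) auto

text \<open>Postconditions also depend on the clock; \<open>t\<close> is its reading before the command.\<close>

definition wp :: "nat \<Rightarrow> nat \<Rightarrow> com \<Rightarrow> (state \<Rightarrow> nat \<Rightarrow> bool) \<Rightarrow> state \<Rightarrow> nat \<Rightarrow> bool" where
  "wp w S c Q s t \<longleftrightarrow> (\<exists>t' s'. exec w S c s t' s' \<and> Q s' (t + t'))"

text \<open>Computed backwards through straight-line code, so that \<open>simp\<close> reduces
  loop-free programs to arithmetic side conditions. At a loop it stops at the semantic
  \<open>wp\<close>, which the invariant rules below discharge.\<close>

primrec vc :: "nat \<Rightarrow> nat \<Rightarrow> com \<Rightarrow> (state \<Rightarrow> nat \<Rightarrow> bool) \<Rightarrow> state \<Rightarrow> nat \<Rightarrow> bool" where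
  "vc w S Skip Q s t \<longleftrightarrow> Q s (t + 1)"
| "vc w S (Assign v e) Q s t \<longleftrightarrow> safe S s e \<and> Q ((fst s)(v := ev s e), snd s) (t + (1 + cost e))"
| "vc w S (Store a e) Q s t \<longleftrightarrow> safe S s a \<and> safe S s e \<and> ev s a < S \<and>
     Q (fst s, (snd s)(ev s a := ev s e)) (t + (1 + cost a + cost e))"
| "vc w S (Seq c d) Q s t \<longleftrightarrow> vc w S c (vc w S d Q) s t"
| "vc w S (Cond e c d) Q s t \<longleftrightarrow> safe S s e \<and>
     (if ev s e \<noteq> 0 then vc w S c Q s (t + (1 + cost e)) else vc w S d Q s (t + (1 + cost e)))"
| "vc w S (While e c) Q s t \<longleftrightarrow> wp w S (While e c) Q s t"

abbreviation seq :: "com \<Rightarrow> com \<Rightarrow> com" (infixr ";;" 60) where "c ;; d \<equiv> Seq c d"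

lemma vc_Seq: "vc w S (c ;; d) Q = vc w S c (vc w S d Q)"
  by (intro ext) simp

lemma vc_mono: "vc w S c Q s t \<Longrightarrow> (\<And>s t. Q s t \<Longrightarrow> Q' s t) \<Longrightarrow> vc w S c Q' s t"
proof (induction c arbitrary: Q Q' s t)
  case (Seq c1 c2)
  show ?case using Seq.prems Seq.IH by (metis vc.simps(4))
next
  case (Cond e c1 c2)
  show ?case using Cond.prems Cond.IH[of Q _ _ Q'] by (cases "ev s e = 0") simp_all
next
  case (While e c)
  then show ?case by (fastforce simp: wp_def)
qed simp_all

lemma vc_wp: "vc w S c Q s t \<Longrightarrow> S \<le> 2 ^ w \<Longrightarrow> wp w S c Q s t"
proof (induction c arbitrary: Q s t)
  case Skip
  then show ?case unfolding wp_def using exec.Skip by fastforce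
next
  case (Assign v e)
  obtain r m where s: "s = (r, m)" by (cases s)
  with Assign safe_val[of S s e w] have "exec w S (Assign v e) s (1 + cost e) (r(v := ev s e), m)"
    using exec.Assign[of w S r m e v] by simp
  with Assign s show ?case unfolding wp_def by fastforce
next
  case (Store a e)
  obtain r m where s: "s = (r, m)" by (cases s)
  with Store safe_val[of S s e w] safe_val[of S s a w]
  have "exec w S (Store a e) s (1 + cost a + cost e) (r, m(ev s a := ev s e))"
    using exec.Store[of w S r m a e] by simp
  with Store s show ?case unfolding wp_def by fastforce
next
  case (Seq c1 c2)
  from Seq.prems have "wp w S c1 (vc w S c2 Q) s t" using Seq.IH(1) by simp
  then obtain t1 s1 where 1: "exec w S c1 s t1 s1" "vc w S c2 Q s1 (t + t1)" by (auto simp: wp_def)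
  from Seq.IH(2)[OF 1(2) Seq.prems(2)] obtain t2 s2 where "exec w S c2 s1 t2 s2" "Q s2 (t + t1 + t2)"
    by (auto simp: wp_def)
  then show ?case using exec.Seq[OF 1(1)] unfolding wp_def by (metis add.assoc)
next
  case (Cond e c1 c2)
  have v: "val w s e = ev s e" "in_space w S s e" using safe_val[of S s e w] Cond.prems by auto
  show ?case
  proof (cases "ev s e = 0")
    case True
    then have "wp w S c2 Q s (t + (1 + cost e))" using Cond by simp
    then obtain t' s' where "exec w S c2 s t' s'" "Q s' (t + (1 + cost e) + t')" by (auto simp: wp_def)
    then show ?thesis unfolding wp_def
      using exec.CondFalse[of w S s e c2 t' s' c1] v True by (metis add.assoc)
  next
    case False
    then have "wp w S c1 Q s (t + (1 + cost e))" using Cond by simp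
    then obtain t' s' where "exec w S c1 s t' s'" "Q s' (t + (1 + cost e) + t')" by (auto simp: wp_def)
    then show ?thesis unfolding wp_def
      using exec.CondTrue[of w S s e c1 t' s' c2] v False by (metis add.assoc)
  qed
qed simp

text \<open>Every iteration costs at least one step, so a bound on the clock proves termination.\<close>

lemma vc_While:
  assumes "Inv s t"
    and S: "S \<le> 2 ^ w"
    and bound: "\<And>s t. Inv s t \<Longrightarrow> t \<le> B \<and> safe S s e"
    and body: "\<And>s t. Inv s t \<Longrightarrow> ev s e \<noteq> 0 \<Longrightarrow> vc w S c Inv s (t + (1 + cost e))"
    and final: "\<And>s t. Inv s t \<Longrightarrow> ev s e = 0 \<Longrightarrow> Q s (t + (1 + cost e))"
  shows "vc w S (While e c) Q s t"
  using assms(1)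
proof (induction "B - t" arbitrary: s t rule: less_induct)
  case less
  note b = bound[OF less.prems]
  have v: "val w s e = ev s e" "in_space w S s e" using safe_val[of S s e w] b S by auto
  show ?case
  proof (cases "ev s e = 0")
    case True
    have "exec w S (While e c) s (1 + cost e) s" using exec.WhileFalse v True by simp
    then show ?thesis using final[OF less.prems True] unfolding vc.simps wp_def by blast
  next
    case False
    from vc_wp[OF body[OF less.prems False] S] obtain t1 s1 where
      1: "exec w S c s t1 s1" "Inv s1 (t + (1 + cost e) + t1)" by (auto simp: wp_def)
    have "t + (1 + cost e) + t1 \<le> B" using bound[OF 1(2)] by simp
    then have "B - (t + (1 + cost e) + t1) < B - t" by simp
    from less.hyps[OF this 1(2)] obtain t2 s2 where
      2: "exec w S (While e c) s1 t2 s2" "Q s2 (t + (1 + cost e) + t1 + t2)" by (auto simp: wp_def)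
    have "exec w S (While e c) s (1 + cost e + t1 + t2) s2"
      using exec.WhileTrue[OF v(2) _ 1(1) 2(1)] v False by simp
    moreover have "Q s2 (t + (1 + cost e + t1 + t2))" using 2(2) by (simp add: add.assoc)
    ultimately show ?thesis unfolding vc.simps wp_def by blast
  qed
qed

lemma vc_While_exit:
  assumes "S \<le> 2 ^ w" "safe S s e" "ev s e = 0" "Q s (t + (1 + cost e))"
  shows "vc w S (While e c) Q s t"
  by (rule vc_While[where Inv = "\<lambda>s' t'. s' = s \<and> t' = t" and B = t]) (use assms in auto)

section \<open>Counting loops\<close>

definition For :: "nat \<Rightarrow> nat \<Rightarrow> com \<Rightarrow> com" where
  "For v b c = Seq (Assign v (Const 0))
     (While (Op Less (Reg v) (Reg b)) (Seq c (Assign v (Op Plus (Reg v) (Const 1)))))"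

text \<open>\<open>P\<close> sees the clock, so the cost may be amortised over the iterations; the
  bound \<open>T\<close> yields termination. The costs 2, 4 and 4 are those of the initial
  assignment, a guard test and an increment.\<close>

lemma vc_For_clock:
  assumes S: "S \<le> 2 ^ w" and N: "N < S" "1 < S"
    and init: "P 0 (r(v := 0)) m (t + 2)"
    and inv: "\<And>i r m t. P i r m t \<Longrightarrow> r v = i \<and> r b = N \<and> i \<le> N \<and> t \<le> T"
    and body: "\<And>i r m t. P i r m t \<Longrightarrow> i < N \<Longrightarrow>
      vc w S c (\<lambda>s' t'. fst s' v = i \<and> P (Suc i) ((fst s')(v := Suc i)) (snd s') (t' + 4)) (r, m) (t + 4)"
    and final: "\<And>r m t. P N r m t \<Longrightarrow> Q (r, m) (t + 4)"
  shows "vc w S (For v b c) Q (r, m) t"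
proof -
  let ?I = "\<lambda>s t. \<exists>i. P i (fst s) (snd s) t"
  have "vc w S (While (Op Less (Reg v) (Reg b)) (Seq c (Assign v (Op Plus (Reg v) (Const 1))))) Q
    (r(v := 0), m) (t + 2)"
  proof (rule vc_While[where Inv = ?I and B = T])
    show "?I (r(v := 0), m) (t + 2)" using init by auto
    show "S \<le> 2 ^ w" by fact
    fix s t'
    assume I: "?I s t'"
    obtain r m where s: "s = (r, m)" by (cases s)
    with I obtain i where i: "P i r m t'" by auto
    note iv = inv[OF i]
    show "t' \<le> T \<and> safe S s (Op Less (Reg v) (Reg b))"
      using iv N by auto
    {
      assume "ev s (Op Less (Reg v) (Reg b)) \<noteq> 0"
      then have lt: "i < N" using iv s by (simp split: if_splits)
      have "vc w S (Assign v (Op Plus (Reg v) (Const 1))) ?I s' t2"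
        if "fst s' v = i \<and> P (Suc i) ((fst s')(v := Suc i)) (snd s') (t2 + 4)" for s' t2
      proof -
        have "i + 1 < S" using lt N by simp
        then show ?thesis using that lt N by (auto simp: eval_nat_numeral)
      qed
      with body[OF i lt]
      have "vc w S c (vc w S (Assign v (Op Plus (Reg v) (Const 1))) ?I) (r, m) (t' + 4)"
        by (rule vc_mono)
      moreover have "1 + cost (Op Less (Reg v) (Reg b)) = 4" by simp
      ultimately show "vc w S (Seq c (Assign v (Op Plus (Reg v) (Const 1)))) ?I s
          (t' + (1 + cost (Op Less (Reg v) (Reg b))))"
        unfolding s vc.simps(4) by (simp only:)
    }
    assume "ev s (Op Less (Reg v) (Reg b)) = 0"
    then have "i = N" using iv s by (simp split: if_splits)
    moreover have "1 + cost (Op Less (Reg v) (Reg b)) = 4" by simp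
    ultimately show "Q s (t' + (1 + cost (Op Less (Reg v) (Reg b))))"
      using i s final by (simp only:)
  qed
  then show ?thesis using N by (simp add: For_def)
qed

text \<open>For bodies of uniform cost \<open>C\<close>: 8 adds guard and increment of each
  iteration, 6 is the initial assignment and the last, failing guard.\<close>

lemma vc_For:
  assumes S: "S \<le> 2 ^ w" and N: "N < S" "1 < S"
    and init: "P 0 (r(v := 0)) m"
    and inv: "\<And>i r m. P i r m \<Longrightarrow> r v = i \<and> r b = N"
    and body: "\<And>i r m t. P i r m \<Longrightarrow> i < N \<Longrightarrow>
      vc w S c (\<lambda>s' t'. fst s' v = i \<and> P (Suc i) ((fst s')(v := Suc i)) (snd s') \<and> t' \<le> t + C) (r, m) t"
    and final: "\<And>r m t'. P N r m \<Longrightarrow> t' \<le> t + N * (C + 8) + 6 \<Longrightarrow> Q (r, m) t'"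
  shows "vc w S (For v b c) Q (r, m) t"
proof (rule vc_For_clock[where T = "t + 2 + N * (C + 8)"
      and P = "\<lambda>i r m t'. P i r m \<and> i \<le> N \<and> t' \<le> t + 2 + i * (C + 8)", OF S N])
  fix i r m t'
  assume P: "P i r m \<and> i \<le> N \<and> t' \<le> t + 2 + i * (C + 8)"
  then have "i * (C + 8) \<le> N * (C + 8)" by (intro mult_le_mono1) simp
  then show "r v = i \<and> r b = N \<and> i \<le> N \<and> t' \<le> t + 2 + N * (C + 8)"
    using P inv by (meson add_left_mono order_trans)
  assume "i < N"
  then show "vc w S c (\<lambda>s' t'. fst s' v = i \<and> P (Suc i) ((fst s')(v := Suc i)) (snd s') \<and> Suc i \<le> N \<and>
      t' + 4 \<le> t + 2 + Suc i * (C + 8)) (r, m) (t' + 4)"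
    using P by (intro vc_mono[OF body]) auto
qed (use init in \<open>auto intro!: final\<close>)

text \<open>
  The arrays are interleaved with stride 16, so that their addresses do not depend on the input:
  0 letters, 1 names, 2 and 3 pairs of keys, 4 list heads, 5 list links, 6 last index seen with a
  given second key, 7 classes of the pairs, 8 answers, 9 sorted indices, 10 merge buffer.
  Registers: 0 the length \<open>n\<close>, 1 the window length \<open>M\<close>, 2 \<open>l\<close>, 3 \<open>k = n div l\<close>, 4 loop counter,
  6 number of pairs, 7 start of a cyclic window, 8 its name, 10 \<open>2 * M\<close>, 11 and 12 the loop over \<open>l\<close>;
  the sorting phase reuses registers 1 to 8 for run bounds.
\<close>

definition arr :: "(nat \<Rightarrow> nat) \<Rightarrow> nat \<Rightarrow> nat \<Rightarrow> nat" where
  "arr m a i = m (16 * i + a)"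

lemma arr_upd [simp]:
  assumes "a < 16" "b < 16"
  shows "arr (m(16 * i + a := v)) b = (if a = b then (arr m b)(i := v) else arr m b)"
proof
  fix j
  have "i = j \<and> a = b" if "16 * j + b = 16 * i + a"
    using arg_cong[OF that, of "\<lambda>k. k div 16"] arg_cong[OF that, of "\<lambda>k. k mod 16"] assms by simp
  then have "16 * j + b = 16 * i + a \<longleftrightarrow> i = j \<and> a = b" by auto
  then show "arr (m(16 * i + a := v)) b j = (if a = b then (arr m b)(i := v) else arr m b) j"
    by (auto simp: arr_def)
qed

text \<open>The simplifier turns the offsets 0, 1 and 2 into \<open>Suc\<close> forms, which
  \<open>arr_upd\<close> no longer matches.\<close>

lemma arr_upd_small [simp]:
  assumes "b < 16"
  shows "arr (m(16 * i := v)) b = (if b = 0 then (arr m b)(i := v) else arr m b)"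
    and "arr (m(Suc (16 * i) := v)) b = (if b = 1 then (arr m b)(i := v) else arr m b)"
    and "arr (m(Suc (Suc (16 * i)) := v)) b = (if b = 2 then (arr m b)(i := v) else arr m b)"
  using arr_upd[of 0 b m i v] arr_upd[of 1 b m i v] arr_upd[of 2 b m i v] assms by auto

definition frame :: "nat set \<Rightarrow> nat set \<Rightarrow> state \<Rightarrow> state \<Rightarrow> bool" where
  "frame X Y s s' \<longleftrightarrow> (\<forall>x. x \<notin> X \<longrightarrow> fst s' x = fst s x) \<and>
     (\<forall>a. a < 16 \<longrightarrow> a \<notin> Y \<longrightarrow> arr (snd s') a = arr (snd s) a)"

lemma frame_trans:
  "frame X Y s s' \<Longrightarrow> frame X' Y' s' s'' \<Longrightarrow> X \<union> X' \<subseteq> Z \<Longrightarrow> Y \<union> Y' \<subseteq> W \<Longrightarrow> frame Z W s s''"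
  unfolding frame_def by (metis UnI1 UnI2 subset_eq)

definition Ld :: "nat \<Rightarrow> exp \<Rightarrow> exp" where
  "Ld a e = Load (Op Plus (Op Times (Const 16) e) (Const a))"

definition St :: "nat \<Rightarrow> exp \<Rightarrow> exp \<Rightarrow> com" where
  "St a e = Store (Op Plus (Op Times (Const 16) e) (Const a))"

lemma ev_Ld [simp]: "ev s (Ld a e) = arr (snd s) a (ev s e)"
  by (simp add: Ld_def arr_def)

lemma cost_Ld [simp]: "cost (Ld a e) = cost e + 5"
  by (simp add: Ld_def)

lemma safe_Ld [simp]: "a < 16 \<Longrightarrow> safe S s (Ld a e) \<longleftrightarrow> 16 < S \<and> safe S s e \<and> 16 * ev s e + a < S"
  by (auto simp: Ld_def)

lemma vc_St [simp]: "a < 16 \<Longrightarrow> vc w S (St a e f) Q s t \<longleftrightarrow>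
    16 < S \<and> safe S s e \<and> 16 * ev s e + a < S \<and> safe S s f \<and>
    Q (fst s, (snd s)(16 * ev s e + a := ev s f)) (t + (cost e + cost f + 5))"
  by (auto simp: St_def eval_nat_numeral)

section \<open>Classes of equal pairs\<close>

text \<open>
  The indices are linked into lists by their first key. While one list is traversed, array 6
  holds for each second key the last index of the list with that key; entries left over from
  other lists are recognised by their different first key. An index is stored as its successor,
  0 means that there is none. Arrays 4 and 6 are only initialised at the keys in use, which keeps
  the running time linear in the number of pairs.
\<close>

definition pairing :: com where
  "pairing =
    For 4 6 (St 4 (Ld 2 (Reg 4)) (Const 0) ;; St 6 (Ld 3 (Reg 4)) (Const 0)) ;;
    For 4 6 (St 5 (Reg 4) (Ld 4 (Ld 2 (Reg 4))) ;;
             St 4 (Ld 2 (Reg 4)) (Op Plus (Reg 4) (Const 1))) ;;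
    For 4 6 (Assign 5 (Ld 4 (Ld 2 (Reg 4))) ;; St 4 (Ld 2 (Reg 4)) (Const 0) ;;
      While (Reg 5)
        (Assign 5 (Op Minus (Reg 5) (Const 1)) ;;
         Assign 8 (Ld 6 (Ld 3 (Reg 5))) ;;
         Cond (Op Times (Reg 8) (Op Equal (Ld 2 (Op Minus (Reg 8) (Const 1))) (Ld 2 (Reg 5))))
           (St 7 (Reg 5) (Op Minus (Reg 8) (Const 1)))
           (St 6 (Ld 3 (Reg 5)) (Op Plus (Reg 5) (Const 1)) ;; St 7 (Reg 5) (Reg 5)) ;;
         Assign 5 (Ld 5 (Reg 5))))"

text \<open>An optional maximum in the encoding of the program: the successor of the largest index,
  so that 0 is free for the missing one.\<close>

fun latest :: "(nat \<Rightarrow> bool) \<Rightarrow> nat \<Rightarrow> nat" where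
  "latest P 0 = 0"
| "latest P (Suc i) = (if P i then Suc i else latest P i)"

lemma latest_le: "latest P i \<le> i"
  by (induction i) auto

lemma latest_D: "latest P i = Suc k \<Longrightarrow> P k \<and> k < i"
  by (induction i) (auto split: if_splits)

lemma latest_ge: "P k \<Longrightarrow> k < i \<Longrightarrow> Suc k \<le> latest P i"
  by (induction i) (auto simp: less_Suc_eq)

text \<open>The largest index is the name that falls out of the traversal: lists are built in
  ascending order, hence walked in descending order, and the first member met names the others.
  Names are again indices, so they stay small at every level.\<close>

definition class_rep :: "(nat \<Rightarrow> nat) \<Rightarrow> (nat \<Rightarrow> nat) \<Rightarrow> nat \<Rightarrow> nat \<Rightarrow> nat" where
  "class_rep A B N i = latest (\<lambda>q. A q = A i \<and> B q = B i) N - 1"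

lemma class_rep_props:
  assumes "i < N"
  shows "A (class_rep A B N i) = A i \<and> B (class_rep A B N i) = B i \<and> i \<le> class_rep A B N i \<and> class_rep A B N i < N"
proof -
  have g: "Suc i \<le> latest (\<lambda>q. A q = A i \<and> B q = B i) N" using assms by (intro latest_ge) auto
  then obtain k where k: "latest (\<lambda>q. A q = A i \<and> B q = B i) N = Suc k"
    by (cases "latest (\<lambda>q. A q = A i \<and> B q = B i) N") auto
  from latest_D[OF k] k g show ?thesis by (auto simp: class_rep_def)
qed

lemma class_rep_eq_iff:
  assumes "i < N" "j < N"
  shows "class_rep A B N i = class_rep A B N j \<longleftrightarrow> A i = A j \<and> B i = B j"
proof
  show "class_rep A B N i = class_rep A B N j \<Longrightarrow> A i = A j \<and> B i = B j"
    using class_rep_props[OF assms(1), of A B] class_rep_props[OF assms(2), of A B] by simp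
qed (simp add: class_rep_def)

lemma class_rep_ge_iff:
  assumes "i < N"
  shows "l \<le> class_rep A B N i \<longleftrightarrow> (\<exists>q. l \<le> q \<and> q < N \<and> A q = A i \<and> B q = B i)"
proof
  assume "\<exists>q. l \<le> q \<and> q < N \<and> A q = A i \<and> B q = B i"
  then obtain q where "l \<le> q" "q < N" "A q = A i" "B q = B i" by blast
  then have "class_rep A B N q = class_rep A B N i" by (simp add: class_rep_def)
  moreover have "q \<le> class_rep A B N q" using class_rep_props[OF \<open>q < N\<close>] by blast
  ultimately show "l \<le> class_rep A B N i" using \<open>l \<le> q\<close> by linarith
next
  assume "l \<le> class_rep A B N i"
  then show "\<exists>q. l \<le> q \<and> q < N \<and> A q = A i \<and> B q = B i"
    using class_rep_props[OF assms, of A B] by (intro exI[of _ "class_rep A B N i"]) simp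
qed

text \<open>\<open>N\<close> counts the pairs, while \<open>L\<close> bounds the keys, which serve
  as addresses in arrays 4 and 6. The time is linear in \<open>N\<close> alone because a list is
  walked only once: its head is cleared on the first visit.\<close>

lemma pairing_correct:
  assumes S: "S \<le> 2 ^ w" and N: "r 6 = N" and L: "N \<le> L" "16 * L + 64 \<le> S"
    and A: "arr m 2 = A" "\<And>i. i < N \<Longrightarrow> A i < L" and B: "arr m 3 = B" "\<And>i. i < N \<Longrightarrow> B i < L"
    and Q: "\<And>r' m' t'. (\<And>x. x \<notin> {4, 5, 8} \<Longrightarrow> r' x = r x) \<Longrightarrow>
      (\<And>a. a < 16 \<Longrightarrow> a \<notin> {4, 5, 6, 7} \<Longrightarrow> arr m' a = arr m a) \<Longrightarrow>
      (\<And>i. i < N \<Longrightarrow> arr m' 7 i = class_rep A B N i) \<Longrightarrow> t' \<le> t + 300 * N + 100 \<Longrightarrow> Q (r', m') t'"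
  shows "vc w S pairing Q (r, m) t"
proof -
  define same where "same = (\<lambda>r' m'. (\<forall>x. x \<notin> {4, 5, 8} \<longrightarrow> r' x = r x) \<and>
      (\<forall>a. a < 16 \<longrightarrow> a \<notin> {4, 5, 6, 7} \<longrightarrow> arr m' a = arr m a))"
  have same: "r' 6 = N" "arr m' 2 = A" "arr m' 3 = B" if "same r' m'" for r' m'
    using that N A B by (auto simp: same_def)
  define P1 where "P1 = (\<lambda>i r' m'. same r' m' \<and> r' 4 = i \<and>
    (\<forall>q<i. arr m' 4 (A q) = 0 \<and> arr m' 6 (B q) = 0))"
  \<comment> \<open>Pushing indices in ascending order makes every head the latest index with its
    first key, and every link the latest earlier one.\<close>
  define P2 where "P2 = (\<lambda>i r' m'. same r' m' \<and> r' 4 = i \<and> (\<forall>q<N. arr m' 6 (B q) = 0) \<and>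
    (\<forall>q<N. arr m' 4 (A q) = latest (\<lambda>p. A p = A q) i) \<and>
    (\<forall>q<i. arr m' 5 q = latest (\<lambda>p. A p = A q) q))"
  have 1: "vc w S (For 4 6 (St 4 (Ld 2 (Reg 4)) (Const 0) ;; St 6 (Ld 3 (Reg 4)) (Const 0))) Q' (r, m) t"
    if "\<And>r' m' t'. P1 N r' m' \<Longrightarrow> t' \<le> t + N * (40 + 8) + 6 \<Longrightarrow> Q' (r', m') t'" for Q'
  proof (rule vc_For[where P = P1 and N = N and C = 40, OF S])
    show "P1 0 (r(4 := 0)) m" by (simp add: P1_def same_def)
    show "vc w S (St 4 (Ld 2 (Reg 4)) (Const 0) ;; St 6 (Ld 3 (Reg 4)) (Const 0))
        (\<lambda>s' t'. fst s' 4 = i \<and> P1 (Suc i) ((fst s')(4 := Suc i)) (snd s') \<and> t' \<le> t + 40) (r', m') t"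
      if p: "P1 i r' m'" and i: "i < N" for i r' m' t
    proof -
      note s = same[of r' m']
      show ?thesis using p i s A(2)[OF i] B(2)[OF i] L
        by (auto simp: P1_def same_def less_Suc_eq)
    qed
  qed (use L that same in \<open>auto simp: P1_def\<close>)
  have 2: "vc w S (For 4 6 (St 5 (Reg 4) (Ld 4 (Ld 2 (Reg 4))) ;;
             St 4 (Ld 2 (Reg 4)) (Op Plus (Reg 4) (Const 1)))) Q' (r1, m1) t1"
    if "P1 N r1 m1" "\<And>r' m' t'. P2 N r' m' \<Longrightarrow> t' \<le> t1 + N * (40 + 8) + 6 \<Longrightarrow> Q' (r', m') t'" for Q' r1 m1 t1
  proof (rule vc_For[where P = P2 and N = N and C = 40, OF S])
    show "P2 0 (r1(4 := 0)) m1" using that(1) by (auto simp: P1_def P2_def same_def)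
    show "vc w S (St 5 (Reg 4) (Ld 4 (Ld 2 (Reg 4))) ;;
             St 4 (Ld 2 (Reg 4)) (Op Plus (Reg 4) (Const 1)))
        (\<lambda>s' t'. fst s' 4 = i \<and> P2 (Suc i) ((fst s')(4 := Suc i)) (snd s') \<and> t' \<le> t + 40) (r', m') t"
      if p: "P2 i r' m'" and i: "i < N" for i r' m' t
    proof -
      note s = same[of r' m']
      show ?thesis using p i s A(2)[OF i] B(2)[OF i] L
        by (auto simp: P2_def same_def less_Suc_eq)
    qed
  qed (use L that same in \<open>auto simp: P2_def\<close>)
  \<comment> \<open>\<open>X i\<close> holds the indices on lists finished before iteration
    \<open>i\<close>. \<open>Y a j\<close> is the part of the list of \<open>a\<close> already
    passed when the pointer is \<open>j\<close>, that is, when index \<open>j - 1\<close> comes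
    next.\<close>
  define X where "X = (\<lambda>i. {q. q < N \<and> (\<exists>p<i. A p = A q)})"
  define Y where "Y = (\<lambda>a j. {q. q < N \<and> A q = a \<and> j \<le> q})"
  define G where "G = (\<lambda>i r' m'. same r' m' \<and> r' 4 = i \<and>
    (\<forall>q<N. arr m' 5 q = latest (\<lambda>p. A p = A q) q) \<and> (\<forall>q\<in>X i. arr m' 7 q = class_rep A B N q))"
  \<comment> \<open>Array 6 is not reset between lists. Leftover entries point into
    \<open>X i\<close>, and when a new list starts at \<open>i\<close>, its first key differs from
    all of those.\<close>
  define P3 where "P3 = (\<lambda>i r' m'. G i r' m' \<and>
    (\<forall>q<N. arr m' 4 (A q) = (if q \<in> X i then 0 else latest (\<lambda>p. A p = A q) N)) \<and>
    (\<forall>q<N. arr m' 6 (B q) = 0 \<or> arr m' 6 (B q) - 1 \<in> X i))"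
  \<comment> \<open>\<open>j < l\<close> says that \<open>l - 1\<close>, the largest index with the
    pair in question, has been passed; from then on array 6 holds \<open>l\<close>.\<close>
  define I4 where "I4 = (\<lambda>i j r' m'. G i r' m' \<and> r' 5 = j \<and> j \<le> N \<and> (j = 0 \<or> A (j - 1) = A i) \<and>
    (\<forall>q\<in>Y (A i) j. arr m' 7 q = class_rep A B N q) \<and>
    (\<forall>q<N. arr m' 4 (A q) = (if q \<in> X (Suc i) then 0 else latest (\<lambda>p. A p = A q) N)) \<and>
    (\<forall>q<N. let v = arr m' 6 (B q); l = latest (\<lambda>p. A p = A i \<and> B p = B q) N in
      if j < l then v = l else v = 0 \<or> v - 1 \<in> X i))"
  have X_Suc: "X (Suc i) = X i \<union> Y (A i) 0" for i
    by (auto simp: X_def Y_def less_Suc_eq)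
  have X_card: "card (X i) \<le> N" for i
    using card_mono[of "{..<N}" "X i"] by (auto simp: X_def)
  let ?body = "Assign 5 (Op Minus (Reg 5) (Const 1)) ;;
         Assign 8 (Ld 6 (Ld 3 (Reg 5))) ;;
         Cond (Op Times (Reg 8) (Op Equal (Ld 2 (Op Minus (Reg 8) (Const 1))) (Ld 2 (Reg 5))))
           (St 7 (Reg 5) (Op Minus (Reg 8) (Const 1)))
           (St 6 (Ld 3 (Reg 5)) (Op Plus (Reg 5) (Const 1)) ;; St 7 (Reg 5) (Reg 5)) ;;
         Assign 5 (Ld 5 (Reg 5))"
  have step: "vc w S ?body (\<lambda>s' t'. (\<exists>j'. I4 i j' (fst s') (snd s') \<and> j' < j \<and>
        card (Y (A i) j') = Suc (card (Y (A i) j))) \<and> t' \<le> t + 90) (r', m') t"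
    if I: "I4 i j r' m'" and j: "0 < j" and i: "i < N" "i \<notin> X i" for i j r' m' t
  proof -
    obtain q0 where q0: "j = Suc q0" using j gr0_implies_Suc by blast
    have sm: "same r' m'" and r: "r' 4 = i" "r' 5 = Suc q0" using I q0 by (auto simp: I4_def G_def)
    note s = same[OF sm]
    have q0N: "q0 < N" "A q0 = A i" using I q0 by (auto simp: I4_def)
    define v where "v = arr m' 6 (B q0)"
    define l where "l = (\<lambda>q. latest (\<lambda>p. A p = A i \<and> B p = B q) N)"
    have lq: "latest (\<lambda>p. A p = A i \<and> B p = B q) N = l q" for q by (simp add: l_def)
    define j' where "j' = latest (\<lambda>p. A p = A i) q0"
    have j'1: "j' \<le> q0" unfolding j'_def by (rule latest_le)
    have j'2: "j' = 0 \<or> A (j' - 1) = A i"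
      using latest_D[of "\<lambda>p. A p = A i" q0 "j' - 1"] unfolding j'_def[symmetric] by (cases j') auto
    note j' = j'1 j'2
    have nx: "arr m' 5 q0 = j'" using I q0N by (simp add: I4_def G_def j'_def)
    have between: "q = q0" if "A q = A i" "j' \<le> q" "q < j" for q
      using latest_ge[of "\<lambda>p. A p = A i" q q0] that q0 by (fastforce simp: j'_def)
    have YE: "Y (A i) j' = insert q0 (Y (A i) j)"
    proof (rule set_eqI)
      show "x \<in> Y (A i) j' \<longleftrightarrow> x \<in> insert q0 (Y (A i) j)" for x
        using between[of x] j'1 q0N q0 by (cases "x < j") (auto simp: Y_def)
    qed
    have YC: "card (Y (A i) j') = Suc (card (Y (A i) j))"
      unfolding YE using q0 by (subst card_insert_disjoint) (auto simp: Y_def)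
    have PT: "if j < l q then arr m' 6 (B q) = l q else arr m' 6 (B q) = 0 \<or> arr m' 6 (B q) - 1 \<in> X i"
      if "q < N" for q
      using I that by (auto simp: I4_def l_def Let_def)
    have lD: "l q \<le> N" "0 < l q \<Longrightarrow> A (l q - 1) = A i \<and> B (l q - 1) = B q" for q
      using latest_le latest_D[of "\<lambda>p. A p = A i \<and> B p = B q" N "l q - 1"] unfolding l_def
      by simp_all
    have lq0: "j \<le> l q0" unfolding l_def q0 by (rule latest_ge) (use q0N in auto)
    have rep0: "class_rep A B N q0 = l q0 - 1" using q0N by (simp add: class_rep_def l_def)
    \<comment> \<open>\<open>l q\<close> is 0 or the successor of a list member, and
      \<open>q0\<close> is the only member passed between the pointers \<open>j\<close> and
      \<open>j'\<close>. So the step changes the status only of the class with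
      \<open>l q = j\<close>.\<close>
    have j'_less: "j' < l q \<longleftrightarrow> j \<le> l q" for q
    proof
      assume "j' < l q"
      then show "j \<le> l q" using between[of "l q - 1"] lD(2)[of q] q0 by fastforce
    qed (use j' q0 in auto)
    have l_eq: "l q = j \<Longrightarrow> B q = B q0" for q using lD(2)[of q] q0 by auto
    have l_cong: "B q = B q0 \<Longrightarrow> l q = l q0" for q by (simp add: l_def)
    have notX: "q \<notin> X i" if "A q = A i" for q using that i by (auto simp: X_def)
    have q0X: "q0 \<notin> X i" using notX q0N by simp
    \<comment> \<open>The guard loads at \<open>v - 1\<close> even if \<open>v = 0\<close>.
      Truncated subtraction keeps that index at 0, and the factor \<open>v\<close> then makes the
      guard false.\<close>
    have vN: "v \<le> N" "v - 1 < N" using PT[OF q0N(1)] lD(1)[of q0] q0N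
      by (auto simp: v_def X_def split: if_splits)
    \<comment> \<open>The comparison of first keys rejects exactly the leftovers: it succeeds iff
      the class has already been met on the current list.\<close>
    have guard: "0 < v \<and> A (v - 1) = A i \<longleftrightarrow> j < l q0"
      using PT[OF q0N(1)] lD(2)[of q0] notX lq0 by (auto simp: v_def split: if_splits)
    have AN: "A q0 < L" "B q0 < L" using A(2)[OF q0N(1)] B(2)[OF q0N(1)] by simp_all
    show ?thesis
    proof (cases "j < l q0")
      case True
      have v: "v = l q0" using True PT[OF q0N(1)] by (simp add: v_def)
      have I': "I4 i j' (r'(8 := v, 5 := j')) (m'(16 * q0 + 7 := v - 1))"
        unfolding I4_def Let_def
      proof (intro conjI allI impI ballI)
        show "G i (r'(8 := v, 5 := j')) (m'(16 * q0 + 7 := v - 1))"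
          using I q0X by (auto simp: I4_def G_def same_def)
        show "arr (m'(16 * q0 + 7 := v - 1)) 7 q = class_rep A B N q" if "q \<in> Y (A i) j'" for q
          using that I rep0 v by (auto simp: YE I4_def)
        show "if j' < latest (\<lambda>p. A p = A i \<and> B p = B q) N
         then arr (m'(16 * q0 + 7 := v - 1)) 6 (B q) = latest (\<lambda>p. A p = A i \<and> B p = B q) N
         else arr (m'(16 * q0 + 7 := v - 1)) 6 (B q) = 0 \<or> arr (m'(16 * q0 + 7 := v - 1)) 6 (B q) - 1 \<in> X i"
          if "q < N" for q
          using PT[OF that] j'_less[of q] l_eq[of q] l_cong[of q] True
          unfolding lq by (auto split: if_splits)
      qed (use I j' q0 q0N in \<open>auto simp: I4_def\<close>)
      then show ?thesis
        using guard True v_def s r nx q0N vN L AN YC j' q0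
        by (auto simp: s r intro!: exI[of _ j'])
    next
      case False
      have l0: "l q0 = j" using False lq0 by simp
      have I': "I4 i j' (r'(8 := v, 5 := j')) (m'(16 * B q0 + 6 := j, 16 * q0 + 7 := q0))"
        unfolding I4_def Let_def
      proof (intro conjI allI impI ballI)
        show "G i (r'(8 := v, 5 := j')) (m'(16 * B q0 + 6 := j, 16 * q0 + 7 := q0))"
          using I q0X by (auto simp: I4_def G_def same_def)
        show "arr (m'(16 * B q0 + 6 := j, 16 * q0 + 7 := q0)) 7 q = class_rep A B N q" if "q \<in> Y (A i) j'" for q
          using that I rep0 l0 q0 by (auto simp: YE I4_def)
        show "if j' < latest (\<lambda>p. A p = A i \<and> B p = B q) N
         then arr (m'(16 * B q0 + 6 := j, 16 * q0 + 7 := q0)) 6 (B q) = latest (\<lambda>p. A p = A i \<and> B p = B q) N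
         else arr (m'(16 * B q0 + 6 := j, 16 * q0 + 7 := q0)) 6 (B q) = 0 \<or>
           arr (m'(16 * B q0 + 6 := j, 16 * q0 + 7 := q0)) 6 (B q) - 1 \<in> X i"
          if "q < N" for q
        proof (cases "B q = B q0")
          case True
          then have "l q = j" using l_cong[of q] l0 by simp
          then show ?thesis using True j' q0 unfolding lq by simp
        next
          case False
          then have "l q \<noteq> j" using l_eq[of q] by blast
          then have "j' < l q \<longleftrightarrow> j < l q" using j'_less[of q] by auto
          then show ?thesis using PT[OF that] False unfolding lq by (auto split: if_splits)
        qed
      qed (use I j' q0 q0N in \<open>auto simp: I4_def\<close>)
      have ex: "\<exists>k. I4 i k (r'(8 := v, 5 := j')) (m'(16 * B q0 + 6 := j, 16 * q0 + 7 := q0)) \<and>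
          k < j \<and> card (Y (A i) k) = Suc (card (Y (A i) j))"
        using I' YC j' q0 by auto
      show ?thesis
      proof (cases "v = 0")
        case True
        then show ?thesis
          using ex v_def s r nx q0N vN L AN q0 by (simp add: s r)
      next
        case v0: False
        then have "A (v - 1) \<noteq> A i" using guard False by simp
        then show ?thesis
          using ex v_def s r nx q0N vN L AN q0 v0 by (simp add: s r)
      qed
    qed
  qed
  have inner: "vc w S (While (Reg 5) ?body) Q' (r1, m1) t1"
    if I: "I4 i j0 r1 m1" and i: "i < N" "i \<notin> X i"
      and fin: "\<And>r' m' t'. I4 i 0 r' m' \<Longrightarrow> t' \<le> t1 + 100 * card (Y (A i) 0) + 10 \<Longrightarrow> Q' (r', m') t'"
    for i j0 r1 m1 t1 Q'
  proof (rule vc_While[where Inv = "\<lambda>s' t'. \<exists>j. I4 i j (fst s') (snd s') \<and>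
        t' \<le> t1 + 100 * card (Y (A i) j)" and B = "t1 + 100 * N", OF _ S])
    show "\<exists>j. I4 i j (fst (r1, m1)) (snd (r1, m1)) \<and> t1 \<le> t1 + 100 * card (Y (A i) j)"
      using I by auto
    fix s' t'
    assume inv: "\<exists>j. I4 i j (fst s') (snd s') \<and> t' \<le> t1 + 100 * card (Y (A i) j)"
    then obtain j r' m' where s': "s' = (r', m')" and j: "I4 i j r' m'" "t' \<le> t1 + 100 * card (Y (A i) j)"
      by (cases s') auto
    have "card (Y (A i) j) \<le> N"
      using card_mono[of "{..<N}" "Y (A i) j"] by (auto simp: Y_def)
    then show "t' \<le> t1 + 100 * N \<and> safe S s' (Reg 5)" using j by auto
    have r5: "r' 5 = j" using j by (simp add: I4_def)
    {
      assume "ev s' (Reg 5) \<noteq> 0"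
      then have "0 < j" using r5 s' by simp
      from vc_mono[OF step[OF j(1) this i, of "t' + (1 + cost (Reg 5))"],
        of "\<lambda>s' t'. \<exists>j. I4 i j (fst s') (snd s') \<and> t' \<le> t1 + 100 * card (Y (A i) j)"]
      show "vc w S ?body (\<lambda>s' t'. \<exists>j. I4 i j (fst s') (snd s') \<and> t' \<le> t1 + 100 * card (Y (A i) j))
          s' (t' + (1 + cost (Reg 5)))"
        unfolding s' using j(2) by fastforce
    }
    assume "ev s' (Reg 5) = 0"
    then have "j = 0" using r5 s' by simp
    then show "Q' s' (t' + (1 + cost (Reg 5)))" using j s' by (auto intro!: fin)
  qed
  have 3: "vc w S (For 4 6 (Assign 5 (Ld 4 (Ld 2 (Reg 4))) ;; St 4 (Ld 2 (Reg 4)) (Const 0) ;;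
      While (Reg 5) ?body)) Q (r2, m2) t2"
    if "P2 N r2 m2" and t2: "t2 \<le> t + 2 * (N * (40 + 8) + 6)" for r2 m2 t2
  \<comment> \<open>Amortisation: walking a list costs 100 per member, charged to the growth of
    \<open>X i\<close>; the remaining cost per iteration is constant. As
    \<open>card (X i) \<le> N\<close>, the total is linear.\<close>
  proof (rule vc_For_clock[where T = "t2 + 200 * N + 2" and N = N and
        P = "\<lambda>i r' m' t'. P3 i r' m' \<and> i \<le> N \<and> t' \<le> t2 + 2 + 100 * card (X i) + 100 * i", OF S])
    show "P3 0 (r2(4 := 0)) m2 \<and> 0 \<le> N \<and> t2 + 2 \<le> t2 + 2 + 100 * card (X 0) + 100 * 0"
      using \<open>P2 N r2 m2\<close> by (auto simp: P2_def P3_def G_def X_def same_def)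
    show "Q (r', m') (t' + 4)"
      if "P3 N r' m' \<and> N \<le> N \<and> t' \<le> t2 + 2 + 100 * card (X N) + 100 * N" for r' m' t'
    proof (rule Q)
      show "t' + 4 \<le> t + 300 * N + 100" using that X_card[of N] t2 by simp
    qed (use that in \<open>auto simp: P3_def G_def same_def X_def\<close>)
    show "r' 4 = i \<and> r' 6 = N \<and> i \<le> N \<and> t' \<le> t2 + 200 * N + 2"
      if "P3 i r' m' \<and> i \<le> N \<and> t' \<le> t2 + 2 + 100 * card (X i) + 100 * i" for i r' m' t'
      using that X_card[of i] same[of r' m'] by (auto simp: P3_def G_def)
    show "vc w S (Assign 5 (Ld 4 (Ld 2 (Reg 4))) ;; St 4 (Ld 2 (Reg 4)) (Const 0) ;; While (Reg 5) ?body)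
      (\<lambda>s' t'. fst s' 4 = i \<and> P3 (Suc i) ((fst s')(4 := Suc i)) (snd s') \<and> Suc i \<le> N \<and>
        t' + 4 \<le> t2 + 2 + 100 * card (X (Suc i)) + 100 * Suc i) (r', m') (t' + 4)"
      if P: "P3 i r' m' \<and> i \<le> N \<and> t' \<le> t2 + 2 + 100 * card (X i) + 100 * i" and i: "i < N" for i r' m' t'
    proof (cases "i \<in> X i")
      case True
      then have X: "X (Suc i) = X i" unfolding X_Suc by (auto simp: X_def Y_def)
      have sm: "same r' m'" and r: "r' 4 = i" using P by (auto simp: P3_def G_def)
      note s = same[OF sm]
      have h: "arr m' 4 (A i) = 0" using P i True by (auto simp: P3_def)
      have "q \<in> X i" if "q < N" "A q = A i" for q using True that by (auto simp: X_def)
      then have P': "P3 (Suc i) (r'(5 := 0, 4 := Suc i)) (m'(16 * A i + 4 := 0))"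
        using P i sm True unfolding P3_def G_def X by (auto simp: same_def)
      have c: "100 * card (X i) + 100 * i + 50 \<le> 100 * card (X (Suc i)) + 100 * Suc i" unfolding X by simp
      have "vc w S (While (Reg 5) ?body) (\<lambda>s' t'. fst s' 4 = i \<and> P3 (Suc i) ((fst s')(4 := Suc i)) (snd s') \<and> Suc i \<le> N \<and>
        t' + 4 \<le> t2 + 2 + 100 * card (X (Suc i)) + 100 * Suc i) (r'(5 := 0), m'(16 * A i + 4 := 0)) (28 + t')"
        by (rule vc_While_exit) (use S P P' c r i in auto)
      then show ?thesis using L A(2)[OF i] i r s h by simp
    next
      case False
      have sm: "same r' m'" and r: "r' 4 = i" using P by (auto simp: P3_def G_def)
      note s = same[OF sm]
      define j where "j = latest (\<lambda>p. A p = A i) N"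
      have h: "arr m' 4 (A i) = j" using P i False by (auto simp: P3_def j_def)
      have I: "I4 i j (r'(5 := j)) (m'(16 * A i + 4 := 0))"
        unfolding I4_def Let_def
      proof (intro conjI allI impI ballI)
        show "G i (r'(5 := j)) (m'(16 * A i + 4 := 0))"
          using P by (auto simp: P3_def G_def same_def)
        show "j \<le> N" unfolding j_def by (rule latest_le)
        show "j = 0 \<or> A (j - 1) = A i"
          using latest_D[of "\<lambda>p. A p = A i" N "j - 1"] unfolding j_def[symmetric] by (cases j) auto
        have Y: "q \<notin> Y (A i) j" for q
          using latest_ge[of "\<lambda>p. A p = A i" q N] unfolding Y_def j_def by fastforce
        show "arr (m'(16 * A i + 4 := 0)) 7 q = class_rep A B N q" if "q \<in> Y (A i) j" for q
          using Y[of q] that by blast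
        show "arr (m'(16 * A i + 4 := 0)) 4 (A q) = (if q \<in> X (Suc i) then 0 else latest (\<lambda>p. A p = A q) N)"
          if "q < N" for q
          using P that unfolding P3_def X_Suc by (auto simp: Y_def)
        have "\<not> j < latest (\<lambda>p. A p = A i \<and> B p = B q) N" for q
        proof (cases "latest (\<lambda>p. A p = A i \<and> B p = B q) N")
          case (Suc k)
          then show ?thesis using latest_D[OF Suc] Y[of k] by (simp add: Y_def)
        qed simp
        then show "if j < latest (\<lambda>p. A p = A i \<and> B p = B q) N
         then arr (m'(16 * A i + 4 := 0)) 6 (B q) = latest (\<lambda>p. A p = A i \<and> B p = B q) N
         else arr (m'(16 * A i + 4 := 0)) 6 (B q) = 0 \<or> arr (m'(16 * A i + 4 := 0)) 6 (B q) - 1 \<in> X i"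
          if "q < N" for q
          using P that by (simp add: P3_def)
      qed simp
      have "X i \<inter> Y (A i) 0 = {}" using False i by (auto simp: X_def Y_def)
      moreover have "finite (X i)" "finite (Y (A i) 0)" by (auto simp: X_def Y_def)
      ultimately have card: "card (X (Suc i)) = card (X i) + card (Y (A i) 0)"
        unfolding X_Suc by (simp add: card_Un_disjoint)
      have "vc w S (While (Reg 5) ?body) (\<lambda>s' t'. fst s' 4 = i \<and> P3 (Suc i) ((fst s')(4 := Suc i)) (snd s') \<and> Suc i \<le> N \<and>
        t' + 4 \<le> t2 + 2 + 100 * card (X (Suc i)) + 100 * Suc i) (r'(5 := j), m'(16 * A i + 4 := 0)) (28 + t')"
      proof (rule inner[OF I i False])
        fix r'' m'' t''
        assume I'': "I4 i 0 r'' m''" and t'': "t'' \<le> 28 + t' + 100 * card (Y (A i) 0) + 10"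
        have "P3 (Suc i) (r''(4 := Suc i)) m''"
          unfolding P3_def
        proof (intro conjI allI impI)
          show "G (Suc i) (r''(4 := Suc i)) m''"
            using I'' unfolding I4_def G_def X_Suc by (auto simp: same_def)
          show "arr m'' 4 (A q) = (if q \<in> X (Suc i) then 0 else latest (\<lambda>p. A p = A q) N)" if "q < N" for q
            using I'' that by (simp add: I4_def)
          show "arr m'' 6 (B q) = 0 \<or> arr m'' 6 (B q) - 1 \<in> X (Suc i)" if "q < N" for q
          proof (cases "latest (\<lambda>p. A p = A i \<and> B p = B q) N")
            case 0
            then show ?thesis using I'' that unfolding I4_def X_Suc by auto
          next
            case (Suc k)
            then have "arr m'' 6 (B q) = Suc k" using I'' that by (auto simp: I4_def)
            moreover have "k \<in> Y (A i) 0" using latest_D[OF Suc] by (simp add: Y_def)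
            ultimately show ?thesis unfolding X_Suc by simp
          qed
        qed
        then show "fst (r'', m'') 4 = i \<and> P3 (Suc i) ((fst (r'', m''))(4 := Suc i)) (snd (r'', m'')) \<and> Suc i \<le> N \<and>
            t'' + 4 \<le> t2 + 2 + 100 * card (X (Suc i)) + 100 * Suc i"
          using I'' t'' P i card by (simp add: I4_def G_def)
      qed
      then show ?thesis using L A(2)[OF i] i r s h by simp
    qed
  qed (use L in auto)
  show ?thesis
    unfolding pairing_def vc.simps(4)
    by (rule 1, rule 2, assumption, rule 3, assumption) simp
qed

section \<open>Windows, cyclic windows and blocks\<close>

text \<open>Doubling the prefix turns a wrapping window into an ordinary factor, of full length as
  long as \<open>z + M \<le> 2 * k\<close>.\<close>

definition cyclic_window :: "'a list \<Rightarrow> nat \<Rightarrow> nat \<Rightarrow> nat \<Rightarrow> 'a list" where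
  "cyclic_window x k M z = take M (drop z (take k x @ take k x))"

text \<open>
  Indices below \<open>n\<close> stand for windows of \<open>x\<close>; the index \<open>n + (l - 1) * M + a\<close> with \<open>a < M\<close> stands for
  the cyclic window of \<open>take k x\<close>, \<open>k = n div l\<close>, that starts \<open>a\<close> letters before its end.
\<close>

definition word_at :: "'a list \<Rightarrow> nat \<Rightarrow> nat \<Rightarrow> 'a list" where
  "word_at x M p = (let n = length x in
     if p < n then take M (drop p x)
     else let k = n div Suc ((p - n) div M) in cyclic_window x k M (k - (p - n) mod M))"

text \<open>All \<open>l \<le> n div M\<close> take part, divisors of \<open>n\<close> or not, so
  that the numbering has no gaps and is decoded by \<open>div\<close> and \<open>mod\<close> alone.
  If \<open>M\<close> exceeds \<open>n\<close>, no index is valid.\<close>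

definition valid_index :: "nat \<Rightarrow> nat \<Rightarrow> nat \<Rightarrow> bool" where
  "valid_index n M p \<longleftrightarrow> (if p < n then p + M \<le> n else p < n + (n div M) * M)"

definition naming :: "'a list \<Rightarrow> nat \<Rightarrow> (nat \<Rightarrow> nat) \<Rightarrow> bool" where
  "naming x M f \<longleftrightarrow> (\<forall>p q. valid_index (length x) M p \<longrightarrow> valid_index (length x) M q \<longrightarrow>
     (f p = f q \<longleftrightarrow> word_at x M p = word_at x M q))"

text \<open>A window that does not cross the end of the prefix is a window of \<open>x\<close> at
  the same position and shares its name. The start \<open>z = k\<close> is legal and gets offset
  0.\<close>

definition cyclic_index :: "nat \<Rightarrow> nat \<Rightarrow> nat \<Rightarrow> nat \<Rightarrow> nat \<Rightarrow> nat" where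
  "cyclic_index n M l k z = (if k < z + M then n + (l - 1) * M + (k - z) else z)"

text \<open>Not quite reduction modulo \<open>k\<close>: the value \<open>k\<close> itself is kept,
  a legal start for \<open>cyclic_index\<close>.\<close>

definition wrap :: "nat \<Rightarrow> nat \<Rightarrow> nat" where
  "wrap k z = (if k < z then z - k else z)"

lemma div_facts:
  fixes n :: nat
  assumes "1 \<le> l" "k = n div l" "1 \<le> M" "M \<le> k"
  shows "l \<le> n div M" "k \<le> n" "l * M \<le> n"
proof -
  have "l * M \<le> l * k" using assms(4) by (rule mult_le_mono2)
  also have "\<dots> \<le> n" using assms by simp
  finally show "l * M \<le> n" .
  then show "l \<le> n div M" using assms by (simp add: less_eq_div_iff_mult_less_eq)
  show "k \<le> n" using assms by simp
qed

lemma valid_cyclic_index: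
  assumes "1 \<le> l" "k = n div l" "1 \<le> M" "M \<le> k" "z \<le> k"
  shows "valid_index n M (cyclic_index n M l k z)"
proof (cases "k < z + M")
  case True
  have "(l - 1) * M + (k - z) < (l - 1) * M + M" using True assms by simp
  also have "\<dots> = l * M" using assms(1) by (cases l) auto
  also have "\<dots> \<le> (n div M) * M" using div_facts[OF assms(1-4)] by simp
  finally show ?thesis using True by (simp add: valid_index_def cyclic_index_def)
next
  case False
  then have "z + M \<le> n" using div_facts(2)[OF assms(1-4)] by linarith
  then show ?thesis using False assms(3) by (simp add: valid_index_def cyclic_index_def)
qed

lemma word_at_cyclic_index:
  assumes "1 \<le> l" "k = length x div l" "1 \<le> M" "M \<le> k" "z \<le> k"
  shows "word_at x M (cyclic_index (length x) M l k z) = cyclic_window x k M z"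
proof (cases "k < z + M")
  case True
  define d where "d = k - z"
  have "d < M" using True assms by (simp add: d_def)
  then have e: "((l - 1) * M + d) div M = l - 1" "((l - 1) * M + d) mod M = d" by simp_all
  have c: "cyclic_index (length x) M l k z = length x + ((l - 1) * M + d)"
    using True by (simp add: cyclic_index_def d_def)
  have w: "word_at x M (length x + ((l - 1) * M + d)) = cyclic_window x (length x div Suc (l - 1)) M (length x div Suc (l - 1) - d)"
    unfolding word_at_def Let_def by (simp only: diff_add_inverse e not_add_less1 if_False)
  have k: "length x div Suc (l - 1) = k" and z: "k - d = z" using assms(1,2,5) by (simp_all add: d_def)
  show ?thesis unfolding c w k z ..
next
  case False
  then have z: "z + M \<le> k" by simp
  have k: "k \<le> length x" using div_facts(2)[OF assms(1-4)] .
  have "z < length x" using z k assms(3) by linarith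
  then have "word_at x M (cyclic_index (length x) M l k z) = take M (drop z x)"
    using False by (simp add: word_at_def cyclic_index_def)
  also have "\<dots> = cyclic_window x k M z" using z k by (simp add: cyclic_window_def drop_take min_def)
  finally show ?thesis .
qed

lemma length_cyclic_window: "k \<le> length x \<Longrightarrow> z + M \<le> 2 * k \<Longrightarrow> length (cyclic_window x k M z) = M"
  by (simp add: cyclic_window_def)

lemma length_word_at: 
  assumes "valid_index (length x) M p" "1 \<le> M"
  shows "length (word_at x M p) = M"
proof (cases "p < length x")
  case True
  then show ?thesis using assms by (simp add: word_at_def valid_index_def Let_def)
next
  case False
  define l where "l = Suc ((p - length x) div M)"
  have "(p - length x) div M < length x div M" using False assms
    by (simp add: valid_index_def less_mult_imp_div_less)
  then have "M \<le> length x div l" using assms(2) unfolding l_def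
    by (metis Suc_leI less_eq_div_iff_mult_less_eq mult.commute zero_less_Suc not_less_eq_eq le_simps(3) One_nat_def Suc_le_eq)
  moreover have "(p - length x) mod M < M" using assms(2) by simp
  ultimately show ?thesis using False assms
    by (simp add: word_at_def Let_def length_cyclic_window l_def)
qed

text \<open>Moving the start from the second copy of the prefix to the first preserves the window
  only if it ended inside the second copy; hence the condition
  \<open>wrap k z + M \<le> k\<close>.\<close>

lemma cyclic_window_wrap:
  assumes "k \<le> length x" "wrap k z + M \<le> k \<or> z \<le> k"
  shows "cyclic_window x k M (wrap k z) = cyclic_window x k M z"
  using assms by (auto simp: cyclic_window_def wrap_def)

section \<open>Splitting a window into two halves of the previous level\<close>

definition fst_half :: "nat \<Rightarrow> nat \<Rightarrow> nat \<Rightarrow> nat" where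
  "fst_half n M i = (if i < n then i else
     let l = Suc ((i - n) div (2 * M)); k = n div l in cyclic_index n M l k (k - (i - n) mod (2 * M)))"

definition snd_half :: "nat \<Rightarrow> nat \<Rightarrow> nat \<Rightarrow> nat" where
  "snd_half n M i = (if i < n then i + M else
     let l = Suc ((i - n) div (2 * M)); k = n div l in cyclic_index n M l k (wrap k (k - (i - n) mod (2 * M) + M)))"

text \<open>An \<open>l\<close> that is in use at level \<open>2 * M\<close> satisfies
  \<open>2 * M \<le> n div l\<close>, so it is in use at level \<open>M\<close> as well and both
  halves have names. A half of a wrapping window need not wrap; \<open>cyclic_index\<close> then
  refers to a window of \<open>x\<close>.\<close>

lemma halves:
  assumes "valid_index (length x) (2 * M) i" "1 \<le> M"
  shows "valid_index (length x) M (fst_half (length x) M i) \<and> valid_index (length x) M (snd_half (length x) M i) \<and>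
    word_at x (2 * M) i = word_at x M (fst_half (length x) M i) @ word_at x M (snd_half (length x) M i)"
proof (cases "i < length x")
  case True
  have "take (2 * M) (drop i x) = take M (drop i x) @ take M (drop (i + M) x)"
    by (simp only: mult_2 take_add drop_drop add.commute[of M i])
  with True show ?thesis using assms
    by (auto simp: valid_index_def word_at_def Let_def fst_half_def snd_half_def)
next
  case False
  define n where "n = length x"
  define l where "l = Suc ((i - n) div (2 * M))"
  define k where "k = n div l"
  define z where "z = k - (i - n) mod (2 * M)"
  have "(i - n) div (2 * M) < n div (2 * M)" using False assms
    by (simp add: valid_index_def less_mult_imp_div_less n_def)
  then have "l \<le> n div (2 * M)" by (simp add: l_def)
  then have "l * (2 * M) \<le> n" using assms(2) by (simp add: less_eq_div_iff_mult_less_eq)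
  then have Mk: "2 * M \<le> k" unfolding k_def
    by (simp add: less_eq_div_iff_mult_less_eq l_def mult.commute)
  have kn: "k \<le> n" by (simp add: k_def)
  have z: "z \<le> k" "wrap k (z + M) \<le> k" using Mk by (auto simp: z_def wrap_def)
  have M: "1 \<le> M" "M \<le> k" using assms(2) Mk by auto
  have l: "1 \<le> l" by (simp add: l_def)
  have f: "fst_half n M i = cyclic_index n M l k z" "snd_half n M i = cyclic_index n M l k (wrap k (z + M))"
    using False by (simp_all add: fst_half_def snd_half_def n_def l_def k_def z_def Let_def)
  have w: "word_at x (2 * M) i = cyclic_window x k (2 * M) z"
    using False by (simp add: word_at_def n_def l_def k_def z_def Let_def)
  have "cyclic_window x k (2 * M) z = cyclic_window x k M z @ cyclic_window x k M (z + M)"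
    unfolding cyclic_window_def by (simp only: mult_2 take_add drop_drop add.commute[of M z])
  also have "cyclic_window x k M (z + M) = cyclic_window x k M (wrap k (z + M))"
    by (rule cyclic_window_wrap[symmetric]) (use kn Mk z in \<open>auto simp: n_def wrap_def\<close>)
  finally have "cyclic_window x k (2 * M) z = cyclic_window x k M z @ cyclic_window x k M (wrap k (z + M))" .
  then show ?thesis
    using valid_cyclic_index[OF l k_def M z(1)] valid_cyclic_index[OF l k_def M z(2)]
      word_at_cyclic_index[OF l k_def[unfolded n_def] M z(1)] word_at_cyclic_index[OF l k_def[unfolded n_def] M z(2)] w f
    by (simp add: n_def)
qed

text \<open>Two words agree iff both halves do, and \<open>class_rep\<close> separates exactly the
  different pairs. The pairs at invalid indices are arbitrary: they may join or even represent a
  class, which does not affect comparisons between valid indices.\<close>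

lemma naming_double:
  assumes "naming x M f" "1 \<le> M"
    and I: "I = length x + (length x div (2 * M)) * (2 * M)"
    and A: "\<And>i. valid_index (length x) (2 * M) i \<Longrightarrow> A i = f (fst_half (length x) M i)"
    and B: "\<And>i. valid_index (length x) (2 * M) i \<Longrightarrow> B i = f (snd_half (length x) M i)"
    and R: "\<And>i. i < I \<Longrightarrow> R i = class_rep A B I i"
  shows "naming x (2 * M) R"
  unfolding naming_def
proof (intro allI impI)
  fix p q
  assume p: "valid_index (length x) (2 * M) p" and q: "valid_index (length x) (2 * M) q"
  have "p < I" "q < I" using p q by (auto simp: valid_index_def I split: if_splits)
  then have "R p = R q \<longleftrightarrow> A p = A q \<and> B p = B q" using R class_rep_eq_iff by simp
  also have "\<dots> \<longleftrightarrow> word_at x (2 * M) p = word_at x (2 * M) q"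
    using halves[OF p assms(2)] halves[OF q assms(2)] A[OF p] A[OF q] B[OF p] B[OF q] assms(1)
      length_word_at[OF _ assms(2)]
    unfolding naming_def by (metis append_eq_append_conv)
  finally show "R p = R q \<longleftrightarrow> word_at x (2 * M) p = word_at x (2 * M) q" .
qed

section \<open>Comparing blocks with rotations by their two ends\<close>

lemma eq_iff_ends:
  assumes "length p = k" "length q = k" "k \<le> 2 * M" "M \<le> k"
  shows "p = q \<longleftrightarrow> take M p = take M q \<and> drop (k - M) p = drop (k - M) q"
proof
  assume "take M p = take M q \<and> drop (k - M) p = drop (k - M) q"
  then have t: "take M p = take M q" and d: "drop (k - M) p = drop (k - M) q" by auto
  \<comment> \<open>As \<open>k - M \<le> M\<close>, this prefix lies within the first window; the
    last window supplies the rest.\<close>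
  have "take (k - M) p = take (k - M) q"
    using arg_cong[OF t, of "take (k - M)"] assms by (simp add: min_def split: if_splits)
  with d show "p = q" by (metis append_take_drop_id)
qed simp

definition block :: "nat \<Rightarrow> 'a list \<Rightarrow> nat \<Rightarrow> 'a list" where
  "block k x b = take k (drop (b * k) x)"

text \<open>The items \<open>i < l\<close> are the blocks, the items \<open>l + r\<close> are the rotations of the first block.\<close>

definition fst_end :: "nat \<Rightarrow> nat \<Rightarrow> nat \<Rightarrow> nat \<Rightarrow> nat \<Rightarrow> nat" where
  "fst_end n M l k i = (if i < l then i * k else cyclic_index n M l k (i - l))"

definition snd_end :: "nat \<Rightarrow> nat \<Rightarrow> nat \<Rightarrow> nat \<Rightarrow> nat \<Rightarrow> nat" where
  "snd_end n M l k i = (if i < l then i * k + (k - M) else cyclic_index n M l k (wrap k (i - l + (k - M))))"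

lemma drop_cyclic_window: "M \<le> k \<Longrightarrow> drop (k - M) (cyclic_window x k k r) = cyclic_window x k M (r + (k - M))"
  by (simp only: cyclic_window_def drop_take drop_drop diff_diff_cancel add.commute)

lemma take_cyclic_window: "M \<le> k \<Longrightarrow> take M (cyclic_window x k k r) = cyclic_window x k M r"
  by (simp only: cyclic_window_def take_take min.absorb1)

lemma rotate_cyclic_window:
  assumes "k \<le> length x" "r < k"
  shows "rotate r (take k x) = cyclic_window x k k r"
proof -
  have "rotate r (take k x) = drop r (take k x) @ take r (take k x)"
    using assms by (simp add: rotate_drop_take)
  then show ?thesis using assms by (simp add: cyclic_window_def)
qed

text \<open>
  A class is represented by its largest index, and rotations come after blocks: the
  representative is at least \<open>l\<close> iff the class contains a rotation.
\<close>

lemma class_rep_ends_iff: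
  assumes f: "naming x M f" and M: "1 \<le> M" "M \<le> k" "k \<le> 2 * M" and kl: "l * k = length x"
    and A: "\<And>i. i < l + k \<Longrightarrow> A i = f (fst_end (length x) M l k i)"
    and B: "\<And>i. i < l + k \<Longrightarrow> B i = f (snd_end (length x) M l k i)"
    and b: "b < l"
  shows "l \<le> class_rep A B (l + k) b \<longleftrightarrow> (\<exists>r<k. block k x b = rotate r (block k x 0))"
proof -
  have l: "1 \<le> l" "k = length x div l" using kl[symmetric] b by auto
  have kn: "k \<le> length x" using l by simp
  have bk: "b * k + k \<le> length x"
    using mult_le_mono1[of "Suc b" l k] b kl by simp
  have lb: "length (block k x b) = k" using bk by (simp add: block_def)
  have eq: "A (l + r) = A b \<and> B (l + r) = B b \<longleftrightarrow> block k x b = rotate r (block k x 0)" if r: "r < k" for r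
  proof -
    have z: "r \<le> k" "wrap k (r + (k - M)) \<le> k" using r by (auto simp: wrap_def)
    have lr: "length (rotate r (block k x 0)) = k" using kn by (simp add: block_def)
    have 1: "fst_end (length x) M l k b = b * k" "snd_end (length x) M l k b = b * k + (k - M)"
      "fst_end (length x) M l k (l + r) = cyclic_index (length x) M l k r"
      "snd_end (length x) M l k (l + r) = cyclic_index (length x) M l k (wrap k (r + (k - M)))"
      using b by (simp_all add: fst_end_def snd_end_def)
    have v: "valid_index (length x) M (b * k)" "valid_index (length x) M (b * k + (k - M))"
      using bk M by (auto simp: valid_index_def)
    have w: "word_at x M (b * k) = take M (block k x b)"
      "word_at x M (b * k + (k - M)) = drop (k - M) (block k x b)"
      using bk M less_le_trans[of "b * k" "b * k + k" "length x"] less_le_trans[of "b * k + (k - M)" "b * k + k" "length x"]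
      by (simp_all add: word_at_def block_def Let_def drop_take add.commute)
    have "drop (k - M) (rotate r (block k x 0)) = cyclic_window x k M (r + (k - M))"
      using rotate_cyclic_window[OF kn r] M drop_cyclic_window[of M k x r] by (simp add: block_def)
    \<comment> \<open>The last window of the rotation ends at \<open>r + k < 2 * k\<close>, inside
      the doubled prefix, so its start may be wrapped.\<close>
    also have "\<dots> = cyclic_window x k M (wrap k (r + (k - M)))"
      by (rule cyclic_window_wrap[symmetric]) (use kn M r in \<open>auto simp: wrap_def\<close>)
    finally have 2: "drop (k - M) (rotate r (block k x 0)) = cyclic_window x k M (wrap k (r + (k - M)))" .
    have 3: "take M (rotate r (block k x 0)) = cyclic_window x k M r"
      using rotate_cyclic_window[OF kn r] M by (simp add: block_def take_cyclic_window)
    have "A (l + r) = A b \<longleftrightarrow> take M (block k x b) = take M (rotate r (block k x 0))"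
      using f v valid_cyclic_index[OF l M(1,2) z(1)] word_at_cyclic_index[OF l M(1,2) z(1)] A[of b] A[of "l + r"] b r 1 w 3
      unfolding naming_def by auto
    moreover have "B (l + r) = B b \<longleftrightarrow> drop (k - M) (block k x b) = drop (k - M) (rotate r (block k x 0))"
      using f v valid_cyclic_index[OF l M(1,2) z(2)] word_at_cyclic_index[OF l M(1,2) z(2)] B[of b] B[of "l + r"] b r 1 w 2
      unfolding naming_def by auto
    ultimately show ?thesis using eq_iff_ends[OF lb lr M(3,2)] by blast
  qed
  have "l \<le> class_rep A B (l + k) b \<longleftrightarrow> (\<exists>q. l \<le> q \<and> q < l + k \<and> A q = A b \<and> B q = B b)"
    using b by (intro class_rep_ge_iff) simp
  also have "\<dots> \<longleftrightarrow> (\<exists>r<k. A (l + r) = A b \<and> B (l + r) = B b)"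
    by (metis le_add1 le_add_diff_inverse nat_add_left_cancel_less)
  finally show ?thesis using eq by blast
qed

section \<open>Cyclic periodicity in terms of blocks\<close>

lemma concat_blocks:
  "length x = l * k \<Longrightarrow> concat (map (block k x) [0..<l]) = x"
proof (induction l arbitrary: x)
  case (Suc l)
  have "map (block k x) [0..<Suc l] = block k x 0 # map (block k (drop k x)) [0..<l]"
    by (simp add: upt_conv_Cons map_Suc_upt[symmetric] block_def add.commute del: upt_Suc)
  then have "concat (map (block k x) [0..<Suc l]) = take k x @ drop k x"
    using Suc.IH[of "drop k x"] Suc.prems by (simp only: concat.simps) (simp add: block_def[of k x 0])
  then show ?case by simp
qed simp

lemma block_concat:
  assumes "\<forall>u\<in>set us. length u = k" "b < length us"
  shows "block k (concat us) b = us ! b"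
  using assms
proof (induction us arbitrary: b)
  case (Cons u us)
  then show ?case by (cases b) (auto simp: block_def)
qed simp

lemma is_rotation_of_iff: "is_rotation_of v u \<longleftrightarrow> (\<exists>r<length u. v = rotate r u)"
proof
  assume "\<exists>r<length u. v = rotate r u"
  then obtain r where "r < length u" "v = rotate r u" by blast
  then show "is_rotation_of v u" unfolding is_rotation_of_def by (intro bexI[of _ "Suc r"]) auto
next
  assume "is_rotation_of v u"
  then obtain \<delta> where "\<delta> \<in> {1..length u}" "v = rotate (\<delta> - 1) u" by (auto simp: is_rotation_of_def)
  then show "\<exists>r<length u. v = rotate r u" by (intro exI[of _ "\<delta> - 1"]) auto
qed

text \<open>Being a rotation is an equivalence, so comparing with the first block suffices: from
  block \<open>j\<close>, rotating by \<open>k - s\<close> leads back to the first block and by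
  \<open>r\<close> on to block \<open>i\<close>. As \<open>1 \<le> k\<close>, the number of blocks
  is determined by \<open>k\<close>.\<close>

lemma cyclic_periodic_iff:
  assumes "l * k = length x" "1 \<le> k"
  shows "cyclic_periodic k x \<longleftrightarrow> (\<forall>b<l. \<exists>r<k. block k x b = rotate r (block k x 0))"
proof
  assume "cyclic_periodic k x"
  then obtain l' us where h: "k * l' = length x" "length us = l'" "x = concat us" "\<forall>u\<in>set us. length u = k"
    "\<forall>i<l'. \<forall>j<l'. is_rotation_of (us ! i) (us ! j)"
    by (auto simp: cyclic_periodic_def has_cyclic_period_def)
  have "l' = l" using h(1) assms by (metis mult.commute mult_left_cancel not_one_le_zero)
  show "\<forall>b<l. \<exists>r<k. block k x b = rotate r (block k x 0)"
  proof (intro allI impI)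
    fix b assume b: "b < l"
    then have "is_rotation_of (us ! b) (us ! 0)" using h(5) \<open>l' = l\<close> by simp
    moreover have "length (us ! 0) = k" using h(2,4) b \<open>l' = l\<close> by simp
    moreover have "block k x b = us ! b" "block k x 0 = us ! 0"
      using block_concat[OF h(4)] b h(2,3) \<open>l' = l\<close> by auto
    ultimately show "\<exists>r<k. block k x b = rotate r (block k x 0)" by (simp add: is_rotation_of_iff)
  qed
next
  assume a: "\<forall>b<l. \<exists>r<k. block k x b = rotate r (block k x 0)"
  have len: "length (block k x b) = k" if "b < l" for b
    using mult_le_mono1[of "Suc b" l k] that assms by (simp add: block_def)
  let ?us = "map (block k x) [0..<l]"
  have "is_rotation_of (?us ! i) (?us ! j)" if ij: "i < l" "j < l" for i j
  proof -
    from a ij obtain r s where r: "r < k" "block k x i = rotate r (block k x 0)"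
      and s: "s < k" "block k x j = rotate s (block k x 0)" by blast
    have "rotate (k - s) (block k x j) = block k x 0"
      using s len[of 0] ij by (simp add: rotate_rotate)
    then have "block k x i = rotate (r + (k - s)) (block k x j)"
      using r by (simp add: rotate_rotate[symmetric])
    also have "\<dots> = rotate ((r + (k - s)) mod k) (block k x j)"
      using len[OF ij(2)] rotate_conv_mod by metis
    finally have "block k x i = rotate ((r + (k - s)) mod k) (block k x j)" .
    moreover have "(r + (k - s)) mod k < k" using assms(2) by simp
    ultimately show ?thesis using ij len[OF ij(2)] by (auto simp: is_rotation_of_iff)
  qed
  then have "has_cyclic_period k l x"
    unfolding has_cyclic_period_def using concat_blocks[of x l k] assms len
    by (intro conjI exI[of _ ?us]) (auto simp: mult.commute)
  then show "cyclic_periodic k x" by (auto simp: cyclic_periodic_def)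
qed

section \<open>One level\<close>

definition lookup :: com where
  "lookup = Cond (Op Less (Reg 3) (Op Plus (Reg 7) (Reg 1)))
     (Assign 8 (Ld 1 (Op Plus (Op Plus (Reg 0) (Op Times (Op Minus (Reg 2) (Const 1)) (Reg 1))) (Op Minus (Reg 3) (Reg 7)))))
     (Assign 8 (Ld 1 (Reg 7)))"

lemma vc_lookup:
  assumes r: "r 0 = n" "r 1 = M" "r 2 = l" "r 3 = k" "r 7 = z"
    and S: "64 * n + 64 \<le> S" and l: "1 \<le> l" "k = n div l" "1 \<le> M" "M \<le> k" "z \<le> k"
    and Q: "\<And>t'. t' \<le> t + 30 \<Longrightarrow> Q (r(8 := arr m 1 (cyclic_index n M l k z)), m) t'"
  shows "vc w S lookup Q (r, m) t"
proof -
  note d = div_facts[OF l(1-4)]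
  have "(l - 1) * M + M = l * M" using l(1) by (cases l) auto
  then have b: "(l - 1) * M + (k - z) \<le> n" if "k < z + M" using that d l by linarith
  have bnd: "z \<le> k" "k \<le> n" "M \<le> k" "l \<le> n" "1 \<le> l"
    using d(2) l order_trans[OF d(1) div_le_dividend] by auto
  show ?thesis
  proof (cases "k < z + M")
    case True
    note b = b[OF this]
    have "(l - 1) * M \<le> n" using b by simp
    moreover have "Q (r(8 := arr m 1 (n + (l - 1) * M + (k - z))), m) (t + 23)"
      using Q[of "t + 23"] True by (simp add: cyclic_index_def)
    moreover have "l - 1 < S" "k - z < S" "n + (l - 1) * M + (k - z) < S"
      using b S bnd by linarith+
    moreover have "16 * (n + (l - 1) * M + (k - z)) \<le> 16 * (2 * n)"
      using b by (intro mult_le_mono2) linarith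
    then have "16 * (n + (l - 1) * M + (k - z)) + 1 < S" using S by linarith
    ultimately show ?thesis unfolding lookup_def using True r S bnd by (simp add: add.commute)
  next
    case False
    moreover have "Q (r(8 := arr m 1 z), m) (t + 13)"
      using Q[of "t + 13"] False by (simp add: cyclic_index_def)
    ultimately show ?thesis unfolding lookup_def using r S bnd by (simp add: add.commute)
  qed
qed

definition wrap_reg :: com where
  "wrap_reg = Cond (Op Less (Reg 3) (Reg 7)) (Assign 7 (Op Minus (Reg 7) (Reg 3))) Skip"

lemma vc_wrap_reg:
  assumes "r 7 < S" "1 < S" "\<And>t'. t' \<le> t + 10 \<Longrightarrow> Q (r(7 := wrap (r 3) (r 7)), m) t'"
  shows "vc w S wrap_reg Q (r, m) t"
  using assms by (auto simp: wrap_reg_def wrap_def fun_upd_idem)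

text \<open>\<open>a\<close> is the item that receives the pair and \<open>d\<close> the distance
  between its two windows: \<open>M\<close> for halves, \<open>k - M\<close> for the ends of a
  rotation. Both are evaluated while registers 7 and 8 change, so they must not depend on
  them.\<close>

definition cyclic_pair :: "exp \<Rightarrow> exp \<Rightarrow> com" where
  "cyclic_pair a d =
     lookup ;; St 2 a (Reg 8) ;; Assign 7 (Op Plus (Reg 7) d) ;; wrap_reg ;; lookup ;; St 3 a (Reg 8)"

lemma vc_cyclic_pair:
  assumes r: "r 0 = n" "r 1 = M" "r 2 = l" "r 3 = k" "r 7 = z"
    and S: "64 * n + 64 \<le> S" and l: "1 \<le> l" "k = n div l" "1 \<le> M" "M \<le> k" "z \<le> k"
    and a: "\<And>s. (\<And>i. i \<notin> {7, 8} \<Longrightarrow> fst s i = r i) \<Longrightarrow> ev s a = p \<and> safe S s a" "p \<le> 2 * n" "cost a \<le> 5"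
    and d: "\<And>s. (\<And>i. i \<notin> {7, 8} \<Longrightarrow> fst s i = r i) \<Longrightarrow> ev s d = e \<and> safe S s d" "e \<le> k" "cost d \<le> 5"
    and Q: "\<And>v t'. t' \<le> t + 150 \<Longrightarrow>
      Q (r(8 := v, 7 := wrap k (z + e)), m(16 * p + 2 := arr m 1 (cyclic_index n M l k z),
        16 * p + 3 := arr m 1 (cyclic_index n M l k (wrap k (z + e))))) t'"
  shows "vc w S (cyclic_pair a d) Q (r, m) t"
proof -
  have kn: "k \<le> n" using l by simp
  have wk: "wrap k (z + e) \<le> k" using l d by (auto simp: wrap_def)
  let ?v = "arr m 1 (cyclic_index n M l k z)"
  have "vc w S (St 2 a (Reg 8) ;; Assign 7 (Op Plus (Reg 7) d) ;; wrap_reg ;; lookup ;; St 3 a (Reg 8)) Q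
      (r(8 := ?v), m) t1" if t1: "t1 \<le> t + 30" for t1
  proof -
    have "vc w S (wrap_reg ;; lookup ;; St 3 a (Reg 8)) Q (r(8 := ?v, 7 := z + e), m(16 * p + 2 := ?v)) t2"
      if t2: "t2 \<le> t + 60" for t2
      unfolding vc.simps(4)
    proof (rule vc_wrap_reg)
      show "(r(8 := ?v, 7 := z + e)) 7 < S" using l(5) d(2) kn S by simp
      show "1 < S" using S by simp
      fix t3 assume t3: "t3 \<le> t2 + 10"
      show "vc w S lookup (vc w S (St 3 a (Reg 8)) Q)
         ((r(8 := ?v, 7 := z + e))(7 := wrap ((r(8 := ?v, 7 := z + e)) 3) ((r(8 := ?v, 7 := z + e)) 7)),
          m(16 * p + 2 := ?v)) t3"
      proof (rule vc_lookup[where n = n and M = M and l = l and k = k and z = "wrap k (z + e)"])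
        fix t4 assume t4: "t4 \<le> t3 + 30"
        let ?s = "(r(8 := arr m 1 (cyclic_index n M l k (wrap k (z + e))), 7 := wrap k (z + e)), m(16 * p + 2 := ?v))"
        have "ev ?s a = p \<and> safe S ?s a" by (rule a(1)) auto
        moreover have "Q (r(8 := arr m 1 (cyclic_index n M l k (wrap k (z + e))), 7 := wrap k (z + e)),
            m(16 * p + 2 := ?v, 16 * p + 3 := arr m 1 (cyclic_index n M l k (wrap k (z + e)))))
          (t4 + (6 + cost a))"
          using Q[of "t4 + (6 + cost a)"] a(3) t2 t3 t4 by simp
        ultimately have "vc w S (St 3 a (Reg 8)) Q ?s t4"
          using S a(2,3) by simp
        then show "vc w S (St 3 a (Reg 8)) Q
          ((r(8 := ?v, 7 := z + e))(7 := wrap ((r(8 := ?v, 7 := z + e)) 3) ((r(8 := ?v, 7 := z + e)) 7),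
             8 := arr (m(16 * p + 2 := ?v)) 1 (cyclic_index n M l k (wrap k (z + e)))),
            m(16 * p + 2 := ?v)) t4"
          using r by (simp add: fun_upd_twist)
      qed (use r S l wk in auto)
    qed
    moreover have "ev (r(8 := ?v), m) a = p \<and> safe S (r(8 := ?v), m) a" by (rule a(1)) auto
    moreover have "ev (r(8 := ?v), m(16 * p + 2 := ?v)) d = e \<and> safe S (r(8 := ?v), m(16 * p + 2 := ?v)) d"
      by (rule d(1)) auto
    moreover have "z + e < S" using l(5) d(2) kn S by linarith
    ultimately show ?thesis using S a(2,3) d(3) t1 r by simp
  qed
  then show ?thesis
    unfolding cyclic_pair_def vc.simps(4)
    by (intro vc_lookup[OF r S l]) simp
qed

lemma vc_pairing:
  assumes "S \<le> 2 ^ w" "N \<le> L" "16 * L + 64 \<le> S" "r 6 = N"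
    and "\<And>i. i < N \<Longrightarrow> arr m 2 i < L" "\<And>i. i < N \<Longrightarrow> arr m 3 i < L"
    and "\<And>r' m' t'. frame {4, 5, 8} {4, 5, 6, 7} (r, m) (r', m') \<Longrightarrow>
      (\<And>i. i < N \<Longrightarrow> arr m' 7 i = class_rep (arr m 2) (arr m 3) N i) \<Longrightarrow> t' \<le> t + 300 * N + 100 \<Longrightarrow> Q (r', m') t'"
  shows "vc w S pairing Q (r, m) t"
  by (rule pairing_correct[where A = "arr m 2" and B = "arr m 3" and N = N and L = L])
    (use assms(1-6) in \<open>auto intro!: assms(7) simp: frame_def\<close>)

section \<open>Names for windows of twice the length\<close>

definition next_level :: com where
  "next_level =
    For 4 0 (Cond (Op Less (Reg 0) (Op Plus (Reg 4) (Reg 10)))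
      (St 2 (Reg 4) (Const 0) ;; St 3 (Reg 4) (Const 0))
      (St 2 (Reg 4) (Ld 1 (Reg 4)) ;; St 3 (Reg 4) (Ld 1 (Op Plus (Reg 4) (Reg 1))))) ;;
    Assign 9 (Op Times (Op Div (Reg 0) (Reg 10)) (Reg 10)) ;;
    For 4 9 (Assign 2 (Op Plus (Op Div (Reg 4) (Reg 10)) (Const 1)) ;;
      Assign 3 (Op Div (Reg 0) (Reg 2)) ;;
      Assign 7 (Op Minus (Reg 3) (Op Mod (Reg 4) (Reg 10))) ;;
      cyclic_pair (Op Plus (Reg 0) (Reg 4)) (Reg 1)) ;;
    Assign 6 (Op Plus (Reg 0) (Reg 9)) ;;
    pairing ;;
    For 4 6 (St 1 (Reg 4) (Ld 7 (Reg 4)))"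

text \<open>The bound \<open>2 * n + 2\<close> on names is reproduced: the new names are class
  representatives, hence indices below
  \<open>n + (n div (2 * M)) * (2 * M) \<le> 2 * n\<close>.\<close>

lemma vc_next_level:
  assumes Sw: "S \<le> 2 ^ w" and S: "64 * n + 64 \<le> S" and n: "n = length x"
    and r: "r 0 = n" "r 1 = M" "r 10 = 2 * M" and M: "1 \<le> M" "M \<le> n"
    and f: "naming x M (arr m 1)" "\<And>p. valid_index n M p \<Longrightarrow> arr m 1 p < 2 * n + 2"
    and Q: "\<And>r' m' t'. frame {2, 3, 4, 5, 6, 7, 8, 9} {1, 2, 3, 4, 5, 6, 7} (r, m) (r', m') \<Longrightarrow>
      naming x (2 * M) (arr m' 1) \<Longrightarrow> (\<And>p. valid_index n (2 * M) p \<Longrightarrow> arr m' 1 p < 2 * n + 2) \<Longrightarrow>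
      t' \<le> t + 2000 * n + 2000 \<Longrightarrow> Q (r', m') t'"
  shows "vc w S next_level Q (r, m) t"
proof -
  define W where "W = (n div (2 * M)) * (2 * M)"
  have Wn: "W \<le> n" by (simp add: W_def)
  \<comment> \<open>Positions too close to the end of \<open>x\<close> for a window of length
    \<open>2 * M\<close> still receive a pair, of two zeros, so that \<open>pairing\<close> finds a
    bounded key at every index.\<close>
  define P1 where "P1 = (\<lambda>i r' m'. frame {4} {2, 3} (r, m) (r', m') \<and> r' 4 = i \<and>
    (\<forall>q<i. arr m' 2 q = (if n < q + 2 * M then 0 else arr m 1 q) \<and>
           arr m' 3 q = (if n < q + 2 * M then 0 else arr m 1 (q + M))))"
  have 1: "vc w S (For 4 0 (Cond (Op Less (Reg 0) (Op Plus (Reg 4) (Reg 10)))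
      (St 2 (Reg 4) (Const 0) ;; St 3 (Reg 4) (Const 0))
      (St 2 (Reg 4) (Ld 1 (Reg 4)) ;; St 3 (Reg 4) (Ld 1 (Op Plus (Reg 4) (Reg 1)))))) Q' (r, m) t"
    if "\<And>r' m' t'. P1 n r' m' \<Longrightarrow> t' \<le> t + n * (40 + 8) + 6 \<Longrightarrow> Q' (r', m') t'" for Q'
  proof (rule vc_For[where P = P1 and N = n and C = 40, OF Sw])
    show "vc w S (Cond (Op Less (Reg 0) (Op Plus (Reg 4) (Reg 10)))
      (St 2 (Reg 4) (Const 0) ;; St 3 (Reg 4) (Const 0))
      (St 2 (Reg 4) (Ld 1 (Reg 4)) ;; St 3 (Reg 4) (Ld 1 (Op Plus (Reg 4) (Reg 1)))))
      (\<lambda>s' t'. fst s' 4 = i \<and> P1 (Suc i) ((fst s')(4 := Suc i)) (snd s') \<and> t' \<le> t + 40) (r', m') t"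
      if P: "P1 i r' m'" and i: "i < n" for i r' m' t
      using P i r S M by (auto simp: P1_def frame_def less_Suc_eq)
  qed (use that r S in \<open>auto simp: P1_def frame_def\<close>)
  define P2 where "P2 = (\<lambda>r1 m1 i r' m'. frame {2, 3, 4, 7, 8} {2, 3} (r1, m1) (r', m') \<and> r' 4 = i \<and>
    (\<forall>q<n. arr m' 2 q = arr m1 2 q \<and> arr m' 3 q = arr m1 3 q) \<and>
    (\<forall>q<i. arr m' 2 (n + q) = arr m 1 (fst_half n M (n + q)) \<and>
           arr m' 3 (n + q) = arr m 1 (snd_half n M (n + q))))"
  have 2: "vc w S (For 4 9 (Assign 2 (Op Plus (Op Div (Reg 4) (Reg 10)) (Const 1)) ;;
      Assign 3 (Op Div (Reg 0) (Reg 2)) ;;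
      Assign 7 (Op Minus (Reg 3) (Op Mod (Reg 4) (Reg 10))) ;;
      cyclic_pair (Op Plus (Reg 0) (Reg 4)) (Reg 1))) Q' (r1, m1) t1"
    if f1: "frame {4, 9} {2, 3} (r, m) (r1, m1)" and r9: "r1 9 = W"
      and Q': "\<And>r' m' t'. P2 r1 m1 W r' m' \<Longrightarrow> t' \<le> t1 + W * (200 + 8) + 6 \<Longrightarrow> Q' (r', m') t'"
    for Q' r1 m1 t1
  proof (rule vc_For[where P = "P2 r1 m1" and N = W and C = 200, OF Sw])
    show "vc w S (Assign 2 (Op Plus (Op Div (Reg 4) (Reg 10)) (Const 1)) ;;
      Assign 3 (Op Div (Reg 0) (Reg 2)) ;;
      Assign 7 (Op Minus (Reg 3) (Op Mod (Reg 4) (Reg 10))) ;;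
      cyclic_pair (Op Plus (Reg 0) (Reg 4)) (Reg 1))
      (\<lambda>s' t'. fst s' 4 = i \<and> P2 r1 m1 (Suc i) ((fst s')(4 := Suc i)) (snd s') \<and> t' \<le> t + 200) (r', m') t"
      if P: "P2 r1 m1 i r' m'" and i: "i < W" for i r' m' t
    proof -
      have fr: "frame {2, 3, 4, 7, 8, 9} {2, 3} (r, m) (r', m')"
        using P by (intro frame_trans[OF f1]) (auto simp: P2_def)
      have rr: "r' 0 = n" "r' 1 = M" "r' 10 = 2 * M" "r' 4 = i" "arr m' 1 = arr m 1"
        using fr r P by (auto simp: frame_def P2_def)
      define l where "l = Suc (i div (2 * M))"
      define k where "k = n div l"
      define z where "z = k - i mod (2 * M)"
      have "i div (2 * M) < n div (2 * M)" using i by (simp add: W_def less_mult_imp_div_less)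
      then have lM: "l \<le> n div (2 * M)" by (simp add: l_def)
      then have "l * (2 * M) \<le> n" using M by (simp add: less_eq_div_iff_mult_less_eq)
      then have Mk: "2 * M \<le> k" unfolding k_def
        by (simp add: less_eq_div_iff_mult_less_eq l_def mult.commute)
      have l: "1 \<le> l" "M \<le> k" "z \<le> k" "k \<le> n" "l \<le> n"
        using Mk order_trans[OF lM div_le_dividend] by (auto simp: l_def z_def k_def)
      have h: "fst_half n M (n + i) = cyclic_index n M l k z" "snd_half n M (n + i) = cyclic_index n M l k (wrap k (z + M))"
        by (simp_all add: fst_half_def snd_half_def l_def k_def z_def Let_def)
      have mod: "i mod (2 * M) < S" using mod_less_eq_dividend[of i "2 * M"] i Wn S by linarith
      have "vc w S (cyclic_pair (Op Plus (Reg 0) (Reg 4)) (Reg 1))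
        (\<lambda>s' t'. fst s' 4 = i \<and> P2 r1 m1 (Suc i) ((fst s')(4 := Suc i)) (snd s') \<and> t' \<le> t + 200)
        (r'(2 := l, 3 := k, 7 := z), m') t'" if t': "t' \<le> t + 40" for t'
      proof (rule vc_cyclic_pair[where n = n and M = M and l = l and k = k and z = z and p = "n + i" and e = M])
        fix v t''
        assume "t'' \<le> t' + 150"
        then show "fst ((r'(2 := l, 3 := k, 7 := z))(8 := v, 7 := wrap k (z + M)),
             m'(16 * (n + i) + 2 := arr m' 1 (cyclic_index n M l k z),
               16 * (n + i) + 3 := arr m' 1 (cyclic_index n M l k (wrap k (z + M))))) 4 = i \<and>
          P2 r1 m1 (Suc i) ((fst ((r'(2 := l, 3 := k, 7 := z))(8 := v, 7 := wrap k (z + M)),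
             m'(16 * (n + i) + 2 := arr m' 1 (cyclic_index n M l k z),
               16 * (n + i) + 3 := arr m' 1 (cyclic_index n M l k (wrap k (z + M))))))(4 := Suc i))
            (snd ((r'(2 := l, 3 := k, 7 := z))(8 := v, 7 := wrap k (z + M)),
             m'(16 * (n + i) + 2 := arr m' 1 (cyclic_index n M l k z),
               16 * (n + i) + 3 := arr m' 1 (cyclic_index n M l k (wrap k (z + M)))))) \<and> t'' \<le> t + 200"
          using P rr t' h by (auto simp: P2_def frame_def less_Suc_eq simp del: add_2_eq_Suc' distrib_left_numeral)
      qed (use rr S l M i Wn in \<open>auto simp: k_def\<close>)
      moreover have e: "i div (2 * M) = l - 1" "Suc (l - 1) = l" "n div l = k" "k - i mod (2 * M) = z"
        by (simp_all add: l_def k_def z_def)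
      moreover have "l - 1 < S" "l < S" "k < S" "z < S" using l S by linarith+
      ultimately show ?thesis
        using rr S mod by simp
    qed
    show "P2 r1 m1 0 (r1(4 := 0)) m1" by (auto simp: P2_def frame_def)
    show "r' 4 = i \<and> r' 9 = W" if "P2 r1 m1 i r' m'" for i r' m'
      using that r9 by (auto simp: P2_def frame_def)
  qed (use Q' S Wn in auto)
  have 3: "vc w S (pairing ;; For 4 6 (St 1 (Reg 4) (Ld 7 (Reg 4)))) Q (r2, m2) t2"
    if f2: "frame {2, 3, 4, 6, 7, 8, 9} {2, 3} (r, m) (r2, m2)" and r6: "r2 6 = n + W"
      and A1: "\<And>q. q < n \<Longrightarrow> arr m2 2 q = (if n < q + 2 * M then 0 else arr m 1 q) \<and>
           arr m2 3 q = (if n < q + 2 * M then 0 else arr m 1 (q + M))"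
      and A2: "\<And>q. q < W \<Longrightarrow> arr m2 2 (n + q) = arr m 1 (fst_half n M (n + q)) \<and>
           arr m2 3 (n + q) = arr m 1 (snd_half n M (n + q))"
      and t2: "t2 \<le> t + 300 * n + 100" for r2 m2 t2
  proof -
    have A: "arr m2 2 q = arr m 1 (fst_half n M q)" "arr m2 3 q = arr m 1 (snd_half n M q)"
      if "valid_index n (2 * M) q" for q
    proof -
      have "arr m2 2 q = arr m 1 (fst_half n M q) \<and> arr m2 3 q = arr m 1 (snd_half n M q)"
      proof (cases "q < n")
        case True
        then show ?thesis using that A1[of q] by (simp add: valid_index_def fst_half_def snd_half_def)
      next
        case False
        then have "q - n < W" "n + (q - n) = q" using that by (auto simp: valid_index_def W_def)
        then show ?thesis using A2[of "q - n"] by simp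
      qed
      then show "arr m2 2 q = arr m 1 (fst_half n M q)" "arr m2 3 q = arr m 1 (snd_half n M q)" by auto
    qed
    have AL: "arr m2 2 q < 2 * n + 2 \<and> arr m2 3 q < 2 * n + 2" if "q < n + W" for q
    proof (cases "valid_index n (2 * M) q")
      case True
      then show ?thesis using A[OF True] f(2) halves[of x M q] M n by simp
    next
      case False
      then show ?thesis using that A1[of q] by (auto simp: valid_index_def W_def split: if_splits)
    qed
    show ?thesis
      unfolding vc.simps(4)
    \<comment> \<open>The space condition reads \<open>32 * n + 96 \<le> 64 * n + 64\<close>; it
      holds because \<open>1 \<le> M \<le> n\<close>.\<close>
    proof (rule vc_pairing[where N = "n + W" and L = "2 * n + 2", OF Sw])
      fix r3 m3 t3
      assume f3: "frame {4, 5, 8} {4, 5, 6, 7} (r2, m2) (r3, m3)"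
        and R: "\<And>i. i < n + W \<Longrightarrow> arr m3 7 i = class_rep (arr m2 2) (arr m2 3) (n + W) i"
        and t3: "t3 \<le> t2 + 300 * (n + W) + 100"
      have f3': "frame {2, 3, 4, 5, 6, 7, 8, 9} {2, 3, 4, 5, 6, 7} (r, m) (r3, m3)"
        by (rule frame_trans[OF f2 f3]) auto
      define P3 where "P3 = (\<lambda>i r' m'. frame {4} {1} (r3, m3) (r', m') \<and> r' 4 = i \<and>
        (\<forall>q<i. arr m' 1 q = arr m3 7 q))"
      have r36: "r3 6 = n + W" using f3 r6 by (simp add: frame_def)
      show "vc w S (For 4 6 (St 1 (Reg 4) (Ld 7 (Reg 4)))) Q (r3, m3) t3"
      proof (rule vc_For[where P = P3 and N = "n + W" and C = 40, OF Sw])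
        show "vc w S (St 1 (Reg 4) (Ld 7 (Reg 4)))
          (\<lambda>s' t'. fst s' 4 = i \<and> P3 (Suc i) ((fst s')(4 := Suc i)) (snd s') \<and> t' \<le> t + 40) (r', m') t"
          if P: "P3 i r' m'" and i: "i < n + W" for i r' m' t
          using P i S Wn by (auto simp: P3_def frame_def less_Suc_eq)
        fix r4 m4 t4
        assume P: "P3 (n + W) r4 m4" and t4: "t4 \<le> t3 + (n + W) * (40 + 8) + 6"
        have m4: "arr m4 1 i = class_rep (arr m2 2) (arr m2 3) (n + W) i" if "i < n + W" for i
          using P R that by (simp add: P3_def)
        show "Q (r4, m4) t4"
        proof (rule Q)
          show "frame {2, 3, 4, 5, 6, 7, 8, 9} {1, 2, 3, 4, 5, 6, 7} (r, m) (r4, m4)"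
            by (rule frame_trans[OF f3']) (use P in \<open>auto simp: P3_def\<close>)
          show "naming x (2 * M) (arr m4 1)"
            by (rule naming_double[OF f(1) M(1), where I = "n + W" and A = "arr m2 2" and B = "arr m2 3"])
              (use A m4 n in \<open>auto simp: W_def\<close>)
          show "t4 \<le> t + 2000 * n + 2000" using t4 t3 t2 Wn by simp
          fix p assume "valid_index n (2 * M) p"
          then have "p < n + W" by (auto simp: valid_index_def W_def split: if_splits)
          then show "arr m4 1 p < 2 * n + 2" using class_rep_props[of p "n + W" "arr m2 2" "arr m2 3"] m4 Wn by simp
        qed
      qed (use r36 S Wn in \<open>auto simp: P3_def frame_def\<close>)
    qed (use S Wn r6 AL M in auto)
  qed
  show ?thesis
    unfolding next_level_def vc.simps(4)
  proof (rule 1)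
    fix r1 m1 t1
    assume P: "P1 n r1 m1" and t1: "t1 \<le> t + n * (40 + 8) + 6"
    then have f1: "frame {4} {2, 3} (r, m) (r1, m1)" by (simp add: P1_def)
    have rr: "r1 0 = n" "r1 10 = 2 * M" using f1 r by (auto simp: frame_def)
    have "vc w S (For 4 9 (Assign 2 (Op Plus (Op Div (Reg 4) (Reg 10)) (Const 1)) ;;
      Assign 3 (Op Div (Reg 0) (Reg 2)) ;;
      Assign 7 (Op Minus (Reg 3) (Op Mod (Reg 4) (Reg 10))) ;;
      cyclic_pair (Op Plus (Reg 0) (Reg 4)) (Reg 1)))
      (vc w S (Assign 6 (Op Plus (Reg 0) (Reg 9))) (vc w S pairing (vc w S (For 4 6 (St 1 (Reg 4) (Ld 7 (Reg 4)))) Q)))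
      (r1(9 := W), m1) t2" if t2: "t2 \<le> t1 + 10" for t2
    proof (rule 2)
      show f2: "frame {4, 9} {2, 3} (r, m) (r1(9 := W), m1)" using f1 by (auto simp: frame_def)
      fix r2 m2 t3
      assume P2: "P2 (r1(9 := W)) m1 W r2 m2" and t3: "t3 \<le> t2 + W * (200 + 8) + 6"
      have f3: "frame {2, 3, 4, 7, 8, 9} {2, 3} (r, m) (r2, m2)"
        by (rule frame_trans[OF f2]) (use P2 in \<open>auto simp: P2_def\<close>)
      have r2: "r2 0 = n" "r2 9 = W" using f3 r P2 by (auto simp: frame_def P2_def)
      have "vc w S (pairing ;; For 4 6 (St 1 (Reg 4) (Ld 7 (Reg 4)))) Q (r2(6 := n + W), m2) (t3 + (1 + cost (Op Plus (Reg 0) (Reg 9))))"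
      proof (rule 3)
        show "frame {2, 3, 4, 6, 7, 8, 9} {2, 3} (r, m) (r2(6 := n + W), m2)"
          using f3 by (auto simp: frame_def)
        show "arr m2 2 q = (if n < q + 2 * M then 0 else arr m 1 q) \<and>
           arr m2 3 q = (if n < q + 2 * M then 0 else arr m 1 (q + M))" if "q < n" for q
          using P P2 that by (simp add: P1_def P2_def)
        show "arr m2 2 (n + q) = arr m 1 (fst_half n M (n + q)) \<and>
           arr m2 3 (n + q) = arr m 1 (snd_half n M (n + q))" if "q < W" for q
          using P2 that by (simp add: P2_def)
      qed (use t1 t2 t3 Wn in auto)
      then show "vc w S (Assign 6 (Op Plus (Reg 0) (Reg 9)))
        (vc w S pairing (vc w S (For 4 6 (St 1 (Reg 4) (Ld 7 (Reg 4)))) Q)) (r2, m2) t3"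
        using r2 S Wn by simp
    qed (use rr in auto)
    then show "vc w S (Assign 9 (Op Times (Op Div (Reg 0) (Reg 10)) (Reg 10))) (vc w S (For 4 9 (Assign 2 (Op Plus (Op Div (Reg 4) (Reg 10)) (Const 1)) ;;
      Assign 3 (Op Div (Reg 0) (Reg 2)) ;;
      Assign 7 (Op Minus (Reg 3) (Op Mod (Reg 4) (Reg 10))) ;;
      cyclic_pair (Op Plus (Reg 0) (Reg 4)) (Reg 1)))
      (vc w S (Assign 6 (Op Plus (Reg 0) (Reg 9))) (vc w S pairing (vc w S (For 4 6 (St 1 (Reg 4) (Ld 7 (Reg 4)))) Q))))
      (r1, m1) t1"
      using rr S Wn order_le_less_trans[OF div_le_dividend, of n S "2 * M"]
      by (simp add: W_def[symmetric])
  qed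
qed

section \<open>Checking a single length\<close>

definition check_length :: com where
  "check_length =
    For 4 2 (Assign 7 (Op Times (Reg 4) (Reg 3)) ;; St 2 (Reg 4) (Ld 1 (Reg 7)) ;;
      St 3 (Reg 4) (Ld 1 (Op Plus (Reg 7) (Op Minus (Reg 3) (Reg 1))))) ;;
    For 4 3 (Assign 7 (Reg 4) ;; cyclic_pair (Op Plus (Reg 2) (Reg 4)) (Op Minus (Reg 3) (Reg 1))) ;;
    Assign 6 (Op Plus (Reg 2) (Reg 3)) ;;
    pairing ;;
    Assign 9 (Const 1) ;;
    For 4 2 (Cond (Op Less (Ld 7 (Reg 4)) (Reg 2)) (Assign 9 (Const 0)) Skip) ;;
    St 8 (Reg 3) (Reg 9)"

text \<open>The cost is linear in the number \<open>l + k\<close> of items, blocks and rotations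
  together; this is the summand in the later sum over the divisors of \<open>n\<close>.\<close>

lemma vc_check_length:
  assumes Sw: "S \<le> 2 ^ w" and S: "64 * n + 64 \<le> S" and n: "n = length x"
    and r: "r 0 = n" "r 1 = M" "r 2 = l" "r 3 = k" and M: "1 \<le> M" "M \<le> k" "k \<le> 2 * M"
    and lk: "l * k = n" "1 \<le> n"
    and f: "naming x M (arr m 1)" "\<And>p. valid_index n M p \<Longrightarrow> arr m 1 p < 2 * n + 2"
    and Q: "\<And>r' m' t'. frame {4, 5, 6, 7, 8, 9} {2, 3, 4, 5, 6, 7, 8} (r, m) (r', m') \<Longrightarrow>
      arr m' 8 = (arr m 8)(k := (if cyclic_periodic k x then 1 else 0)) \<Longrightarrow>
      t' \<le> t + 1000 * (l + k) + 1000 \<Longrightarrow> Q (r', m') t'"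
  shows "vc w S check_length Q (r, m) t"
proof -
  have l: "1 \<le> l" "k = n div l" "l \<le> n" "k \<le> n" using lk M by (auto intro: Suc_leI)
  have blkn: "i * k + k \<le> n" if "i < l" for i
    using mult_le_mono1[of "Suc i" l k] that lk by simp
  define P1 where "P1 = (\<lambda>i r' m'. frame {4, 7} {2, 3} (r, m) (r', m') \<and> r' 4 = i \<and>
    (\<forall>q<i. arr m' 2 q = arr m 1 (fst_end n M l k q) \<and> arr m' 3 q = arr m 1 (snd_end n M l k q)))"
  have 1: "vc w S (For 4 2 (Assign 7 (Op Times (Reg 4) (Reg 3)) ;; St 2 (Reg 4) (Ld 1 (Reg 7)) ;;
      St 3 (Reg 4) (Ld 1 (Op Plus (Reg 7) (Op Minus (Reg 3) (Reg 1)))))) Q' (r, m) t"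
    if "\<And>r' m' t'. P1 l r' m' \<Longrightarrow> t' \<le> t + l * (50 + 8) + 6 \<Longrightarrow> Q' (r', m') t'" for Q'
  proof (rule vc_For[where P = P1 and N = l and C = 50, OF Sw])
    show "vc w S (Assign 7 (Op Times (Reg 4) (Reg 3)) ;; St 2 (Reg 4) (Ld 1 (Reg 7)) ;;
      St 3 (Reg 4) (Ld 1 (Op Plus (Reg 7) (Op Minus (Reg 3) (Reg 1)))))
      (\<lambda>s' t'. fst s' 4 = i \<and> P1 (Suc i) ((fst s')(4 := Suc i)) (snd s') \<and> t' \<le> t + 50) (r', m') t"
      if P: "P1 i r' m'" and i: "i < l" for i r' m' t
    proof -
      have e: "fst_end n M l k i = i * k" "snd_end n M l k i = i * k + (k - M)"
        using i by (simp_all add: fst_end_def snd_end_def)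
      have fr: "frame {4, 7} {2, 3} (r, m) (r', m')" using P by (simp add: P1_def)
      have rr: "r' 1 = M" "r' 3 = k" "r' 4 = i" "arr m' 1 = arr m 1"
        using fr r P by (auto simp: frame_def P1_def)
      have "P1 (Suc i) (r'(7 := i * k, 4 := Suc i)) (m'(16 * i + 2 := arr m 1 (i * k), 16 * i + 3 := arr m 1 (i * k + (k - M))))"
        using P by (auto simp: P1_def frame_def less_Suc_eq e)
      moreover have "i * k + (k - M) \<le> n" using blkn[OF i] by linarith
      from mult_le_mono2[OF this, of 16] this
      have "i * k < S" "k - M < S" "i * k + (k - M) < S" "16 * (i * k) + 1 < S"
        "16 * (i * k + (k - M)) + 1 < S"
        using S by linarith+
      moreover have "16 * i + 2 < S" "16 * i + 3 < S" "16 < S" "0 < S"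
        using S l i by linarith+
      ultimately show ?thesis using rr by simp
    qed
  qed (use that r S l(1,3,4) in \<open>auto simp: P1_def frame_def\<close>)
  define P2 where "P2 = (\<lambda>r1 m1 i r' m'. frame {4, 7, 8} {2, 3} (r1, m1) (r', m') \<and> r' 4 = i \<and>
    (\<forall>q<l + i. arr m' 2 q = arr m 1 (fst_end n M l k q) \<and> arr m' 3 q = arr m 1 (snd_end n M l k q)))"
  have 2: "vc w S (For 4 3 (Assign 7 (Reg 4) ;; cyclic_pair (Op Plus (Reg 2) (Reg 4)) (Op Minus (Reg 3) (Reg 1))))
      Q' (r1, m1) t1"
    if P1: "P1 l r1 m1"
      and Q': "\<And>r' m' t'. P2 r1 m1 k r' m' \<Longrightarrow> t' \<le> t1 + k * (200 + 8) + 6 \<Longrightarrow> Q' (r', m') t'"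
    for Q' r1 m1 t1
  proof (rule vc_For[where P = "P2 r1 m1" and N = k and C = 200, OF Sw])
    have f1: "frame {4, 7} {2, 3} (r, m) (r1, m1)" using P1 by (simp add: P1_def)
    show "vc w S (Assign 7 (Reg 4) ;; cyclic_pair (Op Plus (Reg 2) (Reg 4)) (Op Minus (Reg 3) (Reg 1)))
      (\<lambda>s' t'. fst s' 4 = i \<and> P2 r1 m1 (Suc i) ((fst s')(4 := Suc i)) (snd s') \<and> t' \<le> t + 200) (r', m') t"
      if P: "P2 r1 m1 i r' m'" and i: "i < k" for i r' m' t
    proof -
      have fr: "frame {4, 7, 8} {2, 3} (r, m) (r', m')"
        using P by (intro frame_trans[OF f1]) (auto simp: P2_def)
      have rr: "r' 0 = n" "r' 1 = M" "r' 2 = l" "r' 3 = k" "r' 4 = i" "arr m' 1 = arr m 1"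
        using fr r P by (auto simp: frame_def P2_def)
      have h: "fst_end n M l k (l + i) = cyclic_index n M l k i"
        "snd_end n M l k (l + i) = cyclic_index n M l k (wrap k (i + (k - M)))"
        by (simp_all add: fst_end_def snd_end_def)
      have "vc w S (cyclic_pair (Op Plus (Reg 2) (Reg 4)) (Op Minus (Reg 3) (Reg 1)))
        (\<lambda>s' t'. fst s' 4 = i \<and> P2 r1 m1 (Suc i) ((fst s')(4 := Suc i)) (snd s') \<and> t' \<le> t + 200)
        (r'(7 := i), m') t'" if t': "t' \<le> t + 40" for t'
      proof (rule vc_cyclic_pair[where n = n and M = M and l = l and k = k and z = i and p = "l + i" and e = "k - M"])
        show "t'' \<le> t' + 150 \<Longrightarrow> fst ((r'(7 := i))(8 := v, 7 := wrap k (i + (k - M))),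
             m'(16 * (l + i) + 2 := arr m' 1 (cyclic_index n M l k i),
               16 * (l + i) + 3 := arr m' 1 (cyclic_index n M l k (wrap k (i + (k - M)))))) 4 = i \<and>
          P2 r1 m1 (Suc i) ((fst ((r'(7 := i))(8 := v, 7 := wrap k (i + (k - M))),
             m'(16 * (l + i) + 2 := arr m' 1 (cyclic_index n M l k i),
               16 * (l + i) + 3 := arr m' 1 (cyclic_index n M l k (wrap k (i + (k - M)))))))(4 := Suc i))
            (snd ((r'(7 := i))(8 := v, 7 := wrap k (i + (k - M))),
             m'(16 * (l + i) + 2 := arr m' 1 (cyclic_index n M l k i),
               16 * (l + i) + 3 := arr m' 1 (cyclic_index n M l k (wrap k (i + (k - M))))))) \<and> t'' \<le> t + 200" for v t''
          using P rr t' h by (auto simp: P2_def frame_def less_Suc_eq simp del: add_2_eq_Suc' distrib_left_numeral)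
        show "k = n div l" by (rule l(2))
      qed (use rr S l(1,3,4) M i in auto)
      then show ?thesis using rr by simp
    qed
    show "P2 r1 m1 0 (r1(4 := 0)) m1" using P1 by (auto simp: P1_def P2_def frame_def)
    show "r' 4 = i \<and> r' 3 = k" if "P2 r1 m1 i r' m'" for i r' m'
      using that f1 r by (auto simp: P2_def frame_def)
  qed (use Q' S l(1,3,4) in auto)
  have 3: "vc w S (pairing ;; Assign 9 (Const 1) ;;
      For 4 2 (Cond (Op Less (Ld 7 (Reg 4)) (Reg 2)) (Assign 9 (Const 0)) Skip) ;;
      St 8 (Reg 3) (Reg 9)) Q (r2, m2) t2"
    if f2: "frame {4, 6, 7, 8} {2, 3} (r, m) (r2, m2)" and r6: "r2 6 = l + k"
      and A: "\<And>q. q < l + k \<Longrightarrow> arr m2 2 q = arr m 1 (fst_end n M l k q) \<and> arr m2 3 q = arr m 1 (snd_end n M l k q)"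
      and t2: "t2 \<le> t + 300 * (l + k) + 100" for r2 m2 t2
  proof -
    have AL: "arr m2 2 q < 2 * n + 2 \<and> arr m2 3 q < 2 * n + 2" if q: "q < l + k" for q
    proof -
      have "valid_index n M (fst_end n M l k q) \<and> valid_index n M (snd_end n M l k q)"
      proof (cases "q < l")
        case True
        then show ?thesis using blkn[OF True] M by (auto simp: fst_end_def snd_end_def valid_index_def)
      next
        case False
        then show ?thesis using q M l
          by (auto simp: fst_end_def snd_end_def wrap_def intro!: valid_cyclic_index)
      qed
      then show ?thesis using A[OF q] f(2) by simp
    qed
    show ?thesis
      unfolding vc.simps(4)
    proof (rule vc_pairing[where N = "l + k" and L = "2 * n + 2", OF Sw])
      fix r3 m3 t3
      assume f3: "frame {4, 5, 8} {4, 5, 6, 7} (r2, m2) (r3, m3)"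
        and R: "\<And>i. i < l + k \<Longrightarrow> arr m3 7 i = class_rep (arr m2 2) (arr m2 3) (l + k) i"
        and t3: "t3 \<le> t2 + 300 * (l + k) + 100"
      have f3': "frame {4, 5, 6, 7, 8} {2, 3, 4, 5, 6, 7} (r, m) (r3, m3)"
        by (rule frame_trans[OF f2 f3]) auto
      have r3: "r3 2 = l" "r3 3 = k" using f3' r by (auto simp: frame_def)
      define P3 where "P3 = (\<lambda>i r' m'. frame {4, 9} {} (r3, m3) (r', m') \<and> r' 4 = i \<and>
        r' 9 = (if \<forall>q<i. l \<le> arr m3 7 q then 1 else 0))"
      have "vc w S (For 4 2 (Cond (Op Less (Ld 7 (Reg 4)) (Reg 2)) (Assign 9 (Const 0)) Skip))
        (vc w S (St 8 (Reg 3) (Reg 9)) Q) (r3(9 := 1), m3) t3'" if t3': "t3' \<le> t3 + 10" for t3'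
      proof (rule vc_For[where P = P3 and N = l and C = 40, OF Sw])
        show "P3 0 ((r3(9 := 1))(4 := 0)) m3" by (simp add: P3_def frame_def)
        show "vc w S (Cond (Op Less (Ld 7 (Reg 4)) (Reg 2)) (Assign 9 (Const 0)) Skip)
          (\<lambda>s' t'. fst s' 4 = i \<and> P3 (Suc i) ((fst s')(4 := Suc i)) (snd s') \<and> t' \<le> t + 40) (r', m') t"
          if P: "P3 i r' m'" and i: "i < l" for i r' m' t
        proof -
          have "arr m' 7 = arr m3 7" using P by (simp add: P3_def frame_def)
          moreover have "r' 2 = l" using P r3 by (simp add: P3_def frame_def)
          ultimately show ?thesis using P i S l(1,3,4) by (auto simp: P3_def frame_def less_Suc_eq)
        qed
        fix r4 m4 t4
        assume P: "P3 l r4 m4" and t4: "t4 \<le> t3' + l * (40 + 8) + 6"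
        have f4: "frame {4, 5, 6, 7, 8, 9} {2, 3, 4, 5, 6, 7} (r, m) (r4, m4)"
          by (rule frame_trans[OF f3']) (use P in \<open>auto simp: P3_def\<close>)
        have r4: "r4 3 = k" using f4 r by (simp add: frame_def)
        have "(\<forall>q<l. l \<le> arr m3 7 q) \<longleftrightarrow> (\<forall>q<l. \<exists>r<k. block k x q = rotate r (block k x 0))"
          using class_rep_ends_iff[OF f(1) M, of l "arr m2 2" "arr m2 3"] A R lk n by auto
        also have "\<dots> \<longleftrightarrow> cyclic_periodic k x"
          using cyclic_periodic_iff[of l k x] lk n M by simp
        finally have r9: "r4 9 = (if cyclic_periodic k x then 1 else 0)"
          using P by (simp add: P3_def)
        have "Q (r4, m4(16 * k + 8 := r4 9)) (t4 + (1 + 1 + 5))"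
        proof (rule Q)
          show "frame {4, 5, 6, 7, 8, 9} {2, 3, 4, 5, 6, 7, 8} (r, m) (r4, m4(16 * k + 8 := r4 9))"
            using f4 by (auto simp: frame_def)
          show "arr (m4(16 * k + 8 := r4 9)) 8 = (arr m 8)(k := (if cyclic_periodic k x then 1 else 0))"
            using f4 r9 by (simp add: frame_def)
          show "t4 + (1 + 1 + 5) \<le> t + 1000 * (l + k) + 1000" using t4 t3' t3 t2 by simp
        qed
        then show "vc w S (St 8 (Reg 3) (Reg 9)) Q (r4, m4) t4" using r4 S l(1,3,4) by simp
      qed (use r3 S l(1,3,4) in \<open>auto simp: P3_def frame_def\<close>)
      then show "vc w S (Assign 9 (Const 1)) (vc w S (For 4 2 (Cond (Op Less (Ld 7 (Reg 4)) (Reg 2)) (Assign 9 (Const 0)) Skip))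
        (vc w S (St 8 (Reg 3) (Reg 9)) Q)) (r3, m3) t3"
        using S by simp
    qed (use S l(1,3,4) lk(2) r6 AL in auto)
  qed
  show ?thesis
    unfolding check_length_def vc.simps(4)
  proof (rule 1, rule 2)
    fix r1 m1 t1 r2 m2 t2
    assume P: "P1 l r1 m1" and t1: "t1 \<le> t + l * (50 + 8) + 6"
      and P2: "P2 r1 m1 k r2 m2" and t2: "t2 \<le> t1 + k * (200 + 8) + 6"
    have "frame {4, 7} {2, 3} (r, m) (r1, m1)" using P by (simp add: P1_def)
    then have f2: "frame {4, 7, 8} {2, 3} (r, m) (r2, m2)"
      by (rule frame_trans) (use P2 in \<open>auto simp: P2_def\<close>)
    have "vc w S (pairing ;; Assign 9 (Const 1) ;;
      For 4 2 (Cond (Op Less (Ld 7 (Reg 4)) (Reg 2)) (Assign 9 (Const 0)) Skip) ;;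
      St 8 (Reg 3) (Reg 9)) Q (r2(6 := l + k), m2) (t2 + (1 + cost (Op Plus (Reg 2) (Reg 3))))"
    proof (rule 3)
      show "frame {4, 6, 7, 8} {2, 3} (r, m) (r2(6 := l + k), m2)" using f2 by (auto simp: frame_def)
    qed (use P2 t1 t2 in \<open>auto simp: P2_def\<close>)
    then show "vc w S (Assign 6 (Op Plus (Reg 2) (Reg 3))) (vc w S pairing (vc w S (Assign 9 (Const 1))
      (vc w S (For 4 2 (Cond (Op Less (Ld 7 (Reg 4)) (Reg 2)) (Assign 9 (Const 0)) Skip))
        (vc w S (St 8 (Reg 3) (Reg 9)) Q)))) (r2, m2) t2"
      using f2 r S l(1,3,4) by (simp add: frame_def vc_Seq)
  qed assumption
qed

section \<open>Names of single letters\<close>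

definition sorted_run :: "(nat \<Rightarrow> nat) \<Rightarrow> (nat \<Rightarrow> nat) \<Rightarrow> nat \<Rightarrow> nat \<Rightarrow> bool" where
  "sorted_run V f a b \<longleftrightarrow> (\<forall>p q. a \<le> p \<longrightarrow> p \<le> q \<longrightarrow> q < b \<longrightarrow> V (f p) \<le> V (f q))"

text \<open>Registers 4 and 5 are the heads of the runs ending at registers 3 and 6, and register 7
  is the output position. Register 8 becomes nonzero to take from the right run. Operators evaluate
  both operands, so the range tests are nested conditionals before the loads: past the runs, array 9
  need not contain indices.\<close>

definition merge_runs :: com where
  "merge_runs =
    While (Op Less (Reg 7) (Reg 6))
      (Assign 8 (Const 0) ;;
       Cond (Op Less (Reg 5) (Reg 6))
         (Cond (Op Less (Reg 4) (Reg 3))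
           (Assign 8 (Op Less (Ld 0 (Ld 9 (Reg 5))) (Ld 0 (Ld 9 (Reg 4)))))
           (Assign 8 (Const 1)))
         Skip ;;
       Cond (Reg 8)
         (St 10 (Reg 7) (Ld 9 (Reg 5)) ;; Assign 5 (Op Plus (Reg 5) (Const 1)))
         (St 10 (Reg 7) (Ld 9 (Reg 4)) ;; Assign 4 (Op Plus (Reg 4) (Const 1))) ;;
       Assign 7 (Op Plus (Reg 7) (Const 1)))"

lemma vc_merge_runs:
  assumes Sw: "S \<le> 2 ^ w" and S: "16 * n + 64 \<le> S"
    and b: "lo \<le> mid" "mid \<le> hi" "hi \<le> n"
    and r: "r 3 = mid" "r 6 = hi" "r 4 = lo" "r 5 = mid" "r 7 = lo"
    and V: "arr m 0 = V" and f: "arr m 9 = f" "f ` {lo..<hi} \<subseteq> {..<n}"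
    and s: "sorted_run V f lo mid" "sorted_run V f mid hi"
    and Q: "\<And>r' m' t'. frame {4, 5, 7, 8} {10} (r, m) (r', m') \<Longrightarrow>
      (\<And>q. q < lo \<Longrightarrow> arr m' 10 q = arr m 10 q) \<Longrightarrow> sorted_run V (arr m' 10) lo hi \<Longrightarrow>
      arr m' 10 ` {lo..<hi} = f ` {lo..<hi} \<Longrightarrow> t' \<le> t + 100 * (hi - lo) + 10 \<Longrightarrow> Q (r', m') t'"
  shows "vc w S merge_runs Q (r, m) t"
  unfolding merge_runs_def
proof -
  \<comment> \<open>The output position is \<open>i + j - mid\<close>, written without subtraction.
    Everything already output is at most everything still waiting in either run, so appending the
    smaller head keeps the output sorted.\<close>
  define J where "J = (\<lambda>i j r' m'. frame {4, 5, 7, 8} {10} (r, m) (r', m') \<and> r' 4 = i \<and> r' 5 = j \<and>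
    lo \<le> i \<and> i \<le> mid \<and> mid \<le> j \<and> j \<le> hi \<and> r' 7 + mid = i + j \<and>
    (\<forall>q<lo. arr m' 10 q = arr m 10 q) \<and> sorted_run V (arr m' 10) lo (r' 7) \<and>
    arr m' 10 ` {lo..<r' 7} = f ` {lo..<i} \<union> f ` {mid..<j} \<and>
    (\<forall>q. lo \<le> q \<longrightarrow> q < r' 7 \<longrightarrow> (\<forall>a. i \<le> a \<longrightarrow> a < mid \<longrightarrow> V (arr m' 10 q) \<le> V (f a)) \<and>
      (\<forall>a. j \<le> a \<longrightarrow> a < hi \<longrightarrow> V (arr m' 10 q) \<le> V (f a))))"
  let ?body = "Assign 8 (Const 0) ;;
       Cond (Op Less (Reg 5) (Reg 6))
         (Cond (Op Less (Reg 4) (Reg 3))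
           (Assign 8 (Op Less (Ld 0 (Ld 9 (Reg 5))) (Ld 0 (Ld 9 (Reg 4)))))
           (Assign 8 (Const 1)))
         Skip ;;
       Cond (Reg 8)
         (St 10 (Reg 7) (Ld 9 (Reg 5)) ;; Assign 5 (Op Plus (Reg 5) (Const 1)))
         (St 10 (Reg 7) (Ld 9 (Reg 4)) ;; Assign 4 (Op Plus (Reg 4) (Const 1))) ;;
       Assign 7 (Op Plus (Reg 7) (Const 1))"
  have step: "vc w S ?body (\<lambda>s' t'. (\<exists>i j. J i j (fst s') (snd s')) \<and> fst s' 7 = Suc p \<and> t' \<le> t + 90) (r', m') t"
    if J: "J i j r' m'" and p: "r' 7 = p" "p < hi" for i j r' m' t p
  proof -
    have fr: "frame {4, 5, 7, 8} {10} (r, m) (r', m')" using J by (simp add: J_def)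
    have rr: "r' 3 = mid" "r' 6 = hi" "arr m' 0 = V" "arr m' 9 = f" "r' 4 = i" "r' 5 = j"
      using fr r V f J by (auto simp: frame_def J_def)
    have ij: "lo \<le> i" "i \<le> mid" "mid \<le> j" "j \<le> hi" "p + mid = i + j"
      using J p by (auto simp: J_def)
    have fn: "f a < n" if "lo \<le> a" "a < hi" for a using f(2) that by (simp add: image_subset_iff)
    have J': "J i (Suc j) (r'(8 := c, 5 := Suc j, 7 := Suc p)) (m'(16 * p + 10 := f j))"
      if "j < hi" "i < mid \<Longrightarrow> V (f j) < V (f i)" for c
    proof -
      have "V (f j) \<le> V (f a)" if a: "i \<le> a" "a < mid" for a
      proof -
        have "V (f i) \<le> V (f a)" using s(1) a ij(1) by (simp add: sorted_run_def)
        then show ?thesis using \<open>i < mid \<Longrightarrow> V (f j) < V (f i)\<close> a by linarith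
      qed
      moreover have "V (f j) \<le> V (f a)" if a: "j \<le> a" "a < hi" for a
        using s(2) a ij(3) by (simp add: sorted_run_def)
      moreover have "{lo..<Suc p} = insert p {lo..<p}" "{mid..<Suc j} = insert j {mid..<j}"
        using ij by auto
      moreover have "arr m' 10 ` {lo..<p} = (arr m' 10)(p := f j) ` {lo..<p}" by auto
      ultimately show ?thesis using J p ij that(1)
        by (auto simp: J_def frame_def sorted_run_def less_Suc_eq)
    qed
    have J'': "J (Suc i) j (r'(8 := c, 4 := Suc i, 7 := Suc p)) (m'(16 * p + 10 := f i))"
      if "i < mid" "j < hi \<Longrightarrow> V (f i) \<le> V (f j)" for c
    proof -
      have "V (f i) \<le> V (f a)" if a: "j \<le> a" "a < hi" for a
      proof -
        have "V (f j) \<le> V (f a)" using s(2) a ij(3) by (simp add: sorted_run_def)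
        then show ?thesis using \<open>j < hi \<Longrightarrow> V (f i) \<le> V (f j)\<close> a by linarith
      qed
      moreover have "V (f i) \<le> V (f a)" if a: "i \<le> a" "a < mid" for a
        using s(1) a ij(1) by (simp add: sorted_run_def)
      moreover have "{lo..<Suc p} = insert p {lo..<p}" "{lo..<Suc i} = insert i {lo..<i}"
        using ij by auto
      moreover have "arr m' 10 ` {lo..<p} = (arr m' 10)(p := f i) ` {lo..<p}" by auto
      ultimately show ?thesis using J p ij that(1)
        by (auto simp: J_def frame_def sorted_run_def less_Suc_eq)
    qed
    have bn: "16 * p + 10 < S" "16 < S" "1 < S" "0 < S" "i + 1 < S" "j + 1 < S" "p + 1 < S"
      "16 * i + 9 < S" "16 * j + 9 < S"
      using S ij b p by linarith+
    have fS: "16 * f a < S" if "lo \<le> a" "a < hi" for a using fn[OF that] S by simp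
    consider "j < hi" "i < mid" "V (f j) < V (f i)" | "j < hi" "i < mid" "V (f i) \<le> V (f j)"
      | "j < hi" "i = mid" | "j = hi" "i < mid"
      using ij p by linarith
    then show ?thesis
    proof cases
      case 1
      then show ?thesis using J'[of 1] rr bn fS[of i] fS[of j] p ij by auto
    next
      case 2
      then show ?thesis using J''[of 0] rr bn fS[of i] fS[of j] p ij by auto
    next
      case 3
      then show ?thesis using J'[of 1] rr bn fS[of j] p ij by auto
    next
      case 4
      then show ?thesis using J''[of 0] rr bn fS[of i] p ij by auto
    qed
  qed
  show "vc w S (While (Op Less (Reg 7) (Reg 6)) (?body)) Q (r, m) t"
  proof (rule vc_While[where B = "t + 100 * (hi - lo)" and
      Inv = "\<lambda>s' t'. (\<exists>i j. J i j (fst s') (snd s')) \<and> t' \<le> t + 100 * (fst s' 7 - lo)", OF _ Sw])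
    have "J lo mid r m" using r b by (auto simp: J_def frame_def sorted_run_def)
    then show "(\<exists>i j. J i j (fst (r, m)) (snd (r, m))) \<and> t \<le> t + 100 * (fst (r, m) 7 - lo)" by auto
    fix s' t'
    assume I: "(\<exists>i j. J i j (fst s') (snd s')) \<and> t' \<le> t + 100 * (fst s' 7 - lo)"
    then obtain r' m' i j where s': "s' = (r', m')" and J: "J i j r' m'" and t': "t' \<le> t + 100 * (r' 7 - lo)"
      by (cases s') auto
    have ph: "r' 7 \<le> hi" "lo \<le> r' 7" "r' 6 = hi" using J r by (auto simp: J_def frame_def)
    show "t' \<le> t + 100 * (hi - lo) \<and> safe S s' (Op Less (Reg 7) (Reg 6))"
      using t' ph S s' by auto
    {
      assume "ev s' (Op Less (Reg 7) (Reg 6)) \<noteq> 0"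
      then have "r' 7 < hi" using s' ph by (simp split: if_splits)
      from step[OF J refl this]
      show "vc w S ?body (\<lambda>s' t'. (\<exists>i j. J i j (fst s') (snd s')) \<and> t' \<le> t + 100 * (fst s' 7 - lo)) s'
          (t' + (1 + cost (Op Less (Reg 7) (Reg 6))))"
        unfolding s' by (rule vc_mono) (use t' ph in auto)
    }
    assume "ev s' (Op Less (Reg 7) (Reg 6)) = 0"
    then have p: "r' 7 = hi" using s' ph by (simp split: if_splits)
    have ij: "i = mid" "j = hi" using J p by (auto simp: J_def)
    have "{lo..<hi} = {lo..<mid} \<union> {mid..<hi}" using b by auto
    then have "arr m' 10 ` {lo..<hi} = f ` {lo..<hi}" using J p ij by (simp add: J_def image_Un)
    then show "Q s' (t' + (1 + cost (Op Less (Reg 7) (Reg 6))))"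
      unfolding s' using J p ij t' by (intro Q) (auto simp: J_def)
  qed
qed

text \<open>Only runs starting below \<open>b\<close> are claimed, which describes a pass in
  progress; the last run is cut off at \<open>n\<close>. The image condition says that each run
  permutes its own interval, since a surjection of a finite set onto itself is a bijection.\<close>

definition runs :: "(nat \<Rightarrow> nat) \<Rightarrow> (nat \<Rightarrow> nat) \<Rightarrow> nat \<Rightarrow> nat \<Rightarrow> nat \<Rightarrow> bool" where
  "runs V f M n b \<longleftrightarrow> (\<forall>s. M dvd s \<longrightarrow> s < b \<longrightarrow>
     sorted_run V f s (min (s + M) n) \<and> f ` {s..<min (s + M) n} = {s..<min (s + M) n})"

definition sort_pass :: com where
  "sort_pass =
    Assign 2 (Const 0) ;;
    While (Op Less (Reg 2) (Reg 0))
      (Assign 3 (Op Plus (Reg 2) (Reg 1)) ;; Cond (Op Less (Reg 0) (Reg 3)) (Assign 3 (Reg 0)) Skip ;;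
       Assign 6 (Op Plus (Reg 3) (Reg 1)) ;; Cond (Op Less (Reg 0) (Reg 6)) (Assign 6 (Reg 0)) Skip ;;
       Assign 4 (Reg 2) ;; Assign 5 (Reg 3) ;; Assign 7 (Reg 2) ;;
       merge_runs ;;
       Assign 2 (Reg 6)) ;;
    For 4 0 (St 9 (Reg 4) (Ld 10 (Reg 4)))"

lemma runs_image:
  assumes "runs V f M n n" "M dvd lo" "lo \<le> n"
  shows "f ` {lo..<min (lo + M) n} = {lo..<min (lo + M) n} \<and> sorted_run V f lo (min (lo + M) n)"
proof (cases "lo < n")
  case True
  then show ?thesis using assms by (simp add: runs_def)
next
  case False
  then show ?thesis using assms by (simp add: sorted_run_def)
qed

lemma vc_sort_pass:
  assumes Sw: "S \<le> 2 ^ w" and S: "64 * n + 64 \<le> S"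
    and r: "r 0 = n" "r 1 = M" and M: "1 \<le> M" "M \<le> n"
    and V: "arr m 0 = V" and f: "runs V (arr m 9) M n n"
    and Q: "\<And>r' m' t'. frame {2, 3, 4, 5, 6, 7, 8} {9, 10} (r, m) (r', m') \<Longrightarrow>
      runs V (arr m' 9) (2 * M) n n \<Longrightarrow> t' \<le> t + 400 * n + 100 \<Longrightarrow> Q (r', m') t'"
  shows "vc w S sort_pass Q (r, m) t"
proof -
  define f where "f = arr m 9"
  define J where "J = (\<lambda>lo r' m'. frame {2, 3, 4, 5, 6, 7, 8} {10} (r, m) (r', m') \<and> r' 2 = lo \<and>
    lo \<le> n \<and> (lo = n \<or> 2 * M dvd lo) \<and> runs V (arr m' 10) (2 * M) n lo)"
  let ?body = "Assign 3 (Op Plus (Reg 2) (Reg 1)) ;; Cond (Op Less (Reg 0) (Reg 3)) (Assign 3 (Reg 0)) Skip ;;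
       Assign 6 (Op Plus (Reg 3) (Reg 1)) ;; Cond (Op Less (Reg 0) (Reg 6)) (Assign 6 (Reg 0)) Skip ;;
       Assign 4 (Reg 2) ;; Assign 5 (Reg 3) ;; Assign 7 (Reg 2) ;;
       merge_runs ;;
       Assign 2 (Reg 6)"
  \<comment> \<open>The overhead outside the merge is absorbed by \<open>200 * (hi - lo)\<close>
    because \<open>lo < hi\<close>.\<close>
  have step: "vc w S ?body (\<lambda>s' t'. \<exists>hi. lo < hi \<and> J hi (fst s') (snd s') \<and> t' \<le> t + 200 * (hi - lo)) (r1, m1) (t + 4)"
    if J: "J lo r1 m1" and lo: "lo < n" for lo r1 m1 t
  proof -
    define mid where "mid = min (lo + M) n"
    define hi where "hi = min (lo + 2 * M) n"
    have b: "lo \<le> mid" "mid \<le> hi" "hi \<le> n" "lo < hi" using lo M by (auto simp: mid_def hi_def)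
    have rr: "r1 0 = n" "r1 1 = M" "r1 2 = lo" "arr m1 0 = V" "arr m1 9 = f"
      using J r V by (auto simp: J_def frame_def f_def)
    have d: "2 * M dvd lo" using J lo by (auto simp: J_def)
    then have dM: "M dvd lo" by (rule dvd_mult_right)
    have a1: "f ` {lo..<mid} = {lo..<mid} \<and> sorted_run V f lo mid"
      using runs_image[OF f dM] lo by (simp add: f_def mid_def)
    have a2: "f ` {mid..<hi} = {mid..<hi} \<and> sorted_run V f mid hi"
    proof (cases "mid < n")
      case True
      then have "mid = lo + M" "hi = min (mid + M) n" by (auto simp: mid_def hi_def)
      then show ?thesis using runs_image[OF f, of mid] dM True by (simp add: f_def)
    next
      case False
      then have "mid = hi" using b by simp
      then show ?thesis by (simp add: sorted_run_def)
    qed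
    have "{lo..<hi} = {lo..<mid} \<union> {mid..<hi}" using b by auto
    then have im: "f ` {lo..<hi} = {lo..<hi}" using a1 a2 by (simp add: image_Un)
    have m: "vc w S (merge_runs ;; Assign 2 (Reg 6))
      (\<lambda>s' t'. \<exists>hi. lo < hi \<and> J hi (fst s') (snd s') \<and> t' \<le> t + 200 * (hi - lo))
      (r1(3 := mid, 6 := hi, 4 := lo, 5 := mid, 7 := lo), m1) t'" if t': "t' \<le> t + 50" for t'
      unfolding vc.simps(4)
    proof (rule vc_merge_runs[where n = n and lo = lo and mid = mid and hi = hi and V = V and f = f, OF Sw])
      fix r2 m2 t2
      assume f2: "frame {4, 5, 7, 8} {10} (r1(3 := mid, 6 := hi, 4 := lo, 5 := mid, 7 := lo), m1) (r2, m2)"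
        and low: "\<And>q. q < lo \<Longrightarrow> arr m2 10 q = arr m1 10 q"
        and s: "sorted_run V (arr m2 10) lo hi" and i2: "arr m2 10 ` {lo..<hi} = f ` {lo..<hi}"
        and t2: "t2 \<le> t' + 100 * (hi - lo) + 10"
      have "frame {2, 3, 4, 5, 6, 7, 8} {10} (r, m) (r2(2 := hi), m2)"
        using J f2 by (auto simp: J_def frame_def)
      moreover have "hi = n \<or> 2 * M dvd hi" using d by (auto simp: hi_def min_def)
      moreover have "runs V (arr m2 10) (2 * M) n hi"
        unfolding runs_def
      proof (intro allI impI)
        fix s0 assume s0: "2 * M dvd s0" "s0 < hi"
        show "sorted_run V (arr m2 10) s0 (min (s0 + 2 * M) n) \<and>
          arr m2 10 ` {s0..<min (s0 + 2 * M) n} = {s0..<min (s0 + 2 * M) n}"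
        proof (cases "s0 < lo")
          case True
          obtain u v where uv: "s0 = 2 * M * u" "lo = 2 * M * v" using s0(1) d by (auto elim!: dvdE)
          then have "u < v" using True by simp
          \<comment> \<open>Distinct multiples of \<open>2 * M\<close> are at least
            \<open>2 * M\<close> apart, so an earlier run ends by \<open>lo\<close> and is not
            touched by this merge.\<close>
          then have "2 * M * Suc u \<le> 2 * M * v" by (intro mult_le_mono2) simp
          then have le: "s0 + 2 * M \<le> lo" using uv by simp
          then have eq: "arr m2 10 q = arr m1 10 q" if "q < min (s0 + 2 * M) n" for q
            using low that by simp
          have "sorted_run V (arr m1 10) s0 (min (s0 + 2 * M) n) \<and>
            arr m1 10 ` {s0..<min (s0 + 2 * M) n} = {s0..<min (s0 + 2 * M) n}"
            using J s0(1) True by (simp add: J_def runs_def)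
          moreover have "arr m2 10 ` {s0..<min (s0 + 2 * M) n} = arr m1 10 ` {s0..<min (s0 + 2 * M) n}"
            using eq by (intro image_cong) auto
          ultimately show ?thesis using eq by (auto simp: sorted_run_def)
        next
          case False
          obtain u v where uv: "s0 = 2 * M * u" "lo = 2 * M * v" using s0(1) d by (auto elim!: dvdE)
          have "s0 < 2 * M * Suc v" using s0(2) uv by (simp add: hi_def)
          then have "u < Suc v" unfolding uv by (simp only: nat_mult_less_cancel_disj)
          moreover have "v \<le> u" using False uv M by simp
          ultimately have "s0 = lo" using uv by simp
          then show ?thesis using s i2 im by (simp add: hi_def)
        qed
      qed
      ultimately have "J hi (r2(2 := hi)) m2" using b by (simp add: J_def)
      moreover have "r2 6 = hi" using f2 by (simp add: frame_def)
      ultimately show "vc w S (Assign 2 (Reg 6)) (\<lambda>s' t'. \<exists>hi. lo < hi \<and> J hi (fst s') (snd s') \<and> t' \<le> t + 200 * (hi - lo))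
        (r2, m2) t2"
        using t2 t' b by (auto intro!: exI[of _ hi])
    qed (use S b rr a1 a2 im in auto)
    have c1: "lo + M \<le> n \<Longrightarrow> mid = lo + M" "n < lo + M \<Longrightarrow> mid = n" 
      "mid + M \<le> n \<Longrightarrow> hi = mid + M" "n < mid + M \<Longrightarrow> hi = n"
      by (auto simp: mid_def hi_def)
    have bS: "lo + M < S" "mid + M < S" "n + M < S" "1 < S" using S b M lo by linarith+
    show ?thesis
      using m rr bS c1 by (cases "n < lo + M"; cases "n < mid + M") (simp_all add: vc_Seq)
  qed
  have loop: "vc w S (While (Op Less (Reg 2) (Reg 0)) (?body)) Q' (r(2 := 0), m) t1"
    if Q': "\<And>r' m' t'. J n r' m' \<Longrightarrow> t' \<le> t1 + 200 * n + 4 \<Longrightarrow> Q' (r', m') t'" for Q' t1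
  proof (rule vc_While[where B = "t1 + 200 * n" and
      Inv = "\<lambda>s' t'. J (fst s' 2) (fst s') (snd s') \<and> t' \<le> t1 + 200 * fst s' 2", OF _ Sw])
    show "J (fst (r(2 := 0), m) 2) (fst (r(2 := 0), m)) (snd (r(2 := 0), m)) \<and> t1 \<le> t1 + 200 * fst (r(2 := 0), m) 2"
      by (auto simp: J_def frame_def runs_def)
    fix s' t'
    assume I: "J (fst s' 2) (fst s') (snd s') \<and> t' \<le> t1 + 200 * fst s' 2"
    obtain r' m' where s': "s' = (r', m')" by (cases s')
    define lo where "lo = r' 2"
    have J: "J lo r' m'" and t': "t' \<le> t1 + 200 * lo" using I s' lo_def by auto
    have l: "lo \<le> n" "r' 0 = n" using J r by (auto simp: J_def frame_def)
    show "t' \<le> t1 + 200 * n \<and> safe S s' (Op Less (Reg 2) (Reg 0))"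
      using t' l S s' by auto
    {
      assume "ev s' (Op Less (Reg 2) (Reg 0)) \<noteq> 0"
      then have lt: "lo < n" using s' l lo_def by (simp split: if_splits)
      have "vc w S ?body (\<lambda>s' t'. J (fst s' 2) (fst s') (snd s') \<and> t' \<le> t1 + 200 * fst s' 2) (r', m') (t' + 4)"
        by (rule vc_mono[OF step[OF J lt]]) (use t' in \<open>auto simp: J_def\<close>)
      moreover have "1 + cost (Op Less (Reg 2) (Reg 0)) = 4" by simp
      ultimately show "vc w S ?body (\<lambda>s' t'. J (fst s' 2) (fst s') (snd s') \<and> t' \<le> t1 + 200 * fst s' 2) s'
          (t' + (1 + cost (Op Less (Reg 2) (Reg 0))))"
        unfolding s' by (simp only:)
    }
    assume "ev s' (Op Less (Reg 2) (Reg 0)) = 0"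
    then have p: "lo = n" using s' l lo_def by (simp split: if_splits)
    then show "Q' s' (t' + (1 + cost (Op Less (Reg 2) (Reg 0))))"
      unfolding s' using J t' by (intro Q') auto
  qed
  have copy: "vc w S (For 4 0 (St 9 (Reg 4) (Ld 10 (Reg 4)))) Q (r1, m1) t1"
    if J: "J n r1 m1" and t1: "t1 \<le> t + 200 * n + 50" for r1 m1 t1
  proof -
    define P where "P = (\<lambda>i r' m'. frame {4} {9} (r1, m1) (r', m') \<and> r' 4 = i \<and> (\<forall>q<i. arr m' 9 q = arr m1 10 q))"
    have f1: "frame {2, 3, 4, 5, 6, 7, 8} {10} (r, m) (r1, m1)" using J by (simp add: J_def)
    show ?thesis
    proof (rule vc_For[where P = P and N = n and C = 40, OF Sw])
      show "vc w S (St 9 (Reg 4) (Ld 10 (Reg 4)))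
        (\<lambda>s' t'. fst s' 4 = i \<and> P (Suc i) ((fst s')(4 := Suc i)) (snd s') \<and> t' \<le> t + 40) (r', m') t"
        if "P i r' m'" "i < n" for i r' m' t
        using that S by (auto simp: P_def frame_def less_Suc_eq)
      fix r2 m2 t2
      assume P: "P n r2 m2" and t2: "t2 \<le> t1 + n * (40 + 8) + 6"
      show "Q (r2, m2) t2"
      proof (rule Q)
        show "frame {2, 3, 4, 5, 6, 7, 8} {9, 10} (r, m) (r2, m2)"
          by (rule frame_trans[OF f1]) (use P in \<open>auto simp: P_def\<close>)
        have eq: "arr m2 9 q = arr m1 10 q" if "q < n" for q using P that by (simp add: P_def)
        have "arr m2 9 ` {s..<min (s + 2 * M) n} = arr m1 10 ` {s..<min (s + 2 * M) n}" for s
          using eq by (intro image_cong) auto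
        then show "runs V (arr m2 9) (2 * M) n n"
          using J eq by (simp add: J_def runs_def sorted_run_def)
      qed (use t1 t2 in simp)
    qed (use f1 r S in \<open>auto simp: P_def frame_def\<close>)
  qed
  show ?thesis
    unfolding sort_pass_def
    using loop[where Q' = "vc w S (For 4 0 (St 9 (Reg 4) (Ld 10 (Reg 4)))) Q" and ?t1.0 = "Suc (Suc t)"] copy S
    by (simp add: vc_Seq del: vc.simps(4))
qed

definition sort_letters :: com where
  "sort_letters =
    For 4 0 (St 9 (Reg 4) (Reg 4)) ;;
    Assign 1 (Const 1) ;;
    While (Op Less (Reg 1) (Reg 0)) (sort_pass ;; Assign 1 (Op Times (Const 2) (Reg 1)))"

lemma vc_sort_letters:
  assumes Sw: "S \<le> 2 ^ w" and S: "64 * n + 64 \<le> S" and K: "n < 2 ^ K" and r: "r 0 = n" and V: "arr m 0 = V"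
    and Q: "\<And>r' m' t'. frame {1, 2, 3, 4, 5, 6, 7, 8} {9, 10} (r, m) (r', m') \<Longrightarrow>
      sorted_run V (arr m' 9) 0 n \<Longrightarrow> arr m' 9 ` {0..<n} = {0..<n} \<Longrightarrow> t' \<le> t + 700 * (n + 1) * (K + 1) \<Longrightarrow> Q (r', m') t'"
  shows "vc w S sort_letters Q (r, m) t"
proof -
  define P where "P = (\<lambda>i r' m'. frame {4} {9} (r, m) (r', m') \<and> r' 4 = i \<and> (\<forall>q<i. arr m' 9 q = q))"
  have 1: "vc w S (For 4 0 (St 9 (Reg 4) (Reg 4))) Q' (r, m) t"
    if "\<And>r' m' t'. P n r' m' \<Longrightarrow> t' \<le> t + n * (40 + 8) + 6 \<Longrightarrow> Q' (r', m') t'" for Q'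
  proof (rule vc_For[where P = P and N = n and C = 40, OF Sw])
    show "vc w S (St 9 (Reg 4) (Reg 4))
      (\<lambda>s' t'. fst s' 4 = i \<and> P (Suc i) ((fst s')(4 := Suc i)) (snd s') \<and> t' \<le> t + 40) (r', m') t"
      if "P i r' m'" "i < n" for i r' m' t
      using that S by (auto simp: P_def frame_def less_Suc_eq)
  qed (use that r S in \<open>auto simp: P_def frame_def\<close>)
  define J where "J = (\<lambda>j r' m'. frame {1, 2, 3, 4, 5, 6, 7, 8} {9, 10} (r, m) (r', m') \<and> r' 1 = 2 ^ j \<and>
    runs V (arr m' 9) (2 ^ j) n n \<and> j \<le> K)"
  have 2: "vc w S (While (Op Less (Reg 1) (Reg 0)) (sort_pass ;; Assign 1 (Op Times (Const 2) (Reg 1)))) Q (r1, m1) t1"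
    if J0: "J 0 r1 m1" and t1: "t1 \<le> t + 48 * n + 10" for r1 m1 t1
  proof (rule vc_While[where B = "t1 + (400 * n + 200) * K" and
      Inv = "\<lambda>s' t'. \<exists>j. J j (fst s') (snd s') \<and> t' \<le> t1 + (400 * n + 200) * j", OF _ Sw])
    show "\<exists>j. J j (fst (r1, m1)) (snd (r1, m1)) \<and> t1 \<le> t1 + (400 * n + 200) * j"
      using J0 by auto
    fix s' t'
    assume "\<exists>j. J j (fst s') (snd s') \<and> t' \<le> t1 + (400 * n + 200) * j"
    then obtain r' m' j where s': "s' = (r', m')" and J: "J j r' m'" and t': "t' \<le> t1 + (400 * n + 200) * j"
      by (cases s') auto
    have jK: "j \<le> K" using J by (simp add: J_def)
    then have le: "(400 * n + 200) * j \<le> (400 * n + 200) * K" by (rule mult_le_mono2)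
    have rr: "r' 0 = n" "r' 1 = 2 ^ j" "arr m' 0 = V" using J r V by (auto simp: J_def frame_def)
    have "t' \<le> t1 + (400 * n + 200) * K" using t' le by linarith
    then show "t' \<le> t1 + (400 * n + 200) * K \<and> safe S s' (Op Less (Reg 1) (Reg 0))"
      using S by simp
    {
      assume "ev s' (Op Less (Reg 1) (Reg 0)) \<noteq> 0"
      then have lt: "2 ^ j < n" using rr s' by (simp split: if_splits)
      then have "(2::nat) ^ j < 2 ^ K" using K by linarith
      then have jK: "j < K" by (simp add: power_strict_increasing_iff)
      have "vc w S sort_pass (vc w S (Assign 1 (Op Times (Const 2) (Reg 1)))
          (\<lambda>s' t'. \<exists>j. J j (fst s') (snd s') \<and> t' \<le> t1 + (400 * n + 200) * j)) (r', m') (t' + 4)"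
      proof (rule vc_sort_pass[where n = n and M = "2 ^ j" and V = V, OF Sw S])
        fix r2 m2 t2
        assume f: "frame {2, 3, 4, 5, 6, 7, 8} {9, 10} (r', m') (r2, m2)"
          and ru: "runs V (arr m2 9) (2 * 2 ^ j) n n" and t2: "t2 \<le> t' + 4 + 400 * n + 100"
        have "J (Suc j) (r2(1 := 2 * 2 ^ j)) m2"
          using J f ru jK by (auto simp: J_def frame_def)
        moreover have "r2 1 = 2 ^ j" using f rr by (simp add: frame_def)
        moreover have "2 * 2 ^ j < S" using lt S by linarith
        moreover have "t2 + 4 \<le> t1 + (400 * n + 200) * Suc j" using t2 t' by simp
        ultimately show "vc w S (Assign 1 (Op Times (Const 2) (Reg 1)))
            (\<lambda>s' t'. \<exists>j. J j (fst s') (snd s') \<and> t' \<le> t1 + (400 * n + 200) * j) (r2, m2) t2"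
          using S by (auto intro!: exI[of _ "Suc j"])
      qed (use rr J lt in \<open>auto simp: J_def\<close>)
      moreover have "1 + cost (Op Less (Reg 1) (Reg 0)) = 4" by simp
      ultimately show "vc w S (sort_pass ;; Assign 1 (Op Times (Const 2) (Reg 1)))
          (\<lambda>s' t'. \<exists>j. J j (fst s') (snd s') \<and> t' \<le> t1 + (400 * n + 200) * j) s'
          (t' + (1 + cost (Op Less (Reg 1) (Reg 0))))"
        unfolding s' vc_Seq by (simp only:)
    }
    assume "ev s' (Op Less (Reg 1) (Reg 0)) = 0"
    then have ge: "n \<le> 2 ^ j" using rr s' by (simp split: if_splits)
    have ru: "runs V (arr m' 9) (2 ^ j) n n" using J by (simp add: J_def)
    show "Q s' (t' + (1 + cost (Op Less (Reg 1) (Reg 0))))"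
      unfolding s'
    proof (rule Q)
      show "frame {1, 2, 3, 4, 5, 6, 7, 8} {9, 10} (r, m) (r', m')" using J by (simp add: J_def)
      show "sorted_run V (arr m' 9) 0 n" "arr m' 9 ` {0..<n} = {0..<n}"
        using runs_image[OF ru, of 0] ge by (simp_all add: min_def split: if_splits)
      have "(700 * n + 700) * 1 \<le> (700 * n + 700) * (K + 1)" by (rule mult_le_mono2) simp
      have "(400 * n + 200) * K \<le> (700 * n + 700) * K" by (rule mult_le_mono1) simp
      then show "t' + (1 + cost (Op Less (Reg 1) (Reg 0))) \<le> t + 700 * (n + 1) * (K + 1)"
        using t' t1 le by (simp add: algebra_simps)
    qed
  qed
  show ?thesis
    unfolding sort_letters_def vc.simps(4)
  proof (rule 1)
    fix r1 m1 t1
    assume P: "P n r1 m1" and t1: "t1 \<le> t + n * (40 + 8) + 6"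
    have "runs V (arr m1 9) 1 n n"
      unfolding runs_def
    proof (intro allI impI)
      fix s assume s: "s < n"
      then have "min (s + 1) n = Suc s" by simp
      moreover have "sorted_run V (arr m1 9) s (Suc s)"
        unfolding sorted_run_def by (metis le_antisym le_trans less_Suc_eq_le order_refl)
      ultimately show "sorted_run V (arr m1 9) s (min (s + 1) n) \<and>
          arr m1 9 ` {s..<min (s + 1) n} = {s..<min (s + 1) n}"
        using P s by (simp add: P_def)
    qed
    then have "J 0 (r1(1 := 1)) m1"
      using P by (auto simp: J_def P_def frame_def)
    then have "vc w S (While (Op Less (Reg 1) (Reg 0)) (sort_pass ;; Assign 1 (Op Times (Const 2) (Reg 1)))) Q
      (r1(1 := 1), m1) (t1 + (1 + cost (Const 1)))"
      by (rule 2) (use t1 in simp)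
    then show "vc w S (Assign 1 (Const 1))
      (vc w S (While (Op Less (Reg 1) (Reg 0)) (sort_pass ;; Assign 1 (Op Times (Const 2) (Reg 1)))) Q) (r1, m1) t1"
      using S by simp
  qed
qed

section \<open>From the sorted order to names of letters\<close>

definition name_letters :: com where
  "name_letters =
    For 4 0 (Assign 5 (Ld 9 (Reg 4)) ;;
      Cond (Reg 4)
        (Cond (Op Equal (Ld 0 (Ld 9 (Op Minus (Reg 4) (Const 1)))) (Ld 0 (Reg 5))) Skip (Assign 8 (Reg 5)))
        (Assign 8 (Reg 5)) ;;
      St 1 (Reg 5) (Reg 8)) ;;
    For 4 0 (St 1 (Op Plus (Reg 0) (Reg 4)) (Ld 1 (Const 0)) ;;
      St 8 (Op Plus (Reg 4) (Const 1)) (Const 0))"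

text \<open>For \<open>M = 1\<close> the offset \<open>(p - n) mod 1\<close> is 0, so every index
  from \<open>n\<close> on denotes the window that starts at the end of a prefix and wraps to
  \<open>x ! 0\<close>. The name of position 0 serves for all of them.\<close>

lemma naming_1:
  assumes N: "\<And>a b. a < length x \<Longrightarrow> b < length x \<Longrightarrow> f a = f b \<longleftrightarrow> x ! a = x ! b"
    and W: "\<And>a. a < length x \<Longrightarrow> f (length x + a) = f 0"
  shows "naming x 1 f"
proof -
  define g where "g = (\<lambda>p. if p < length x then p else 0)"
  have g: "g p < length x \<and> f p = f (g p) \<and> word_at x 1 p = [x ! g p]" if "valid_index (length x) 1 p" for p
  proof (cases "p < length x")
    case True
    then show ?thesis by (simp add: g_def word_at_def Let_def take_Suc_conv_app_nth[of 0, simplified] hd_drop_conv_nth take_Suc)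
  next
    case False
    define k where "k = length x div Suc (p - length x)"
    have p: "p - length x < length x" using False that by (auto simp: valid_index_def)
    then have k: "1 \<le> k" unfolding k_def
      by (metis Suc_leI div_greater_zero_iff One_nat_def zero_less_Suc)
    have "length x \<noteq> 0" using p by auto
    then obtain c y where x: "x = c # y" by (cases x) auto
    obtain k' where k': "k = Suc k'" using k by (cases k) auto
    have "word_at x 1 p = cyclic_window x k 1 k" using False by (simp add: word_at_def Let_def k_def)
    also have "\<dots> = [x ! 0]"
    proof -
      have "k \<le> length x" by (simp add: k_def)
      then show ?thesis by (simp add: cyclic_window_def k' x)
    qed
    finally have "word_at x 1 p = [x ! 0]" .
    moreover have "f p = f 0" using W[OF p] False by simp
    ultimately show ?thesis using False p by (auto simp: g_def)
  qed
  show ?thesis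
    unfolding naming_def
  proof (intro allI impI)
    fix p q assume v: "valid_index (length x) 1 p" "valid_index (length x) 1 q"
    show "f p = f q \<longleftrightarrow> word_at x 1 p = word_at x 1 q"
      using g[OF v(1)] g[OF v(2)] N[of "g p" "g q"] by simp
  qed
qed

text \<open>The name of a letter is the first of its positions in sorted order, hence below
  \<open>n\<close> however large the letter is. Array 8 has to be cleared here because input letters
  may still lie in its cells.\<close>

lemma vc_name_letters:
  assumes Sw: "S \<le> 2 ^ w" and S: "64 * n + 64 \<le> S" and n: "n = length x" and r: "r 0 = n"
    and V: "\<And>i. i < n \<Longrightarrow> arr m 0 i = x ! i"
    and f: "sorted_run (arr m 0) (arr m 9) 0 n" "arr m 9 ` {0..<n} = {0..<n}"
    and Q: "\<And>r' m' t'. frame {4, 5, 8} {1, 8} (r, m) (r', m') \<Longrightarrow>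
      naming x 1 (arr m' 1) \<Longrightarrow> (\<And>p. valid_index n 1 p \<Longrightarrow> arr m' 1 p < 2 * n + 2) \<Longrightarrow>
      (\<And>k. 1 \<le> k \<Longrightarrow> k \<le> n \<Longrightarrow> arr m' 8 k = 0) \<Longrightarrow> t' \<le> t + 200 * n + 100 \<Longrightarrow> Q (r', m') t'"
  shows "vc w S name_letters Q (r, m) t"
proof -
  define V where "V = arr m 0"
  define f where "f = arr m 9"
  have inj: "inj_on f {0..<n}" by (rule eq_card_imp_inj_on) (use f(2) in \<open>simp_all add: f_def\<close>)
  have fn: "f q < n" if "q < n" for q
  proof -
    have "f q \<in> f ` {0..<n}" using that by auto
    then show ?thesis using f(2) by (simp add: f_def)
  qed
  have mono: "V (f p) \<le> V (f q)" if "p \<le> q" "q < n" for p q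
    using f(1) that by (simp add: sorted_run_def V_def f_def)
  \<comment> \<open>Register 8 carries the name of the preceding sorted index, to be continued when
    the letter stays the same.\<close>
  define P where "P = (\<lambda>i r' m'. frame {4, 5, 8} {1} (r, m) (r', m') \<and> r' 4 = i \<and>
    (\<forall>q<i. arr m' 1 (f q) < n \<and> V (arr m' 1 (f q)) = V (f q)) \<and>
    (\<forall>p<i. \<forall>q<i. V (f p) = V (f q) \<longrightarrow> arr m' 1 (f p) = arr m' 1 (f q)) \<and>
    (0 < i \<longrightarrow> r' 8 = arr m' 1 (f (i - 1))))"
  have 1: "vc w S (For 4 0 (Assign 5 (Ld 9 (Reg 4)) ;;
      Cond (Reg 4)
        (Cond (Op Equal (Ld 0 (Ld 9 (Op Minus (Reg 4) (Const 1)))) (Ld 0 (Reg 5))) Skip (Assign 8 (Reg 5)))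
        (Assign 8 (Reg 5)) ;;
      St 1 (Reg 5) (Reg 8))) Q' (r, m) t"
    if "\<And>r' m' t'. P n r' m' \<Longrightarrow> t' \<le> t + n * (60 + 8) + 6 \<Longrightarrow> Q' (r', m') t'" for Q'
  proof (rule vc_For[where P = P and N = n and C = 60, OF Sw])
    show "vc w S (Assign 5 (Ld 9 (Reg 4)) ;;
      Cond (Reg 4)
        (Cond (Op Equal (Ld 0 (Ld 9 (Op Minus (Reg 4) (Const 1)))) (Ld 0 (Reg 5))) Skip (Assign 8 (Reg 5)))
        (Assign 8 (Reg 5)) ;;
      St 1 (Reg 5) (Reg 8))
      (\<lambda>s' t'. fst s' 4 = i \<and> P (Suc i) ((fst s')(4 := Suc i)) (snd s') \<and> t' \<le> t + 60) (r', m') t"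
      if P: "P i r' m'" and i: "i < n" for i r' m' t
    proof -
      have rr: "r' 4 = i" "arr m' 0 = V" "arr m' 9 = f"
        using P by (auto simp: P_def frame_def V_def f_def)
      have new: "f q \<noteq> f i" if "q < i" for q using inj_onD[OF inj, of q i] that i by auto
      have P': "frame {4, 5, 8} {1} (r, m) (r', m')"
        "\<And>q. q < i \<Longrightarrow> arr m' 1 (f q) < n \<and> V (arr m' 1 (f q)) = V (f q)"
        "\<And>p q. p < i \<Longrightarrow> q < i \<Longrightarrow> V (f p) = V (f q) \<Longrightarrow> arr m' 1 (f p) = arr m' 1 (f q)"
        "0 < i \<Longrightarrow> r' 8 = arr m' 1 (f (i - 1))"
        using P unfolding P_def by blast+
      have upd: "P (Suc i) (r''(4 := Suc i)) (m'(16 * f i + 1 := c))"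
        if c: "c < n" "V c = V (f i)" "\<And>q. q < i \<Longrightarrow> V (f q) = V (f i) \<Longrightarrow> arr m' 1 (f q) = c"
          and r'': "r'' 8 = c" "\<And>x. x \<notin> {5, 8} \<Longrightarrow> r'' x = r' x" for c r''
      proof -
        have ai: "arr (m'(16 * f i + 1 := c)) 1 = (arr m' 1)(f i := c)" by simp
        have old: "arr (m'(16 * f i + 1 := c)) 1 (f q) = arr m' 1 (f q)" if "q < i" for q
          using new[OF that] unfolding ai by simp
        have cur: "arr (m'(16 * f i + 1 := c)) 1 (f i) = c" unfolding ai by simp
        show ?thesis
          unfolding P_def
        proof (intro conjI allI impI)
          show "frame {4, 5, 8} {1} (r, m) (r''(4 := Suc i), m'(16 * f i + 1 := c))"
            using P'(1) r''(2) by (auto simp: frame_def)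
          show "arr (m'(16 * f i + 1 := c)) 1 (f q) < n" "V (arr (m'(16 * f i + 1 := c)) 1 (f q)) = V (f q)"
            if "q < Suc i" for q
            using that old[of q] cur c(1,2) P'(2)[of q] unfolding less_Suc_eq by metis+
          show "arr (m'(16 * f i + 1 := c)) 1 (f p) = arr (m'(16 * f i + 1 := c)) 1 (f q)"
            if "p < Suc i" "q < Suc i" "V (f p) = V (f q)" for p q
            using that old[of p] old[of q] cur c(3)[of p] c(3)[of q] P'(3)[of p q]
            unfolding less_Suc_eq by metis
          show "(r''(4 := Suc i)) 8 = arr (m'(16 * f i + 1 := c)) 1 (f (Suc i - 1))"
            using r''(1) cur by simp
        qed simp
      qed
      have keep: "P (Suc i) (r'(5 := f i, 4 := Suc i)) (m'(16 * f i + 1 := r' 8))"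
        if i0: "0 < i" and eq: "V (f (i - 1)) = V (f i)"
      proof (rule upd)
        note e = P'(4)[OF i0] and p = P'(2)[of "i - 1"]
        have i1: "i - 1 < i" using i0 by simp
        show "r' 8 < n" "V (r' 8) = V (f i)" using e p[OF i1] eq by simp_all
        show "arr m' 1 (f q) = r' 8" if "q < i" "V (f q) = V (f i)" for q
          using P'(3)[OF that(1) i1] that(2) eq e by simp
      qed auto
      have fresh: "P (Suc i) (r'(5 := f i, 8 := f i, 4 := Suc i)) (m'(16 * f i + 1 := f i))"
        if ne: "0 < i \<Longrightarrow> V (f (i - 1)) \<noteq> V (f i)"
      proof (rule upd)
        \<comment> \<open>Vacuous: by sortedness an equal letter further left would also be the
          letter of the direct predecessor, contrary to \<open>ne\<close>.\<close>
        show "arr m' 1 (f q) = f i" if q: "q < i" "V (f q) = V (f i)" for q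
        proof -
          have "V (f q) \<le> V (f (i - 1))" "V (f (i - 1)) \<le> V (f i)"
            using mono[of q "i - 1"] mono[of "i - 1" i] q(1) i by auto
          then show ?thesis using q ne by linarith
        qed
      qed (use fn[OF i] in auto)
      have "16 * f i + 1 < S" "16 * f (i - 1) < S" "16 * i + 9 < S" "16 < S" "1 < S" "16 * (i - 1) + 9 < S"
        using fn[OF i] fn[of "i - 1"] i S by linarith+
      note bnd = this
      show ?thesis
      proof (cases "0 < i \<and> V (f (i - 1)) = V (f i)")
        case True
        then show ?thesis using rr keep bnd by simp
      next
        case False
        then have "P (Suc i) (r'(5 := f i, 8 := f i, 4 := Suc i)) (m'(16 * f i + 1 := f i))"
          by (intro fresh) auto
        then show ?thesis using rr bnd False by (cases "i = 0") simp_all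
      qed
    qed
    show "r' 4 = i \<and> r' 0 = n" if "P i r' m'" for i r' m'
      using that r unfolding P_def frame_def by simp
    show "P 0 (r(4 := 0)) m" by (simp add: P_def frame_def)
  qed (use S in \<open>auto intro: that\<close>)
  define P2 where "P2 = (\<lambda>r1 m1 i r' m'. frame {4} {1, 8} (r1, m1) (r', m') \<and> r' 4 = i \<and>
    (\<forall>q<n. arr m' 1 q = arr m1 1 q) \<and> (\<forall>q<i. arr m' 1 (n + q) = arr m1 1 0 \<and> arr m' 8 (Suc q) = 0))"
  show ?thesis
    unfolding name_letters_def vc.simps(4)
  proof (rule 1)
    fix r1 m1 t1
    assume P: "P n r1 m1" and t1: "t1 \<le> t + n * (60 + 8) + 6"
    have f1: "frame {4, 5, 8} {1} (r, m) (r1, m1)" using P by (simp add: P_def)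
    show "vc w S (For 4 0 (St 1 (Op Plus (Reg 0) (Reg 4)) (Ld 1 (Const 0)) ;;
      St 8 (Op Plus (Reg 4) (Const 1)) (Const 0))) Q (r1, m1) t1"
    proof (rule vc_For[where P = "P2 r1 m1" and N = n and C = 60, OF Sw])
      show "vc w S (St 1 (Op Plus (Reg 0) (Reg 4)) (Ld 1 (Const 0)) ;; St 8 (Op Plus (Reg 4) (Const 1)) (Const 0))
        (\<lambda>s' t'. fst s' 4 = i \<and> P2 r1 m1 (Suc i) ((fst s')(4 := Suc i)) (snd s') \<and> t' \<le> t + 60) (r', m') t"
        if P2: "P2 r1 m1 i r' m'" and i: "i < n" for i r' m' t
      proof -
        have rr: "r' 0 = n" "r' 4 = i" "arr m' 1 0 = arr m1 1 0" using P2 f1 r i by (auto simp: P2_def frame_def)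
        have "P2 r1 m1 (Suc i) (r'(4 := Suc i)) (m'(16 * (n + i) + 1 := arr m1 1 0, 16 * (i + 1) + 8 := 0))"
          using P2 i by (auto simp: P2_def frame_def less_Suc_eq simp del: distrib_left_numeral mult_Suc_right)
        then show ?thesis using rr S i by (simp add: fun_upd_idem)
      qed
      fix r2 m2 t2
      assume P2: "P2 r1 m1 n r2 m2" and t2: "t2 \<le> t1 + n * (60 + 8) + 6"
      have nm: "arr m2 1 q = arr m1 1 q" if "q < n" for q using P2 that by (simp add: P2_def)
      have pre: "\<exists>q<n. a = f q" if "a < n" for a
      proof -
        have "a \<in> f ` {0..<n}" using f(2) that by (simp add: f_def)
        then show ?thesis by auto
      qed
      have N: "arr m1 1 a < n \<and> V (arr m1 1 a) = V a" if "a < n" for a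
        using pre[OF that] P by (auto simp: P_def)
      \<comment> \<open>A name is a position carrying the named letter, so equal names force equal
        letters.\<close>
      have NE: "arr m1 1 a = arr m1 1 b \<longleftrightarrow> V a = V b" if "a < n" "b < n" for a b
      proof
        show "V a = V b \<Longrightarrow> arr m1 1 a = arr m1 1 b"
          using pre[OF that(1)] pre[OF that(2)] P by (auto simp: P_def)
      qed (use N that in metis)
      show "Q (r2, m2) t2"
      proof (rule Q)
        show "frame {4, 5, 8} {1, 8} (r, m) (r2, m2)"
          by (rule frame_trans[OF f1]) (use P2 in \<open>auto simp: P2_def\<close>)
        show "naming x 1 (arr m2 1)"
        proof (rule naming_1)
          show "arr m2 1 a = arr m2 1 b \<longleftrightarrow> x ! a = x ! b" if "a < length x" "b < length x" for a b
            using that nm NE[of a b] V n by (simp add: V_def)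
          show "arr m2 1 (length x + a) = arr m2 1 0" if "a < length x" for a
          proof -
            have "0 < n" "a < n" using that n by auto
            then show ?thesis using nm[of 0] P2 n by (simp add: P2_def)
          qed
        qed
        show "arr m2 1 p < 2 * n + 2" if "valid_index n 1 p" for p
        proof (cases "p < n")
          case True
          then show ?thesis using nm N[of p] by simp
        next
          case False
          then have "p - n < n" "n + (p - n) = p" using that by (auto simp: valid_index_def)
          moreover have "arr m2 1 (n + (p - n)) = arr m1 1 0"
            using P2 \<open>p - n < n\<close> unfolding P2_def by blast
          ultimately show ?thesis using N[of 0] by simp
        qed
        show "arr m2 8 k = 0" if "1 \<le> k" "k \<le> n" for k
        proof -
          have "k - 1 < n" "Suc (k - 1) = k" using that by auto
          then show ?thesis using P2 unfolding P2_def by metis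
        qed
      qed (use t1 t2 in simp)
    qed (use f1 r S in \<open>auto simp: P2_def frame_def\<close>)
  qed
qed

text \<open>Copying in descending order never overwrites a letter that is still needed.\<close>

definition spread :: com where
  "spread = Assign 4 (Reg 0) ;;
    While (Reg 4) (Assign 4 (Op Minus (Reg 4) (Const 1)) ;; Store (Op Times (Const 16) (Reg 4)) (Load (Reg 4)))"

lemma vc_spread:
  assumes Sw: "S \<le> 2 ^ w" and S: "64 * n + 64 \<le> S" and r: "r 0 = n"
    and Q: "\<And>r' m' t'. r' 0 = n \<Longrightarrow> (\<And>i. i < n \<Longrightarrow> arr m' 0 i = m i) \<Longrightarrow> t' \<le> t + 50 * n + 50 \<Longrightarrow> Q (r', m') t'"
  shows "vc w S spread Q (r, m) t"
proof -
  let ?body = "Assign 4 (Op Minus (Reg 4) (Const 1)) ;; Store (Op Times (Const 16) (Reg 4)) (Load (Reg 4))"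
  define J where "J = (\<lambda>(s' :: state) t'. fst s' 0 = n \<and> fst s' 4 \<le> n \<and> (\<forall>i<fst s' 4. snd s' i = m i) \<and>
    (\<forall>i. fst s' 4 \<le> i \<longrightarrow> i < n \<longrightarrow> snd s' (16 * i) = m i) \<and> t' + 50 * fst s' 4 \<le> t + 50 * n + 2)"
  have "vc w S (While (Reg 4) ?body) Q (r(4 := n), m) (t + 2)"
  proof (rule vc_While[where Inv = J and B = "t + 50 * n + 2", OF _ Sw])
    show "J (r(4 := n), m) (t + 2)" using r by (simp add: J_def)
    fix s' t'
    assume J: "J s' t'"
    show "t' \<le> t + 50 * n + 2 \<and> safe S s' (Reg 4)" using J by (auto simp: J_def)
    {
      assume "ev s' (Reg 4) \<noteq> 0"
      then obtain j where j: "fst s' 4 = Suc j" by (cases "fst s' 4") auto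
      have "j < S" "16 * j < S" "1 < S" "16 < S" using J j S by (auto simp: J_def)
      then show "vc w S ?body J s' (t' + (1 + cost (Reg 4)))"
        using J j by (auto simp: J_def Suc_le_eq)
    }
    assume "ev s' (Reg 4) = 0"
    then show "Q s' (t' + (1 + cost (Reg 4)))"
      using J by (cases s') (auto simp: J_def arr_def intro!: Q)
  qed
  then show ?thesis using r by (simp add: spread_def)
qed

section \<open>The whole program\<close>

text \<open>Lengths are enumerated by their cofactor \<open>l\<close>. The range
  \<open>l \<le> n div M\<close> already means \<open>M \<le> n div l\<close>, so only divisibility
  and the upper bound on the length remain to be tested.\<close>

definition checks :: com where
  "checks =
    For 11 12 (Assign 2 (Op Plus (Reg 11) (Const 1)) ;; Assign 3 (Op Div (Reg 0) (Reg 2)) ;;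
      Cond (Op Equal (Op Times (Reg 2) (Reg 3)) (Reg 0)) (Cond (Op Less (Reg 3) (Reg 10)) check_length Skip) Skip)"

text \<open>The cofactors for which \<open>check_length\<close> has run after \<open>i\<close>
  iterations; they index the sum that bounds the clock.\<close>

definition checked :: "nat \<Rightarrow> nat \<Rightarrow> nat \<Rightarrow> nat set" where
  "checked n M i = {l. 1 \<le> l \<and> l \<le> i \<and> l * (n div l) = n \<and> n div l < 2 * M}"

text \<open>The quotients \<open>n div l\<close> are distinct elements of \<open>{M..<2 * M}\<close>, so there are at most \<open>M\<close> of them.\<close>

lemma checked_sum:
  assumes "1 \<le> M"
  shows "(\<Sum>l\<in>checked n M (n div M). l + n div l) \<le> 3 * n"
proof -
  let ?G = "checked n M (n div M)"
  have fin: "finite ?G" unfolding checked_def by (rule finite_subset[of _ "{..n div M}"]) auto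
  have lM: "l * M \<le> n" if "l \<in> ?G" for l
  proof -
    have "l * M \<le> (n div M) * M" using that by (intro mult_le_mono1) (simp add: checked_def)
    then show ?thesis by (rule order_trans) simp
  qed
  have "(\<lambda>l. n div l) ` ?G \<subseteq> {M..<2 * M}"
    using lM by (fastforce simp: checked_def less_eq_div_iff_mult_less_eq mult.commute)
  moreover have "inj_on (\<lambda>l. n div l) ?G"
  proof (rule inj_onI)
    fix a b assume ab: "a \<in> ?G" "b \<in> ?G" "n div a = n div b"
    then have "a * (n div a) = b * (n div a)" by (simp add: checked_def)
    moreover have "0 < n div a" using lM[OF ab(1)] ab(1) assms
      by (auto simp: checked_def div_greater_zero_iff intro: order_trans[rotated])
    ultimately show "a = b" by simp
  qed
  ultimately have c1: "card ?G \<le> M"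
    using card_inj_on_le[of "\<lambda>l. n div l" ?G "{M..<2 * M}"] by simp
  \<comment> \<open>The cardinality is bounded twice: by \<open>M\<close> for the sum of the
    \<open>l \<le> n div M\<close>, and by \<open>n div M\<close> for the sum of the
    \<open>n div l < 2 * M\<close>.\<close>
  have "?G \<subseteq> {1..n div M}" by (auto simp: checked_def)
  then have c2: "card ?G \<le> n div M" using card_mono[of "{1..n div M}" ?G] by simp
  have "(\<Sum>l\<in>?G. l) \<le> card ?G * (n div M)"
    using sum_bounded_above[of ?G "\<lambda>l. l" "n div M"] by (simp add: checked_def)
  also have "\<dots> \<le> M * (n div M)" using c1 by (rule mult_le_mono1)
  also have "\<dots> \<le> n" by simp
  finally have s1: "(\<Sum>l\<in>?G. l) \<le> n" .
  have "(\<Sum>l\<in>?G. n div l) \<le> card ?G * (2 * M)"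
    using sum_bounded_above[of ?G "\<lambda>l. n div l" "2 * M"] by (simp add: checked_def)
  also have "\<dots> \<le> (n div M) * (2 * M)" using c2 by (rule mult_le_mono1)
  also have "\<dots> = 2 * (M * (n div M))" by simp
  also have "\<dots> \<le> 2 * n" by (simp only: mult_le_mono2 times_div_less_eq_dividend)
  finally show ?thesis using s1 by (simp add: sum.distrib)
qed

lemma vc_checks:
  assumes Sw: "S \<le> 2 ^ w" and S: "64 * n + 64 \<le> S" and n: "n = length x"
    and r: "r 0 = n" "r 1 = M" "r 10 = 2 * M" "r 12 = n div M" and M: "1 \<le> M" "M \<le> n"
    and f: "naming x M (arr m 1)" "\<And>p. valid_index n M p \<Longrightarrow> arr m 1 p < 2 * n + 2"
    and out: "\<And>k. 1 \<le> k \<Longrightarrow> k \<le> n \<Longrightarrow> arr m 8 k = (if cyclic_periodic k x \<and> k < M then 1 else 0)"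
    and Q: "\<And>r' m' t'. frame {2, 3, 4, 5, 6, 7, 8, 9, 11} {2, 3, 4, 5, 6, 7, 8} (r, m) (r', m') \<Longrightarrow>
      (\<And>k. 1 \<le> k \<Longrightarrow> k \<le> n \<Longrightarrow> arr m' 8 k = (if cyclic_periodic k x \<and> k < 2 * M then 1 else 0)) \<Longrightarrow>
      t' \<le> t + 4200 * n + 100 \<Longrightarrow> Q (r', m') t'"
  shows "vc w S checks Q (r, m) t"
proof -
  define cp where "cp = (\<lambda>k. cyclic_periodic k x)"
  \<comment> \<open>\<open>D i k\<close> marks the lengths whose answer may be 1 after
    \<open>i\<close> iterations; all others still have the initial answer 0.\<close>
  define D where "D = (\<lambda>i k. k < M \<or> (k < 2 * M \<and> (\<exists>l. 1 \<le> l \<and> l \<le> i \<and> l * k = n)))"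
  define P where "P = (\<lambda>i r' m' t'. frame {2, 3, 4, 5, 6, 7, 8, 9, 11} {2, 3, 4, 5, 6, 7, 8} (r, m) (r', m') \<and>
    r' 11 = i \<and> i \<le> n div M \<and> (\<forall>k. 1 \<le> k \<longrightarrow> k \<le> n \<longrightarrow> arr m' 8 k = (if cp k \<and> D i k then 1 else 0)) \<and>
    t' \<le> t + 2 + 1100 * i + 1000 * (\<Sum>l\<in>checked n M i. l + n div l))"
  have fin: "finite (checked n M i)" for i
    unfolding checked_def by (rule finite_subset[of _ "{..i}"]) auto
  have nM: "n div M \<le> n" by simp
  show ?thesis
    unfolding checks_def
  proof (rule vc_For_clock[where P = P and N = "n div M" and
        T = "t + 2 + 1100 * (n div M) + 1000 * (\<Sum>l\<in>checked n M (n div M). l + n div l)", OF Sw])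
    show "P 0 (r(11 := 0)) m (t + 2)"
      using out by (auto simp: P_def frame_def D_def cp_def)
    show "n div M < S" "1 < S" using nM S by linarith+
    fix i r' m' t'
    assume P: "P i r' m' t'"
    have fr: "frame {2, 3, 4, 5, 6, 7, 8, 9, 11} {2, 3, 4, 5, 6, 7, 8} (r, m) (r', m')"
      using P by (simp add: P_def)
    have rr: "r' 0 = n" "r' 1 = M" "r' 10 = 2 * M" "r' 12 = n div M" "arr m' 1 = arr m 1" "r' 11 = i"
      using fr r P by (auto simp: frame_def P_def)
    have i: "i \<le> n div M" using P by (simp add: P_def)
    have "checked n M i \<subseteq> checked n M (n div M)" using i by (auto simp: checked_def)
    then have "(\<Sum>l\<in>checked n M i. l + n div l) \<le> (\<Sum>l\<in>checked n M (n div M). l + n div l)"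
      by (intro sum_mono2 fin) auto
    moreover have "t' \<le> t + 2 + 1100 * i + 1000 * (\<Sum>l\<in>checked n M i. l + n div l)"
      using P by (simp add: P_def)
    ultimately have "t' \<le> t + 2 + 1100 * (n div M) + 1000 * (\<Sum>l\<in>checked n M (n div M). l + n div l)"
      using i by linarith
    then show "r' 11 = i \<and> r' 12 = n div M \<and> i \<le> n div M \<and>
        t' \<le> t + 2 + 1100 * (n div M) + 1000 * (\<Sum>l\<in>checked n M (n div M). l + n div l)"
      using rr i by simp
    assume lt: "i < n div M"
    define l where "l = Suc i"
    define k where "k = n div l"
    have l: "1 \<le> l" "l \<le> n" using lt nM unfolding l_def by linarith+
    have "l \<le> n div M" using lt by (simp add: l_def)
    then have lM: "l * M \<le> n" using M(1) by (simp add: less_eq_div_iff_mult_less_eq)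
    then have k: "M \<le> k" "k \<le> n" using l M by (simp_all add: k_def less_eq_div_iff_mult_less_eq mult.commute)
    have lk: "l * k \<le> n" by (simp add: k_def)
    have div_eq: "l * k' = n \<longleftrightarrow> k' = k \<and> l * k = n" for k'
      using l(1) by (auto simp: k_def)
    have D: "D l k' \<longleftrightarrow> D i k' \<or> (l * k = n \<and> k < 2 * M \<and> k' = k)" for k'
      unfolding D_def using div_eq[of k'] l_def le_Suc_eq by (metis le_SucI l(1))
    let ?post = "\<lambda>s' t'. fst s' 11 = i \<and> P (Suc i) ((fst s')(11 := Suc i)) (snd s') (t' + 4)"
    have skip: "P (Suc i) (r'(2 := l, 3 := k, 11 := Suc i)) m' t2"
      if t2: "t2 \<le> t' + 100" and ng: "\<not> (l * k = n \<and> k < 2 * M)" for t2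
    proof -
      have "D (Suc i) k' = D i k'" for k' using D[of k'] ng by (auto simp: l_def)
      moreover have "checked n M (Suc i) = checked n M i"
        using ng by (auto simp: checked_def le_Suc_eq l_def k_def)
      ultimately show ?thesis using P t2 lt rr by (auto simp: P_def frame_def)
    qed
    have chk: "vc w S check_length ?post (r'(2 := l, 3 := k), m') t2"
      if t2: "t2 \<le> t' + 50" and g: "l * k = n" "k < 2 * M" for t2
    proof (rule vc_check_length[where n = n and M = M and l = l and k = k and x = x, OF Sw S n])
      fix r3 m3 t3
      assume f3: "frame {4, 5, 6, 7, 8, 9} {2, 3, 4, 5, 6, 7, 8} (r'(2 := l, 3 := k), m') (r3, m3)"
        and o3: "arr m3 8 = (arr m' 8)(k := (if cyclic_periodic k x then 1 else 0))"
        and t3: "t3 \<le> t2 + 1000 * (l + k) + 1000"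
      have "checked n M (Suc i) = insert l (checked n M i)" "l \<notin> checked n M i"
        using g by (auto simp: checked_def le_Suc_eq l_def k_def)
      then have "(\<Sum>l\<in>checked n M (Suc i). l + n div l) = l + k + (\<Sum>l\<in>checked n M i. l + n div l)"
        using fin by (simp add: k_def)
      then have "t3 + 4 \<le> t + 2 + 1100 * Suc i + 1000 * (\<Sum>l\<in>checked n M (Suc i). l + n div l)"
        using P t2 t3 by (simp add: P_def)
      moreover have "arr m3 8 k' = (if cp k' \<and> D (Suc i) k' then 1 else 0)" if "1 \<le> k'" "k' \<le> n" for k'
        using P that o3 D[of k'] g by (auto simp: P_def cp_def l_def)
      moreover have "frame {2, 3, 4, 5, 6, 7, 8, 9, 11} {2, 3, 4, 5, 6, 7, 8} (r, m) (r3(11 := Suc i), m3)"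
        using fr f3 by (auto simp: frame_def)
      moreover have "r3 11 = i" using f3 rr by (simp add: frame_def)
      ultimately show "?post (r3, m3) t3" using lt by (simp add: P_def)
    qed (use rr k f g M in auto)
    have bS: "i + 1 < S" "l * k < S" "k < S" "1 < S" using l lk k S by (auto simp: l_def)
    have e: "n div l = k" by (simp add: k_def)
    show "vc w S (Assign 2 (Op Plus (Reg 11) (Const 1)) ;; Assign 3 (Op Div (Reg 0) (Reg 2)) ;;
      Cond (Op Equal (Op Times (Reg 2) (Reg 3)) (Reg 0)) (Cond (Op Less (Reg 3) (Reg 10)) check_length Skip) Skip)
      ?post (r', m') (t' + 4)"
      using skip chk rr bS e l_def
      by (cases "l * k = n"; cases "k < 2 * M") simp_all
  next
    fix r' m' t'
    assume P: "P (n div M) r' m' t'"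
    have D: "cp k \<and> D (n div M) k \<longleftrightarrow> cp k \<and> k < 2 * M" if "1 \<le> k" "k \<le> n" for k
    proof -
      \<comment> \<open>A cyclic periodic length divides \<open>n\<close>, and
        \<open>M \<le> k\<close> puts its cofactor within the range of the loop, so no such length
        is missed.\<close>
      have "\<exists>l. 1 \<le> l \<and> l \<le> n div M \<and> l * k = n" if "cp k" "M \<le> k"
      proof -
        obtain l where l: "k * l = n" using \<open>cp k\<close> n
          by (auto simp: cp_def cyclic_periodic_def has_cyclic_period_def)
        have "l * M \<le> l * k" using \<open>M \<le> k\<close> by (rule mult_le_mono2)
        then have "l * M \<le> n" using l by (simp add: mult.commute)
        then have "l \<le> n div M" using M by (simp add: less_eq_div_iff_mult_less_eq)
        moreover have "1 \<le> l" using l M by (cases l) auto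
        ultimately show ?thesis using l by (auto simp: mult.commute)
      qed
      then show ?thesis unfolding D_def using not_le by auto
    qed
    show "Q (r', m') (t' + 4)"
    proof (rule Q)
      have "t' \<le> t + 2 + 1100 * (n div M) + 1000 * (\<Sum>l\<in>checked n M (n div M). l + n div l)"
        using P unfolding P_def by blast
      \<comment> \<open>At most \<open>n\<close> iterations at 1100 each and 1000 times a sum of at
        most \<open>3 * n\<close> give \<open>4100 * n\<close> plus a constant.\<close>
      then show "t' + 4 \<le> t + 4200 * n + 100" using checked_sum[OF M(1), of n] nM by linarith
      show "arr m' 8 k = (if cyclic_periodic k x \<and> k < 2 * M then 1 else 0)" if "1 \<le> k" "k \<le> n" for k
        using P D[OF that] that by (auto simp: P_def cp_def)
    qed (use P in \<open>simp add: P_def\<close>)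
  qed
qed

text \<open>The checks come before \<open>next_level\<close>, which replaces the names in array 1.
  In the last round \<open>2 * M\<close> exceeds \<open>n\<close>; no index is valid then, and the
  naming invariant holds vacuously.\<close>

definition levels :: com where
  "levels =
    Assign 1 (Const 1) ;;
    While (Op Less (Reg 1) (Op Plus (Reg 0) (Const 1)))
      (Assign 10 (Op Times (Const 2) (Reg 1)) ;;
       Assign 12 (Op Div (Reg 0) (Reg 1)) ;;
       checks ;;
       next_level ;;
       Assign 1 (Reg 10))"

lemma vc_levels:
  assumes Sw: "S \<le> 2 ^ w" and S: "64 * n + 64 \<le> S" and K: "n < 2 ^ K" and n: "n = length x" and r: "r 0 = n"
    and f: "naming x 1 (arr m 1)" "\<And>p. valid_index n 1 p \<Longrightarrow> arr m 1 p < 2 * n + 2"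
    and out: "\<And>k. 1 \<le> k \<Longrightarrow> k \<le> n \<Longrightarrow> arr m 8 k = 0"
    and Q: "\<And>r' m' t'. r' 0 = n \<Longrightarrow>
      (\<And>k. 1 \<le> k \<Longrightarrow> k \<le> n \<Longrightarrow> arr m' 8 k = (if cyclic_periodic k x then 1 else 0)) \<Longrightarrow>
      t' \<le> t + 7000 * (n + 1) * (K + 1) \<Longrightarrow> Q (r', m') t'"
  shows "vc w S levels Q (r, m) t"
proof -
  let ?body = "Assign 10 (Op Times (Const 2) (Reg 1)) ;; Assign 12 (Op Div (Reg 0) (Reg 1)) ;;
       checks ;; next_level ;; Assign 1 (Reg 10)"
  let ?g = "Op Less (Reg 1) (Op Plus (Reg 0) (Const 1))"
  define J where "J = (\<lambda>j (r' :: nat \<Rightarrow> nat) m'. r' 0 = n \<and> r' 1 = 2 ^ j \<and> j \<le> K \<and>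
    naming x (2 ^ j) (arr m' 1) \<and> (\<forall>p. valid_index n (2 ^ j) p \<longrightarrow> arr m' 1 p < 2 * n + 2) \<and>
    (\<forall>k. 1 \<le> k \<longrightarrow> k \<le> n \<longrightarrow> arr m' 8 k = (if cyclic_periodic k x \<and> k < 2 ^ j then 1 else 0)))"
  have step: "vc w S ?body (\<lambda>s' t'. J (Suc j) (fst s') (snd s') \<and> t' \<le> t + 6900 * n + 3000) (r1, m1) (t + 6)"
    if J: "J j r1 m1" and le: "2 ^ j \<le> n" for j r1 m1 t
  proof -
    define M where "M = (2::nat) ^ j"
    have M: "1 \<le> M" "M \<le> n" using le by (simp_all add: M_def)
    have "(2::nat) ^ j < 2 ^ K" using K le by linarith
    then have jK: "j < K" by (simp add: power_strict_increasing_iff)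
    have rr: "r1 0 = n" "r1 1 = M" using J by (simp_all add: J_def M_def)
    have JM: "naming x M (arr m1 1)" "\<And>p. valid_index n M p \<Longrightarrow> arr m1 1 p < 2 * n + 2"
      "\<And>k. 1 \<le> k \<Longrightarrow> k \<le> n \<Longrightarrow> arr m1 8 k = (if cyclic_periodic k x \<and> k < M then 1 else 0)"
      using J unfolding J_def M_def by blast+
    have "vc w S checks (vc w S next_level (vc w S (Assign 1 (Reg 10))
        (\<lambda>s' t'. J (Suc j) (fst s') (snd s') \<and> t' \<le> t + 6900 * n + 3000))) (r1(10 := 2 * M, 12 := n div M), m1) t2"
      if t2: "t2 \<le> t + 40" for t2
    proof (rule vc_checks[where n = n and M = M and x = x, OF Sw S n])
      fix r3 m3 t3
      assume f3: "frame {2, 3, 4, 5, 6, 7, 8, 9, 11} {2, 3, 4, 5, 6, 7, 8} (r1(10 := 2 * M, 12 := n div M), m1) (r3, m3)"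
        and o3: "\<And>k. 1 \<le> k \<Longrightarrow> k \<le> n \<Longrightarrow> arr m3 8 k = (if cyclic_periodic k x \<and> k < 2 * M then 1 else 0)"
        and t3: "t3 \<le> t2 + 4200 * n + 100"
      have r3: "r3 0 = n" "r3 1 = M" "r3 10 = 2 * M" "arr m3 1 = arr m1 1"
        using f3 rr by (simp_all add: frame_def)
      show "vc w S next_level (vc w S (Assign 1 (Reg 10))
        (\<lambda>s' t'. J (Suc j) (fst s') (snd s') \<and> t' \<le> t + 6900 * n + 3000)) (r3, m3) t3"
      proof (rule vc_next_level[where n = n and M = M and x = x, OF Sw S n])
        fix r4 m4 :: "nat \<Rightarrow> nat" and t4
        assume f4: "frame {2, 3, 4, 5, 6, 7, 8, 9} {1, 2, 3, 4, 5, 6, 7} (r3, m3) (r4, m4)"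
          and nm: "naming x (2 * M) (arr m4 1)" "\<And>p. valid_index n (2 * M) p \<Longrightarrow> arr m4 1 p < 2 * n + 2"
          and t4: "t4 \<le> t3 + 2000 * n + 2000"
        have r4: "r4 0 = n" "r4 10 = 2 * M" "arr m4 8 = arr m3 8"
          using f4 r3 by (simp_all add: frame_def)
        have "J (Suc j) (r4(1 := 2 * M)) m4"
          using r4 nm o3 jK by (simp add: J_def M_def)
        moreover have "t4 + 2 \<le> t + 6900 * n + 3000" using t2 t3 t4 by simp
        ultimately show "vc w S (Assign 1 (Reg 10))
          (\<lambda>s' t'. J (Suc j) (fst s') (snd s') \<and> t' \<le> t + 6900 * n + 3000) (r4, m4) t4"
          using r4 by simp
      qed (use r3 M JM in auto)
    qed (use rr M JM in auto)
    moreover have "2 * M < S" "n div M < S" using M(2) S order_le_less_trans[OF div_le_dividend, of n S M] by linarith+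
    ultimately show ?thesis using rr S by (simp add: vc_Seq del: vc.simps(4))
  qed
  have "vc w S (While ?g ?body) Q (r(1 := 1), m) (t + 2)"
  proof (rule vc_While[where B = "t + 2 + (6900 * n + 3000) * K" and
      Inv = "\<lambda>s' t'. \<exists>j. J j (fst s') (snd s') \<and> t' \<le> t + 2 + (6900 * n + 3000) * j", OF _ Sw])
    have "J 0 (r(1 := 1)) m" using r f out by (auto simp: J_def)
    then show "\<exists>j. J j (fst (r(1 := 1), m)) (snd (r(1 := 1), m)) \<and> t + 2 \<le> t + 2 + (6900 * n + 3000) * j"
      by auto
    fix s' t'
    assume "\<exists>j. J j (fst s') (snd s') \<and> t' \<le> t + 2 + (6900 * n + 3000) * j"
    then obtain r' m' j where s': "s' = (r', m')" and J: "J j r' m'" and t': "t' \<le> t + 2 + (6900 * n + 3000) * j"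
      by (cases s') auto
    have rr: "r' 0 = n" "r' 1 = 2 ^ j" "j \<le> K" using J by (simp_all add: J_def)
    have le: "(6900 * n + 3000) * j \<le> (6900 * n + 3000) * K" using rr(3) by (rule mult_le_mono2)
    have tB: "t' \<le> t + 2 + (6900 * n + 3000) * K" using t' le by linarith
    then show "t' \<le> t + 2 + (6900 * n + 3000) * K \<and> safe S s' ?g"
      using rr S s' by simp
    {
      assume "ev s' ?g \<noteq> 0"
      then have lt: "2 ^ j \<le> n" using rr s' by (simp split: if_splits)
      have "vc w S ?body (\<lambda>s' t'. \<exists>j. J j (fst s') (snd s') \<and> t' \<le> t + 2 + (6900 * n + 3000) * j) (r', m') (t' + 6)"
      proof (rule vc_mono[OF step[OF J lt]])
        fix s2 t2
        assume "J (Suc j) (fst s2) (snd s2) \<and> t2 \<le> t' + 6900 * n + 3000"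
        moreover from this t' have "t2 \<le> t + 2 + (6900 * n + 3000) * Suc j" by simp
        ultimately show "\<exists>j. J j (fst s2) (snd s2) \<and> t2 \<le> t + 2 + (6900 * n + 3000) * j" by blast
      qed
      moreover have "1 + cost ?g = 6" by simp
      ultimately show "vc w S ?body (\<lambda>s' t'. \<exists>j. J j (fst s') (snd s') \<and> t' \<le> t + 2 + (6900 * n + 3000) * j) s'
          (t' + (1 + cost ?g))"
        unfolding s' by (simp only:)
    }
    assume "ev s' ?g = 0"
    then have gt: "n < 2 ^ j" using rr s' by (simp split: if_splits)
    show "Q s' (t' + (1 + cost ?g))"
      unfolding s'
    proof (rule Q)
      show "r' 0 = n" by fact
      show "arr m' 8 k = (if cyclic_periodic k x then 1 else 0)" if "1 \<le> k" "k \<le> n" for k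
        using J that gt by (simp add: J_def)
      have "(6900 * n + 3000) * K \<le> (7000 * n + 7000) * K" by (rule mult_le_mono1) simp
      then show "t' + (1 + cost ?g) \<le> t + 7000 * (n + 1) * (K + 1)"
        using tB by (simp add: algebra_simps)
    qed
  qed
  then show ?thesis using S by (simp add: levels_def)
qed

text \<open>
  The cells \<open>1, \<dots>, n\<close> overlap the arrays, but answer \<open>k\<close> is read from cell \<open>16 * k + 8\<close>, beyond all
  cells written before.
\<close>

definition write_results :: com where
  "write_results = For 4 0 (Store (Op Plus (Reg 4) (Const 1)) (Ld 8 (Op Plus (Reg 4) (Const 1))))"

lemma vc_write_results:
  assumes Sw: "S \<le> 2 ^ w" and S: "64 * n + 64 \<le> S" and r: "r 0 = n"
    and Q: "\<And>r' m' t'. (\<And>k. 1 \<le> k \<Longrightarrow> k \<le> n \<Longrightarrow> m' k = arr m 8 k) \<Longrightarrow> t' \<le> t + 50 * n + 50 \<Longrightarrow> Q (r', m') t'"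
  shows "vc w S write_results Q (r, m) t"
proof -
  define P where "P = (\<lambda>i (r' :: nat \<Rightarrow> nat) m'. r' 4 = i \<and> r' 0 = n \<and> (\<forall>k. 1 \<le> k \<longrightarrow> k \<le> i \<longrightarrow> m' k = arr m 8 k) \<and>
    (\<forall>k>i. m' k = m k))"
  show ?thesis
    unfolding write_results_def
  proof (rule vc_For[where P = P and N = n and C = 40, OF Sw])
    show "vc w S (Store (Op Plus (Reg 4) (Const 1)) (Ld 8 (Op Plus (Reg 4) (Const 1))))
      (\<lambda>s' t'. fst s' 4 = i \<and> P (Suc i) ((fst s')(4 := Suc i)) (snd s') \<and> t' \<le> t + 40) (r', m') t"
      if P: "P i r' m'" and i: "i < n" for i r' m' t
    proof -
      have "arr m' 8 (Suc i) = arr m 8 (Suc i)" using P by (simp add: P_def arr_def)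
      then have "P (Suc i) (r'(4 := Suc i)) (m'(Suc i := arr m' 8 (Suc i)))"
        using P by (auto simp: P_def le_Suc_eq)
      moreover have "r' 4 = i" "i + 1 < S" "16 * (i + 1) + 8 < S" "1 < S" "16 < S"
        using P i S by (auto simp: P_def)
      ultimately show ?thesis by simp
    qed
  qed (use r S Q in \<open>auto simp: P_def\<close>)
qed

definition cyclic_periods :: com where
  "cyclic_periods = spread ;; sort_letters ;; name_letters ;; levels ;; write_results"

lemma vc_cyclic_periods:
  assumes Sw: "S \<le> 2 ^ w" and S: "64 * n + 64 \<le> S" and K: "n < 2 ^ K" and n: "n = length x"
    and r: "r 0 = n" and m: "\<And>i. i < n \<Longrightarrow> m i = x ! i"
    and Q: "\<And>r' m' t'. all_cyclic_periodicities x m' \<Longrightarrow> t' \<le> 9000 * (n + 1) * (K + 1) \<Longrightarrow> Q (r', m') t'"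
  shows "vc w S cyclic_periods Q (r, m) 0"
  unfolding cyclic_periods_def vc.simps(4)
proof (rule vc_spread[where n = n and r = r, OF Sw S r])
  fix r1 m1 :: "nat \<Rightarrow> nat" and t1
  assume r1: "r1 0 = n" and m1: "\<And>i. i < n \<Longrightarrow> arr m1 0 i = m i" and t1: "t1 \<le> 0 + 50 * n + 50"
  show "vc w S sort_letters (vc w S name_letters (vc w S levels (vc w S write_results Q))) (r1, m1) t1"
  proof (rule vc_sort_letters[where n = n and V = "arr m1 0" and r = r1 and m = m1, OF Sw S K r1 refl])
    fix r2 m2 t2
    assume f2: "frame {1, 2, 3, 4, 5, 6, 7, 8} {9, 10} (r1, m1) (r2, m2)"
      and s2: "sorted_run (arr m1 0) (arr m2 9) 0 n" "arr m2 9 ` {0..<n} = {0..<n}"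
      and t2: "t2 \<le> t1 + 700 * (n + 1) * (K + 1)"
    have m2: "arr m2 0 = arr m1 0" and r2: "r2 0 = n" using f2 r1 by (simp_all add: frame_def)
    show "vc w S name_letters (vc w S levels (vc w S write_results Q)) (r2, m2) t2"
    proof (rule vc_name_letters[where n = n and r = r2, OF Sw S n r2])
      fix r3 m3 t3
      assume f3: "frame {4, 5, 8} {1, 8} (r2, m2) (r3, m3)"
        and nm: "naming x 1 (arr m3 1)" "\<And>p. valid_index n 1 p \<Longrightarrow> arr m3 1 p < 2 * n + 2"
        and o3: "\<And>k. 1 \<le> k \<Longrightarrow> k \<le> n \<Longrightarrow> arr m3 8 k = 0" and t3: "t3 \<le> t2 + 200 * n + 100"
      have r3: "r3 0 = n" using f3 r2 by (simp add: frame_def)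
      show "vc w S levels (vc w S write_results Q) (r3, m3) t3"
      proof (rule vc_levels[where n = n and r = r3 and m = m3, OF Sw S K n r3 nm o3])
        fix r4 m4 :: "nat \<Rightarrow> nat" and t4
        assume r4: "r4 0 = n"
          and o4: "\<And>k. 1 \<le> k \<Longrightarrow> k \<le> n \<Longrightarrow> arr m4 8 k = (if cyclic_periodic k x then 1 else 0)"
          and t4: "t4 \<le> t3 + 7000 * (n + 1) * (K + 1)"
        show "vc w S write_results Q (r4, m4) t4"
        proof (rule vc_write_results[where n = n and r = r4, OF Sw S r4])
          fix r5 m5 :: "nat \<Rightarrow> nat" and t5
          assume o5: "\<And>k. 1 \<le> k \<Longrightarrow> k \<le> n \<Longrightarrow> m5 k = arr m4 8 k" and t5: "t5 \<le> t4 + 50 * n + 50"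
          show "Q (r5, m5) t5"
          proof (rule Q)
            show "all_cyclic_periodicities x m5"
              using o5 o4 n by (simp add: all_cyclic_periodicities_def)
            show "t5 \<le> 9000 * (n + 1) * (K + 1)"
              using t1 t2 t3 t4 t5 by (simp add: algebra_simps)
          qed
        qed
      qed
    qed (use m2 m1 m s2 in simp_all)
  qed
qed

lemma cyclic_periods_solves: "solves_within cyclic_periods all_cyclic_periodicities
  (\<lambda>n. 9000 * (n + 1) * (floor_log n + 2)) (\<lambda>n. 64 * n + 64)"
  unfolding solves_within_def
proof (intro allI impI)
  fix w and x :: "nat list"
  define n where "n = length x"
  assume "length x < 2 ^ w \<and> 64 * length x + 64 \<le> 2 ^ w \<and> (\<forall>a\<in>set x. a < 2 ^ w)"
  then have Sw: "64 * n + 64 \<le> 2 ^ w" by (simp add: n_def)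
  \<comment> \<open>This also covers the empty string; the factor \<open>K + 1\<close> becomes
    \<open>floor_log n + 2\<close>.\<close>
  have K: "n < 2 ^ (floor_log n + 1)" using floor_log_exp2_gt[of n] by simp
  have "vc w (64 * n + 64) cyclic_periods (\<lambda>s' t'. all_cyclic_periodicities x (snd s') \<and>
      t' \<le> 9000 * (n + 1) * (floor_log n + 2)) (initial_state x) 0"
    unfolding initial_state_def
    by (rule vc_cyclic_periods[OF Sw order_refl K n_def]) (auto simp: n_def)
  from vc_wp[OF this Sw]
  show "\<exists>t r m. exec w (64 * length x + 64) cyclic_periods (initial_state x) t (r, m) \<and>
      t \<le> 9000 * (length x + 1) * (floor_log (length x) + 2) \<and> all_cyclic_periodicities x m"
    unfolding wp_def n_def by force
qed

section \<open>Asymptotic bounds\<close>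

lemma running_time_bound: "(\<lambda>n. real (9000 * (n + 1) * (floor_log n + 2))) \<in> O(\<lambda>n. real n * ln (real n))"
\<comment> \<open>For \<open>2 \<le> n\<close>, \<open>9000 * (n + 1)\<close> is at most
  \<open>18000 * n\<close> and \<open>floor_log n + 2\<close> at most three times the binary
  logarithm; dividing by \<open>ln 2\<close> changes the base.\<close>
proof (rule bigoI[where c = "54000 / ln 2"], rule eventually_mono[OF eventually_ge_at_top[of 2]])
  fix n :: nat assume n: "2 \<le> n"
  have l: "1 \<le> log 2 (real n)" using n by simp
  have "real (floor_log n) \<le> log 2 (real n)" using n by (simp add: floor_log_altdef)
  then have "real (floor_log n + 2) \<le> 3 * log 2 (real n)" using l by simp
  moreover have "real (9000 * (n + 1)) \<le> 18000 * real n" using n by simp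
  ultimately have "real (9000 * (n + 1)) * real (floor_log n + 2) \<le> (18000 * real n) * (3 * log 2 (real n))"
    by (intro mult_mono) simp_all
  also have "\<dots> = 54000 / ln 2 * (real n * ln (real n))" by (simp add: log_def)
  finally show "norm (real (9000 * (n + 1) * (floor_log n + 2))) \<le> 54000 / ln 2 * norm (real n * ln (real n))"
    using n by (simp only: of_nat_mult) simp
qed

lemma space_bound: "(\<lambda>n. real (64 * n + 64)) \<in> O(\<lambda>n. real n)"
  by (rule bigoI[where c = 128], rule eventually_mono[OF eventually_ge_at_top[of 1]]) simp

theorem theorem2:
  "\<exists>(P :: com) (T :: nat \<Rightarrow> nat) (S :: nat \<Rightarrow> nat).
     (\<lambda>n. real (T n)) \<in> O(\<lambda>n. real n * ln (real n)) \<and>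
     (\<lambda>n. real (S n)) \<in> O(\<lambda>n. real n) \<and>
     solves_within P all_cyclic_periodicities T S"
  by (intro exI[of _ cyclic_periods] exI[of _ "\<lambda>n. 9000 * (n + 1) * (floor_log n + 2)"]
      exI[of _ "\<lambda>n. 64 * n + 64"] conjI running_time_bound space_bound cyclic_periods_solves)

end
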